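(* Let $\mathbb K$ be a field. Consider two crossed biextensions $$X:\ 0\to B\xrightarrow{j}A_2\xrightarrow{\partial}A_1\xrightarrow{p}C\to0,\qquad X':\ 0\to B'\xrightarrow{j'}A_2'\xrightarrow{\partial'}A_1'\xrightarrow{p'}C'\to0$$ of unital associative $\mathbb K$-algebras, with associated elements $[\epsilon]\in\mathcal H^3_H(C,B)$ and $[\epsilon']\in\mathcal H^3_H(C',B')$ respectively, and a morphism $\underline\varphi=(\varphi_0,\varphi)\colon(C,B)\to(C',B')$ of bimodules. Regard $B'$ as a $C$-bimodule by pulling back its $C'$-bimodule structure along $\varphi_0$. Then: (i) there exists a crossed bimodule butterfly $\widehat E$ from $X$ to $X'$ with $P([\widehat E])=\underline\varphi$ if and only if $[\varphi\cdot\epsilon]=[\epsilon'\cdot(\varphi_0\otimes\varphi_0\otimes\varphi_0)]$ in $\mathcal H^3_H(C,B')$; (ii) if the set $[\mathsf{BXBiext}]_{\underline\varphi}(X,X')$ of isomorphism classes of crossed bimodule butterflies $\widehat E$ from $X$ to $X'$ with $P([\widehat E])=\underline\varphi$ is not empty, it is a simply transitive $\mathcal H^2_H(C,B')$-set.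
   Context: All algebras are over $\mathbb K$. A bimodule over a unital associative algebra $C$ is a $\mathbb K$-vector space with left and right unital $\mathbb K$-bilinear actions with $(c*b)*c'=c*(b*c')$; a morphism $(\varphi_0,\varphi)\colon(C,B)\to(C',B')$ is a unital algebra morphism $\varphi_0$ with a linear map $\varphi$ compatible with both actions. $\mathcal H^n_H$ denotes Hochschild cohomology (over $\mathbb K$). A crossed bimodule is a morphism $\partial\colon A_2\to A_1$ of $A_1$-bimodules, with $A_1$ a unital associative algebra, such that $\partial(a)*a'=a*\partial(a')$ for all $a,a'\in A_2$. A crossed biextension is an exact sequence $0\to B\xrightarrow{j}A_2\xrightarrow{\partial}A_1\xrightarrow{p}C\to0$ of $\mathbb K$-vector spaces with $p$ a surjective morphism of unital associative algebras and $\partial$ a crossed bimodule. It induces a $C$-bimodule structure on $B$ by $j(p(a_1)*b)=a_1*j(b)$, $j(b*p(a_1))=j(b)*a_1$. The associated class $[\epsilon]\in\mathcal H^3_H(C,B)$ is the class of the cocycle $\epsilon\colon C\otimes C\otimes C\to B$ obtained by choosing linear sections $s$ of $p$ and $q$ of $A_2\to\operatorname{im}\partial$, setting $f(c,c')=q(s(c)s(c')-s(cc'))$ and $j\epsilon(c,c',c'')=s(c)*f(c',c'')-f(cc',c'')+f(c,c'c'')-f(c,c')*s(c'')$. A crossed bimodule butterfly $\widehat E$ from $X$ to $X'$ consists of a unital associative algebra $E$ and maps $\kappa\colon A_2\to E$, $\iota\colon A_2'\to E$, $\delta\colon E\to A_1$, $\gamma\colon E\to A_1'$ with $\delta\kappa=\partial$,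 $\gamma\iota=\partial'$, such that: (1) $\delta$ is a surjective morphism of unital algebras and $\iota$ is its kernel in $\mathbb K$-vector spaces; (2) $\gamma$ is a morphism of unital algebras, $\kappa$ is $\mathbb K$-linear and $\gamma\kappa=0$; (3) for all $a\in A_2$, $a'\in A_2'$, $e\in E$: $\iota(a'*\gamma(e))=\iota(a')e$, $\iota(\gamma(e)*a')=e\iota(a')$, $\kappa(a*\delta(e))=\kappa(a)e$, $\kappa(\delta(e)*a)=e\kappa(a)$. Two butterflies are isomorphic if there is a unital algebra morphism $\alpha\colon E\to E'$ (necessarily an isomorphism) commuting with the $\kappa$'s, $\iota$'s, $\delta$'s and $\gamma$'s. Isomorphism classes of butterflies are the arrows of the category $[\mathsf{BXBiext}]$ whose objects are the crossed biextensions. $P([\widehat E])=(\varphi_0,\varphi)$ is the morphism of bimodules determined by $\varphi_0(p\delta(e))=p'\gamma(e)$ for $e\in E$ and $\kappa(j(b))+\iota(j'(\varphi(b)))=0$ for $b\in B$. A simply transitive $\Gamma$-set is a set on which the group $\Gamma$ acts so that for any two elements exactly one group element carries the first to the second. *)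

theory Defs
  imports "HOL-Algebra.Module" "HOL-Algebra.Group_Action"
begin

section \<open>Algebras, bimodules and their morphisms\<close>

text \<open>
  A vector space over a field \<open>K\<close> is a module over \<open>K\<close> in the sense of HOL-Algebra; the fields
  \<open>mult\<close> and \<open>one\<close> of its record are then irrelevant.  The locale \<open>algebra\<close> of HOL-Algebra only
  covers commutative algebras.  As in \<open>ring\<close>, the zero algebra is allowed.
\<close>

locale assoc_algebra = module K A + ring A
  for K (structure) and A (structure) +
  assumes smult_mult_left:
      "\<lbrakk>k \<in> carrier K; x \<in> carrier A; y \<in> carrier A\<rbrakk> \<Longrightarrow>
        (k \<odot>\<^bsub>A\<^esub> x) \<otimes>\<^bsub>A\<^esub> y = k \<odot>\<^bsub>A\<^esub> (x \<otimes>\<^bsub>A\<^esub> y)"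
    and smult_mult_right:
      "\<lbrakk>k \<in> carrier K; x \<in> carrier A; y \<in> carrier A\<rbrakk> \<Longrightarrow>
        x \<otimes>\<^bsub>A\<^esub> (k \<odot>\<^bsub>A\<^esub> y) = k \<odot>\<^bsub>A\<^esub> (x \<otimes>\<^bsub>A\<^esub> y)"

definition linear_maps ::
  "('k, 'r) ring_scheme \<Rightarrow> ('k, 'v, 's) module_scheme \<Rightarrow> ('k, 'w, 't) module_scheme \<Rightarrow> ('v \<Rightarrow> 'w) set"
where
  "linear_maps K V W = {f \<in> carrier V \<rightarrow> carrier W.
     (\<forall>x\<in>carrier V. \<forall>y\<in>carrier V. f (x \<oplus>\<^bsub>V\<^esub> y) = f x \<oplus>\<^bsub>W\<^esub> f y) \<and>
     (\<forall>k\<in>carrier K. \<forall>x\<in>carrier V. f (k \<odot>\<^bsub>V\<^esub> x) = k \<odot>\<^bsub>W\<^esub> f x)}"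

definition algebra_homs ::
  "('k, 'r) ring_scheme \<Rightarrow> ('k, 'v, 's) module_scheme \<Rightarrow> ('k, 'w, 't) module_scheme \<Rightarrow> ('v \<Rightarrow> 'w) set"
where
  "algebra_homs K A A' = ring_hom A A' \<inter> linear_maps K A A'"

record ('k, 'b, 'c) bimodule = "('k, 'b) module" +
  lact :: "'c \<Rightarrow> 'b \<Rightarrow> 'b"
  ract :: "'b \<Rightarrow> 'c \<Rightarrow> 'b"

locale bimodule =
  C?: assoc_algebra K C + B?: module K B
  for K :: "('k, 'r) ring_scheme" (structure) and C :: "('k, 'c, 's) module_scheme" (structure)
    and B :: "('k, 'b, 'c, 'z) bimodule_scheme" (structure) +
  assumes lact_closed: "\<lbrakk>c \<in> carrier C; b \<in> carrier B\<rbrakk> \<Longrightarrow> lact B c b \<in> carrier B"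
    and ract_closed: "\<lbrakk>c \<in> carrier C; b \<in> carrier B\<rbrakk> \<Longrightarrow> ract B b c \<in> carrier B"
    and lact_add_left: "\<lbrakk>c \<in> carrier C; c' \<in> carrier C; b \<in> carrier B\<rbrakk> \<Longrightarrow>
          lact B (c \<oplus>\<^bsub>C\<^esub> c') b = lact B c b \<oplus>\<^bsub>B\<^esub> lact B c' b"
    and lact_add_right: "\<lbrakk>c \<in> carrier C; b \<in> carrier B; b' \<in> carrier B\<rbrakk> \<Longrightarrow>
          lact B c (b \<oplus>\<^bsub>B\<^esub> b') = lact B c b \<oplus>\<^bsub>B\<^esub> lact B c b'"
    and lact_smult_left: "\<lbrakk>k \<in> carrier K; c \<in> carrier C; b \<in> carrier B\<rbrakk> \<Longrightarrow>
          lact B (k \<odot>\<^bsub>C\<^esub> c) b = k \<odot>\<^bsub>B\<^esub> lact B c b"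
    and lact_smult_right: "\<lbrakk>k \<in> carrier K; c \<in> carrier C; b \<in> carrier B\<rbrakk> \<Longrightarrow>
          lact B c (k \<odot>\<^bsub>B\<^esub> b) = k \<odot>\<^bsub>B\<^esub> lact B c b"
    and ract_add_left: "\<lbrakk>c \<in> carrier C; b \<in> carrier B; b' \<in> carrier B\<rbrakk> \<Longrightarrow>
          ract B (b \<oplus>\<^bsub>B\<^esub> b') c = ract B b c \<oplus>\<^bsub>B\<^esub> ract B b' c"
    and ract_add_right: "\<lbrakk>c \<in> carrier C; c' \<in> carrier C; b \<in> carrier B\<rbrakk> \<Longrightarrow>
          ract B b (c \<oplus>\<^bsub>C\<^esub> c') = ract B b c \<oplus>\<^bsub>B\<^esub> ract B b c'"
    and ract_smult_left: "\<lbrakk>k \<in> carrier K; c \<in> carrier C; b \<in> carrier B\<rbrakk> \<Longrightarrow>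
          ract B (k \<odot>\<^bsub>B\<^esub> b) c = k \<odot>\<^bsub>B\<^esub> ract B b c"
    and ract_smult_right: "\<lbrakk>k \<in> carrier K; c \<in> carrier C; b \<in> carrier B\<rbrakk> \<Longrightarrow>
          ract B b (k \<odot>\<^bsub>C\<^esub> c) = k \<odot>\<^bsub>B\<^esub> ract B b c"
    and lact_one: "b \<in> carrier B \<Longrightarrow> lact B \<one>\<^bsub>C\<^esub> b = b"
    and ract_one: "b \<in> carrier B \<Longrightarrow> ract B b \<one>\<^bsub>C\<^esub> = b"
    and lact_mult: "\<lbrakk>c \<in> carrier C; c' \<in> carrier C; b \<in> carrier B\<rbrakk> \<Longrightarrow>
          lact B (c \<otimes>\<^bsub>C\<^esub> c') b = lact B c (lact B c' b)"
    and ract_mult: "\<lbrakk>c \<in> carrier C; c' \<in> carrier C; b \<in> carrier B\<rbrakk> \<Longrightarrow>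
          ract B b (c \<otimes>\<^bsub>C\<^esub> c') = ract B (ract B b c) c'"
    and lact_ract: "\<lbrakk>c \<in> carrier C; c' \<in> carrier C; b \<in> carrier B\<rbrakk> \<Longrightarrow>
          ract B (lact B c b) c' = lact B c (ract B b c')"

definition with_actions ::
  "('k, 'b, 's) module_scheme \<Rightarrow> ('c \<Rightarrow> 'b \<Rightarrow> 'b) \<Rightarrow> ('b \<Rightarrow> 'c \<Rightarrow> 'b) \<Rightarrow> ('k, 'b, 'c) bimodule"
where
  "with_actions V l r =
     \<lparr>carrier = carrier V, monoid.mult = monoid.mult V, one = one V, ring.zero = ring.zero V, ring.add = ring.add V,
      smult = smult V, lact = l, ract = r\<rparr>"

definition regular_bimodule :: "('k, 'a, 's) module_scheme \<Rightarrow> ('k, 'a, 'a) bimodule" where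
  "regular_bimodule A = with_actions A (monoid.mult A) (monoid.mult A)"

definition pullback_bimodule ::
  "('c \<Rightarrow> 'd) \<Rightarrow> ('k, 'b, 'd) bimodule \<Rightarrow> ('k, 'b, 'c) bimodule"
where
  "pullback_bimodule h B = with_actions B (\<lambda>c b. lact B (h c) b) (\<lambda>b c. ract B b (h c))"

definition bimodule_morphism ::
  "('k, 'r) ring_scheme \<Rightarrow> ('k, 'c, 's) module_scheme \<Rightarrow> ('k, 'b, 'c) bimodule \<Rightarrow>
   ('k, 'd, 't) module_scheme \<Rightarrow> ('k, 'e, 'd) bimodule \<Rightarrow> ('c \<Rightarrow> 'd) \<Rightarrow> ('b \<Rightarrow> 'e) \<Rightarrow> bool"
where
  "bimodule_morphism K C B C' B' \<phi>\<^sub>0 \<phi> \<longleftrightarrow>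
     \<phi>\<^sub>0 \<in> algebra_homs K C C' \<and> \<phi> \<in> linear_maps K B B' \<and>
     (\<forall>c\<in>carrier C. \<forall>b\<in>carrier B.
        \<phi> (lact B c b) = lact B' (\<phi>\<^sub>0 c) (\<phi> b) \<and> \<phi> (ract B b c) = ract B' (\<phi> b) (\<phi>\<^sub>0 c))"

section \<open>Hochschild cohomology\<close>

text \<open>
  A linear map from the \<open>n\<close>-th tensor power of \<open>C\<close> to \<open>B\<close> is represented by the corresponding
  \<open>n\<close>-linear map, whose argument is the list of its \<open>n\<close> entries.  Cochains are extensional, i.e.
  equal to \<open>undefined\<close> outside \<open>tuples C n\<close>, so that equality of cochains is equality in HOL.
\<close>

definition tuples :: "('c, 's) partial_object_scheme \<Rightarrow> nat \<Rightarrow> 'c list set" where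
  "tuples C n = {cs. length cs = n \<and> set cs \<subseteq> carrier C}"

definition hoch_cochains ::
  "('k, 'r) ring_scheme \<Rightarrow> ('k, 'c, 's) module_scheme \<Rightarrow> ('k, 'b, 'c) bimodule \<Rightarrow>
   nat \<Rightarrow> ('c list \<Rightarrow> 'b) set"
where
  "hoch_cochains K C B n = {f \<in> tuples C n \<rightarrow>\<^sub>E carrier B.
     \<forall>cs\<in>tuples C n. \<forall>i<n.
       (\<forall>x\<in>carrier C. \<forall>y\<in>carrier C.
          f (cs[i := x \<oplus>\<^bsub>C\<^esub> y]) = f (cs[i := x]) \<oplus>\<^bsub>B\<^esub> f (cs[i := y])) \<and>
       (\<forall>k\<in>carrier K. \<forall>x\<in>carrier C.
          f (cs[i := k \<odot>\<^bsub>C\<^esub> x]) = k \<odot>\<^bsub>B\<^esub> f (cs[i := x]))}"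

definition alternating :: "('b, 's) ring_scheme \<Rightarrow> nat \<Rightarrow> 'b \<Rightarrow> 'b" where
  "alternating B i x = (if even i then x else \<ominus>\<^bsub>B\<^esub> x)"

definition hoch_d ::
  "('k, 'c, 's) module_scheme \<Rightarrow> ('k, 'b, 'c) bimodule \<Rightarrow> nat \<Rightarrow> ('c list \<Rightarrow> 'b) \<Rightarrow> 'c list \<Rightarrow> 'b"
where
  "hoch_d C B n f = (\<lambda>cs\<in>tuples C (Suc n).
     lact B (hd cs) (f (tl cs)) \<oplus>\<^bsub>B\<^esub>
     (\<Oplus>\<^bsub>B\<^esub>i\<in>{..<n}. alternating B (Suc i)
        (f (take i cs @ (cs ! i \<otimes>\<^bsub>C\<^esub> cs ! Suc i) # drop (i + 2) cs))) \<oplus>\<^bsub>B\<^esub>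
     alternating B (Suc n) (ract B (f (butlast cs)) (last cs)))"

definition hoch_cocycles ::
  "('k, 'r) ring_scheme \<Rightarrow> ('k, 'c, 's) module_scheme \<Rightarrow> ('k, 'b, 'c) bimodule \<Rightarrow>
   nat \<Rightarrow> ('c list \<Rightarrow> 'b) set"
where
  "hoch_cocycles K C B n =
     {f \<in> hoch_cochains K C B n. hoch_d C B n f = (\<lambda>cs\<in>tuples C (Suc n). \<zero>\<^bsub>B\<^esub>)}"

definition hoch_coboundaries ::
  "('k, 'r) ring_scheme \<Rightarrow> ('k, 'c, 's) module_scheme \<Rightarrow> ('k, 'b, 'c) bimodule \<Rightarrow>
   nat \<Rightarrow> ('c list \<Rightarrow> 'b) set"
where
  "hoch_coboundaries K C B n =
     (case n of 0 \<Rightarrow> {\<lambda>cs\<in>tuples C 0. \<zero>\<^bsub>B\<^esub>}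
      | Suc m \<Rightarrow> hoch_d C B m ` hoch_cochains K C B m)"

text \<open>The additive group of cocycles, written as a HOL-Algebra (multiplicative) monoid record.\<close>

definition hoch_cocycle_group ::
  "('k, 'r) ring_scheme \<Rightarrow> ('k, 'c, 's) module_scheme \<Rightarrow> ('k, 'b, 'c) bimodule \<Rightarrow>
   nat \<Rightarrow> ('c list \<Rightarrow> 'b) monoid"
where
  "hoch_cocycle_group K C B n =
     \<lparr>carrier = hoch_cocycles K C B n,
      monoid.mult = (\<lambda>f g. \<lambda>cs\<in>tuples C n. f cs \<oplus>\<^bsub>B\<^esub> g cs),
      one = (\<lambda>cs\<in>tuples C n. \<zero>\<^bsub>B\<^esub>)\<rparr>"

definition hochschild_cohomology ::
  "('k, 'r) ring_scheme \<Rightarrow> ('k, 'c, 's) module_scheme \<Rightarrow> ('k, 'b, 'c) bimodule \<Rightarrow>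
   nat \<Rightarrow> ('c list \<Rightarrow> 'b) set monoid"
where
  "hochschild_cohomology K C B n = hoch_cocycle_group K C B n Mod hoch_coboundaries K C B n"

definition hoch_class ::
  "('k, 'r) ring_scheme \<Rightarrow> ('k, 'c, 's) module_scheme \<Rightarrow> ('k, 'b, 'c) bimodule \<Rightarrow>
   nat \<Rightarrow> ('c list \<Rightarrow> 'b) \<Rightarrow> ('c list \<Rightarrow> 'b) set"
where
  "hoch_class K C B n f = hoch_coboundaries K C B n #>\<^bsub>hoch_cocycle_group K C B n\<^esub> f"

section \<open>Crossed bimodules and crossed biextensions\<close>

definition crossed_bimodule ::
  "('k, 'r) ring_scheme \<Rightarrow> ('k, 'a1) module \<Rightarrow> ('k, 'a2, 'a1) bimodule \<Rightarrow> ('a2 \<Rightarrow> 'a1) \<Rightarrow> bool"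
where
  "crossed_bimodule K A1 A2 d \<longleftrightarrow>
     assoc_algebra K A1 \<and> bimodule K A1 A2 \<and>
     bimodule_morphism K A1 A2 A1 (regular_bimodule A1) id d \<and>
     (\<forall>a\<in>carrier A2. \<forall>a'\<in>carrier A2. lact A2 (d a) a' = ract A2 a (d a'))"

record ('k, 'b, 'a2, 'a1, 'c) biext =
  bx_B :: "('k, 'b) module"
  bx_A2 :: "('k, 'a2, 'a1) bimodule"
  bx_A1 :: "('k, 'a1) module"
  bx_C :: "('k, 'c) module"
  bx_j :: "'b \<Rightarrow> 'a2"
  bx_d :: "'a2 \<Rightarrow> 'a1"
  bx_p :: "'a1 \<Rightarrow> 'c"

definition crossed_biextension ::
  "('k, 'r) ring_scheme \<Rightarrow> ('k, 'b, 'a2, 'a1, 'c) biext \<Rightarrow> bool"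
where
  "crossed_biextension K X \<longleftrightarrow>
     module K (bx_B X) \<and> assoc_algebra K (bx_C X) \<and>
     crossed_bimodule K (bx_A1 X) (bx_A2 X) (bx_d X) \<and>
     bx_j X \<in> linear_maps K (bx_B X) (bx_A2 X) \<and>
     bx_p X \<in> algebra_homs K (bx_A1 X) (bx_C X) \<and>
     inj_on (bx_j X) (carrier (bx_B X)) \<and>
     bx_j X ` carrier (bx_B X) = {a \<in> carrier (bx_A2 X). bx_d X a = \<zero>\<^bsub>bx_A1 X\<^esub>} \<and>
     bx_d X ` carrier (bx_A2 X) = {a \<in> carrier (bx_A1 X). bx_p X a = \<zero>\<^bsub>bx_C X\<^esub>} \<and>
     bx_p X ` carrier (bx_A1 X) = carrier (bx_C X)"

text \<open>The \<open>C\<close>-bimodule structure on \<open>B\<close> characterized by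
  \<open>j (p a * b) = a * j b\<close> and \<open>j (b * p a) = j b * a\<close>.\<close>

definition bx_bimodule ::
  "('k, 'b, 'a2, 'a1, 'c) biext \<Rightarrow> ('k, 'b, 'c) bimodule"
where
  "bx_bimodule X = with_actions (bx_B X)
     (\<lambda>c b. THE b'. b' \<in> carrier (bx_B X) \<and>
        (\<exists>a\<in>carrier (bx_A1 X). bx_p X a = c \<and> bx_j X b' = lact (bx_A2 X) a (bx_j X b)))
     (\<lambda>b c. THE b'. b' \<in> carrier (bx_B X) \<and>
        (\<exists>a\<in>carrier (bx_A1 X). bx_p X a = c \<and> bx_j X b' = ract (bx_A2 X) (bx_j X b) a))"

text \<open>
  \<open>associated_cocycle K X \<epsilon>\<close>: \<open>\<epsilon>\<close> is one of the cocycles constructed from linear sections \<open>s\<close> of \<open>p\<close>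
  and \<open>q\<close> of the corestriction of \<open>\<partial>\<close> to its image.  The class associated with \<open>X\<close> is the
  Hochschild class of any such \<open>\<epsilon>\<close>.
\<close>

definition associated_cocycle ::
  "('k, 'r) ring_scheme \<Rightarrow> ('k, 'b, 'a2, 'a1, 'c) biext \<Rightarrow> ('c list \<Rightarrow> 'b) \<Rightarrow> bool"
where
  "associated_cocycle K X \<epsilon> \<longleftrightarrow>
     \<epsilon> \<in> tuples (bx_C X) 3 \<rightarrow>\<^sub>E carrier (bx_B X) \<and>
     (\<exists>s q. s \<in> linear_maps K (bx_C X) (bx_A1 X) \<and>
        (\<forall>c\<in>carrier (bx_C X). bx_p X (s c) = c) \<and>
        q \<in> linear_maps K ((bx_A1 X)\<lparr>carrier := bx_d X ` carrier (bx_A2 X)\<rparr>) (bx_A2 X) \<and>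
        (\<forall>y\<in>bx_d X ` carrier (bx_A2 X). bx_d X (q y) = y) \<and>
        (let f = (\<lambda>c c'. q (s c \<otimes>\<^bsub>bx_A1 X\<^esub> s c' \<ominus>\<^bsub>bx_A1 X\<^esub> s (c \<otimes>\<^bsub>bx_C X\<^esub> c'))) in
         \<forall>c\<in>carrier (bx_C X). \<forall>c'\<in>carrier (bx_C X). \<forall>c''\<in>carrier (bx_C X).
           bx_j X (\<epsilon> [c, c', c'']) =
             lact (bx_A2 X) (s c) (f c' c'')
             \<ominus>\<^bsub>bx_A2 X\<^esub> f (c \<otimes>\<^bsub>bx_C X\<^esub> c') c''
             \<oplus>\<^bsub>bx_A2 X\<^esub> f c (c' \<otimes>\<^bsub>bx_C X\<^esub> c'')
             \<ominus>\<^bsub>bx_A2 X\<^esub> ract (bx_A2 X) (f c c') (s c'')))"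

definition push_cochain ::
  "('k, 'c, 's) module_scheme \<Rightarrow> nat \<Rightarrow> ('b \<Rightarrow> 'y) \<Rightarrow> ('c list \<Rightarrow> 'b) \<Rightarrow> 'c list \<Rightarrow> 'y"
where
  "push_cochain C n h f = (\<lambda>cs\<in>tuples C n. h (f cs))"

definition pull_cochain ::
  "('k, 'c, 's) module_scheme \<Rightarrow> nat \<Rightarrow> ('c \<Rightarrow> 'd) \<Rightarrow> ('d list \<Rightarrow> 'b) \<Rightarrow> 'c list \<Rightarrow> 'b"
where
  "pull_cochain C n h f = (\<lambda>cs\<in>tuples C n. f (map h cs))"

section \<open>Butterflies\<close>

record ('k, 'a2, 'a1, 'x2, 'x1, 'e) bfly =
  bf_E :: "('k, 'e) module"
  bf_kappa :: "'a2 \<Rightarrow> 'e"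
  bf_iota :: "'x2 \<Rightarrow> 'e"
  bf_delta :: "'e \<Rightarrow> 'a1"
  bf_gamma :: "'e \<Rightarrow> 'x1"

definition butterfly ::
  "('k, 'r) ring_scheme \<Rightarrow> ('k, 'b, 'a2, 'a1, 'c) biext \<Rightarrow> ('k, 'y, 'x2, 'x1, 'd) biext \<Rightarrow>
   ('k, 'a2, 'a1, 'x2, 'x1, 'e) bfly \<Rightarrow> bool"
where
  "butterfly K X X' F \<longleftrightarrow>
     assoc_algebra K (bf_E F) \<and>
     (\<forall>a\<in>carrier (bx_A2 X). bf_delta F (bf_kappa F a) = bx_d X a) \<and>
     (\<forall>a'\<in>carrier (bx_A2 X'). bf_gamma F (bf_iota F a') = bx_d X' a') \<and>
     bf_delta F \<in> algebra_homs K (bf_E F) (bx_A1 X) \<and>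
     bf_delta F ` carrier (bf_E F) = carrier (bx_A1 X) \<and>
     bf_iota F \<in> linear_maps K (bx_A2 X') (bf_E F) \<and>
     inj_on (bf_iota F) (carrier (bx_A2 X')) \<and>
     bf_iota F ` carrier (bx_A2 X') = {e \<in> carrier (bf_E F). bf_delta F e = \<zero>\<^bsub>bx_A1 X\<^esub>} \<and>
     bf_gamma F \<in> algebra_homs K (bf_E F) (bx_A1 X') \<and>
     bf_kappa F \<in> linear_maps K (bx_A2 X) (bf_E F) \<and>
     (\<forall>a\<in>carrier (bx_A2 X). bf_gamma F (bf_kappa F a) = \<zero>\<^bsub>bx_A1 X'\<^esub>) \<and>
     (\<forall>a\<in>carrier (bx_A2 X). \<forall>a'\<in>carrier (bx_A2 X'). \<forall>e\<in>carrier (bf_E F).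
        bf_iota F (ract (bx_A2 X') a' (bf_gamma F e)) = bf_iota F a' \<otimes>\<^bsub>bf_E F\<^esub> e \<and>
        bf_iota F (lact (bx_A2 X') (bf_gamma F e) a') = e \<otimes>\<^bsub>bf_E F\<^esub> bf_iota F a' \<and>
        bf_kappa F (ract (bx_A2 X) a (bf_delta F e)) = bf_kappa F a \<otimes>\<^bsub>bf_E F\<^esub> e \<and>
        bf_kappa F (lact (bx_A2 X) (bf_delta F e) a) = e \<otimes>\<^bsub>bf_E F\<^esub> bf_kappa F a)"

definition butterfly_iso ::
  "('k, 'r) ring_scheme \<Rightarrow> ('k, 'b, 'a2, 'a1, 'c) biext \<Rightarrow> ('k, 'y, 'x2, 'x1, 'd) biext \<Rightarrow>
   ('k, 'a2, 'a1, 'x2, 'x1, 'e) bfly \<Rightarrow> ('k, 'a2, 'a1, 'x2, 'x1, 'f) bfly \<Rightarrow> bool"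
where
  "butterfly_iso K X X' F F' \<longleftrightarrow>
     (\<exists>\<alpha>\<in>algebra_homs K (bf_E F) (bf_E F').
        (\<forall>a\<in>carrier (bx_A2 X). \<alpha> (bf_kappa F a) = bf_kappa F' a) \<and>
        (\<forall>a'\<in>carrier (bx_A2 X'). \<alpha> (bf_iota F a') = bf_iota F' a') \<and>
        (\<forall>e\<in>carrier (bf_E F). bf_delta F' (\<alpha> e) = bf_delta F e \<and>
           bf_gamma F' (\<alpha> e) = bf_gamma F e))"

text \<open>\<open>butterfly_over X X' F \<phi>\<^sub>0 \<phi>\<close> says that the morphism of bimodules determined by the butterfly
  \<open>F\<close> is the pair \<open>\<phi>\<^sub>0\<close>, \<open>\<phi>\<close>, where \<open>\<phi>\<^sub>0\<close> and \<open>\<phi>\<close> only matter on the carriers.\<close>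

definition butterfly_over ::
  "('k, 'b, 'a2, 'a1, 'c) biext \<Rightarrow> ('k, 'y, 'x2, 'x1, 'd) biext \<Rightarrow>
   ('k, 'a2, 'a1, 'x2, 'x1, 'e) bfly \<Rightarrow> ('c \<Rightarrow> 'd) \<Rightarrow> ('b \<Rightarrow> 'y) \<Rightarrow> bool"
where
  "butterfly_over X X' F \<phi>\<^sub>0 \<phi> \<longleftrightarrow>
     (\<forall>e\<in>carrier (bf_E F). \<phi>\<^sub>0 (bx_p X (bf_delta F e)) = bx_p X' (bf_gamma F e)) \<and>
     (\<forall>b\<in>carrier (bx_B X).
        bf_kappa F (bx_j X b) \<oplus>\<^bsub>bf_E F\<^esub> bf_iota F (bx_j X' (\<phi> b)) = \<zero>\<^bsub>bf_E F\<^esub>)"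

definition butterflies_over ::
  "('k, 'r) ring_scheme \<Rightarrow> ('k, 'b, 'a2, 'a1, 'c) biext \<Rightarrow> ('k, 'y, 'x2, 'x1, 'd) biext \<Rightarrow>
   ('c \<Rightarrow> 'd) \<Rightarrow> ('b \<Rightarrow> 'y) \<Rightarrow> ('k, 'a2, 'a1, 'x2, 'x1, 'e) bfly set"
where
  "butterflies_over K X X' \<phi>\<^sub>0 \<phi> = {F. butterfly K X X' F \<and> butterfly_over X X' F \<phi>\<^sub>0 \<phi>}"

definition butterfly_iso_rel ::
  "('k, 'r) ring_scheme \<Rightarrow> ('k, 'b, 'a2, 'a1, 'c) biext \<Rightarrow> ('k, 'y, 'x2, 'x1, 'd) biext \<Rightarrow>
   ('k, 'a2, 'a1, 'x2, 'x1, 'e) bfly rel"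
where
  "butterfly_iso_rel K X X' =
     {(F, F'). butterfly K X X' F \<and> butterfly K X X' F' \<and> butterfly_iso K X X' F F'}"

definition butterfly_classes ::
  "('k, 'r) ring_scheme \<Rightarrow> ('k, 'b, 'a2, 'a1, 'c) biext \<Rightarrow> ('k, 'y, 'x2, 'x1, 'd) biext \<Rightarrow>
   ('c \<Rightarrow> 'd) \<Rightarrow> ('b \<Rightarrow> 'y) \<Rightarrow> ('k, 'a2, 'a1, 'x2, 'x1, 'e) bfly set set"
where
  "butterfly_classes K X X' \<phi>\<^sub>0 \<phi> = butterflies_over K X X' \<phi>\<^sub>0 \<phi> // butterfly_iso_rel K X X'"

section \<open>Simply transitive actions\<close>

locale simply_transitive_action = group_action +
  assumes simply_transitive: "\<lbrakk>x \<in> E; y \<in> E\<rbrakk> \<Longrightarrow> \<exists>!g. g \<in> carrier G \<and> \<phi> g x = y"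

text \<open>
  The 2-cocycle \<open>g\<close> acts on a butterfly by adding \<open>\<iota> (j' (g (p \<delta> e, p \<delta> e')))\<close> to the product
  \<open>e e'\<close>.  Since cocycles are not assumed to be normalized, the unit has to be corrected as well.
\<close>

definition twist_butterfly ::
  "('k, 'b, 'a2, 'a1, 'c) biext \<Rightarrow> ('k, 'y, 'x2, 'x1, 'd) biext \<Rightarrow> ('c list \<Rightarrow> 'y) \<Rightarrow>
   ('k, 'a2, 'a1, 'x2, 'x1, 'e) bfly \<Rightarrow> ('k, 'a2, 'a1, 'x2, 'x1, 'e) bfly"
where
  "twist_butterfly X X' g F = F\<lparr>bf_E := (bf_E F)
     \<lparr>monoid.mult := (\<lambda>e e'. e \<otimes>\<^bsub>bf_E F\<^esub> e' \<oplus>\<^bsub>bf_E F\<^esub>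
        bf_iota F (bx_j X' (g [bx_p X (bf_delta F e), bx_p X (bf_delta F e')]))),
      one := \<one>\<^bsub>bf_E F\<^esub> \<ominus>\<^bsub>bf_E F\<^esub> bf_iota F (bx_j X' (g [\<one>\<^bsub>bx_C X\<^esub>, \<one>\<^bsub>bx_C X\<^esub>]))\<rparr>\<rparr>"

end

theory Submission
  imports Defs
begin

text \<open>
  A butterfly over \<open>(\<phi>\<^sub>0, \<phi>)\<close> has a linear map \<open>\<sigma>\<close> from \<open>C\<close> to \<open>E\<close> lifting both \<open>s\<close> and \<open>s' \<phi>\<^sub>0\<close>.  The defect
  \<open>\<sigma> c \<sigma> c' - \<sigma> (c c') - \<kappa> (f c c') - \<iota> (f' (\<phi>\<^sub>0 c) (\<phi>\<^sub>0 c'))\<close> is killed by \<open>\<delta>\<close> and \<open>\<gamma>\<close>, hence equals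
  \<open>\<iota> (j' (h c c'))\<close> for a 2-cochain \<open>h\<close>, and associativity of \<open>E\<close> says exactly that
  \<open>d h = \<phi> \<cdot> \<epsilon> - \<epsilon>' \<cdot> (\<phi>\<^sub>0 \<otimes> \<phi>\<^sub>0 \<otimes> \<phi>\<^sub>0)\<close>.  Conversely such an \<open>h\<close> defines an associative product on
  \<open>A1 \<times> A2'\<close> and thereby a model butterfly, to which \<open>E\<close> is isomorphic.  Two models are isomorphic if and
  only if the cochains differ by a coboundary, and twisting by a 2-cocycle adds it to \<open>h\<close>; so the
  isomorphism classes form a torsor under the second cohomology group.
\<close>

section \<open>Linear maps\<close>

text \<open>The sections \<open>s\<close>, \<open>s'\<close> preserve neither products nor units,
  and \<open>q\<close> lives only on the image of \<open>d\<close>. To stay linear, \<open>q\<close>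
  is extended to \<open>A1\<close> by \<open>r a = q (a - s (p a))\<close>; then every
  \<open>a\<close> is \<open>s (p a) + d (r a)\<close>. The formula for \<open>m\<close> is forced
  by \<open>t a = \<sigma> (p a) + \<kappa> (r a)\<close>: in \<open>t a t b - t (a b)\<close> the
  \<kappa> parts add up to \<open>\<kappa> (w a b)\<close> with \<open>d (w a b) = 0\<close>, and on
  the kernel of \<open>d\<close> a butterfly over \<open>(\<phi>\<^sub>0, \<phi>)\<close> has
  \<open>\<kappa> = - \<iota> \<psi>\<close>, where \<psi> is \<phi> read through \<open>j\<close>
  and \<open>j'\<close>. So the whole difference is a value of \<iota>. Throughout, the Peiffer
  identity repairs the failure of linear lifts to be multiplicative: their defect is in the image of
  \<open>d\<close> or \<open>d'\<close> and can be moved to the other side of an action.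

  Two obstacles remain. A model has no evident unit, since \<open>S 1\<close> need not be
  \<open>1\<close>; the unit must be solved for. And models live on pairs while the carriers in the
  statement have a prescribed type, so structures are moved along bijections; the same device
  supplies the algebra axioms for twisted products.\<close>

context abelian_group
begin

lemma add_diff_eq: "\<lbrakk>a \<in> carrier G; b \<in> carrier G; c \<in> carrier G\<rbrakk> \<Longrightarrow> a \<oplus> (b \<ominus> c) = (a \<oplus> b) \<ominus> c"
  by (simp add: minus_eq a_ac)

lemma diff_add_eq: "\<lbrakk>a \<in> carrier G; b \<in> carrier G; c \<in> carrier G\<rbrakk> \<Longrightarrow> (a \<ominus> b) \<oplus> c = (a \<oplus> c) \<ominus> b"
  by (simp add: minus_eq a_ac)

lemma diff_diff_eq: "\<lbrakk>a \<in> carrier G; b \<in> carrier G; c \<in> carrier G\<rbrakk> \<Longrightarrow> (a \<ominus> b) \<ominus> c = a \<ominus> (b \<oplus> c)"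
  by (simp add: minus_eq minus_add a_ac)

lemma diff_diff_eq2: "\<lbrakk>a \<in> carrier G; b \<in> carrier G; c \<in> carrier G\<rbrakk> \<Longrightarrow> a \<ominus> (b \<ominus> c) = (a \<oplus> c) \<ominus> b"
  by (simp add: minus_eq minus_add a_ac)

lemma diff_eq_eq: "\<lbrakk>a \<in> carrier G; b \<in> carrier G; c \<in> carrier G\<rbrakk> \<Longrightarrow> (a \<ominus> b = c) = (a = c \<oplus> b)"
  by (auto simp: minus_eq a_assoc l_neg r_neg)

lemma eq_diff_eq: "\<lbrakk>a \<in> carrier G; b \<in> carrier G; c \<in> carrier G\<rbrakk> \<Longrightarrow> (c = a \<ominus> b) = (c \<oplus> b = a)"
  by (auto simp: minus_eq a_assoc l_neg r_neg)

lemma neg_eq_diff: "a \<in> carrier G \<Longrightarrow> \<ominus> a = \<zero> \<ominus> a"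
  by (simp add: minus_eq)

lemma add_neg_eq: "\<lbrakk>a \<in> carrier G; b \<in> carrier G\<rbrakk> \<Longrightarrow> a \<oplus> \<ominus> b = a \<ominus> b"
  by (simp add: minus_eq)

lemma neg_add_eq: "\<lbrakk>a \<in> carrier G; b \<in> carrier G\<rbrakk> \<Longrightarrow> \<ominus> a \<oplus> b = b \<ominus> a"
  by (simp add: minus_eq a_comm)

lemma neg_diff: "\<lbrakk>a \<in> carrier G; b \<in> carrier G\<rbrakk> \<Longrightarrow> \<ominus> (a \<ominus> b) = b \<ominus> a"
  by (simp add: minus_eq minus_add a_comm)

lemma diff_neg: "\<lbrakk>a \<in> carrier G; b \<in> carrier G\<rbrakk> \<Longrightarrow> a \<ominus> (\<ominus> b) = a \<oplus> b"
  by (simp add: minus_eq)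

lemma neg_eq_iff: "\<lbrakk>a \<in> carrier G; b \<in> carrier G\<rbrakk> \<Longrightarrow> (\<ominus> a = b) = (\<zero> = b \<oplus> a)"
  by (simp add: neg_eq_diff diff_eq_eq)

lemma eq_neg_iff: "\<lbrakk>a \<in> carrier G; b \<in> carrier G\<rbrakk> \<Longrightarrow> (b = \<ominus> a) = (b \<oplus> a = \<zero>)"
  by (simp add: neg_eq_diff eq_diff_eq)

lemma neg_diff_eq: "\<lbrakk>a \<in> carrier G; b \<in> carrier G\<rbrakk> \<Longrightarrow> \<ominus> a \<ominus> b = \<ominus> (a \<oplus> b)"
  by (simp add: minus_eq minus_add)

lemma neg_zero [simp]: "\<ominus> \<zero> = \<zero>"
  by (simp add: neg_eq_iff)

lemma diff_self [simp]: "a \<in> carrier G \<Longrightarrow> a \<ominus> a = \<zero>"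
  by (simp add: minus_eq r_neg)

lemma diff_zero [simp]: "a \<in> carrier G \<Longrightarrow> a \<ominus> \<zero> = a"
  by (simp add: minus_eq)

lemma add_left_cancel:
  "\<lbrakk>a \<in> carrier G; b \<in> carrier G; c \<in> carrier G\<rbrakk> \<Longrightarrow> a \<oplus> b = a \<oplus> c \<longleftrightarrow> b = c"
  by (simp add: a_comm[of a])

text \<open>As rewrite rules these clear subtractions: differences are gathered on each side and
  then moved across the equation, leaving sums that \<open>a_ac\<close> sorts.\<close>

lemmas diff_simps = a_ac add_diff_eq diff_add_eq diff_diff_eq diff_diff_eq2 diff_eq_eq eq_diff_eq
  add_neg_eq neg_add_eq neg_diff diff_neg neg_eq_iff eq_neg_iff neg_diff_eq

end

locale lin_map = V: module K V + W: module K W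
  for K :: "('k, 'r) ring_scheme" (structure) and V :: "('k, 'v, 's) module_scheme" (structure)
    and W :: "('k, 'w, 't) module_scheme" (structure) +
  fixes f :: "'v \<Rightarrow> 'w"
  assumes lin: "f \<in> linear_maps K V W"
begin

lemma closed [simp, intro]: "x \<in> carrier V \<Longrightarrow> f x \<in> carrier W"
  using lin by (auto simp: linear_maps_def)

lemma add [simp]: "\<lbrakk>x \<in> carrier V; y \<in> carrier V\<rbrakk> \<Longrightarrow> f (x \<oplus>\<^bsub>V\<^esub> y) = f x \<oplus>\<^bsub>W\<^esub> f y"
  using lin by (auto simp: linear_maps_def)

lemma smult [simp]: "\<lbrakk>k \<in> carrier K; x \<in> carrier V\<rbrakk> \<Longrightarrow> f (k \<odot>\<^bsub>V\<^esub> x) = k \<odot>\<^bsub>W\<^esub> f x"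
  using lin by (auto simp: linear_maps_def)

lemma zero [simp]: "f \<zero>\<^bsub>V\<^esub> = \<zero>\<^bsub>W\<^esub>"
  using smult[of "\<zero>\<^bsub>K\<^esub>" "\<zero>\<^bsub>V\<^esub>"] by simp

lemma neg [simp]: "x \<in> carrier V \<Longrightarrow> f (\<ominus>\<^bsub>V\<^esub> x) = \<ominus>\<^bsub>W\<^esub> f x"
  using add[of x "\<ominus>\<^bsub>V\<^esub> x"] by (simp add: W.M.eq_neg_iff V.M.r_neg W.M.a_comm del: add)

lemma diff [simp]: "\<lbrakk>x \<in> carrier V; y \<in> carrier V\<rbrakk> \<Longrightarrow> f (x \<ominus>\<^bsub>V\<^esub> y) = f x \<ominus>\<^bsub>W\<^esub> f y"
  by (simp add: V.M.minus_eq W.M.minus_eq)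

lemma inj_onI_kernel:
  assumes "\<And>x. \<lbrakk>x \<in> carrier V; f x = \<zero>\<^bsub>W\<^esub>\<rbrakk> \<Longrightarrow> x = \<zero>\<^bsub>V\<^esub>"
  shows "inj_on f (carrier V)"
proof (rule inj_onI)
  fix x y assume xy: "x \<in> carrier V" "y \<in> carrier V" "f x = f y"
  then have "x \<ominus>\<^bsub>V\<^esub> y = \<zero>\<^bsub>V\<^esub>" using assms[of "x \<ominus>\<^bsub>V\<^esub> y"] by simp
  with xy show "x = y" by (simp add: V.M.diff_eq_eq)
qed

end

lemma linear_mapsI:
  assumes "\<And>x. x \<in> carrier V \<Longrightarrow> f x \<in> carrier W"
    and "\<And>x y. \<lbrakk>x \<in> carrier V; y \<in> carrier V\<rbrakk> \<Longrightarrow> f (x \<oplus>\<^bsub>V\<^esub> y) = f x \<oplus>\<^bsub>W\<^esub> f y"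
    and "\<And>k x. \<lbrakk>k \<in> carrier K; x \<in> carrier V\<rbrakk> \<Longrightarrow> f (k \<odot>\<^bsub>V\<^esub> x) = k \<odot>\<^bsub>W\<^esub> f x"
  shows "f \<in> linear_maps K V W"
  using assms by (auto simp: linear_maps_def)

text \<open>Zorn's lemma gives a subspace \<open>U\<close> maximal among those meeting the kernel of
  \<open>f\<close> only in zero. Maximality makes \<open>f\<close> map \<open>U\<close> onto
  \<open>W\<close>, so \<open>f\<close> is bijective on \<open>U\<close> and its inverse there is
  the section.\<close>

theorem surjective_linear_map_has_section:
  fixes K (structure)
  assumes K: "field K" and f: "lin_map K V W f" and surj: "f ` carrier V = carrier W"
  shows "\<exists>t \<in> linear_maps K W V. \<forall>w\<in>carrier W. f (t w) = w"
proof -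
  interpret K: field K by fact
  interpret f: lin_map K V W f by fact
  define sub where "sub U \<longleftrightarrow> U \<subseteq> carrier V \<and> \<zero>\<^bsub>V\<^esub> \<in> U \<and> (\<forall>x\<in>U. \<forall>y\<in>U. x \<oplus>\<^bsub>V\<^esub> y \<in> U) \<and>
    (\<forall>k\<in>carrier K. \<forall>x\<in>U. k \<odot>\<^bsub>V\<^esub> x \<in> U) \<and> (\<forall>x\<in>U. f x = \<zero>\<^bsub>W\<^esub> \<longrightarrow> x = \<zero>\<^bsub>V\<^esub>)" for U
  have "\<exists>U\<in>{U. sub U}. \<forall>T\<in>{U. sub U}. U \<subseteq> T \<longrightarrow> T = U"
  proof (rule subset_Zorn_nonempty)
    have "sub {\<zero>\<^bsub>V\<^esub>}" by (simp add: sub_def)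
    then show "{U. sub U} \<noteq> {}" by blast
  next
    fix c assume c: "c \<noteq> {}" "subset.chain {U. sub U} c"
    then have S: "\<And>U. U \<in> c \<Longrightarrow> sub U" by (auto simp: subset.chain_def)
    have ch: "\<And>U T. U \<in> c \<Longrightarrow> T \<in> c \<Longrightarrow> U \<subseteq> T \<or> T \<subseteq> U"
      using c(2) by (auto simp: subset.chain_def)
    have "x \<oplus>\<^bsub>V\<^esub> y \<in> \<Union>c" if xy: "x \<in> \<Union>c" "y \<in> \<Union>c" for x y
    proof -
      obtain U T where UT: "U \<in> c" "T \<in> c" "x \<in> U" "y \<in> T" using xy by blast
      with ch[OF UT(1,2)] obtain U' where "U' \<in> c" "x \<in> U'" "y \<in> U'" by blast
      with S[of U'] show ?thesis unfolding sub_def by blast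
    qed
    moreover have "\<zero>\<^bsub>V\<^esub> \<in> \<Union>c" using c(1) S unfolding sub_def by blast
    moreover have "\<Union>c \<subseteq> carrier V" "\<forall>k\<in>carrier K. \<forall>x\<in>\<Union>c. k \<odot>\<^bsub>V\<^esub> x \<in> \<Union>c"
        "\<forall>x\<in>\<Union>c. f x = \<zero>\<^bsub>W\<^esub> \<longrightarrow> x = \<zero>\<^bsub>V\<^esub>"
      using S unfolding sub_def by blast+
    ultimately show "\<Union>c \<in> {U. sub U}"
      unfolding sub_def mem_Collect_eq by blast
  qed
  then obtain U where U: "sub U" and max: "\<And>T. sub T \<Longrightarrow> U \<subseteq> T \<Longrightarrow> T = U" by blast
  have UV: "\<And>x. x \<in> U \<Longrightarrow> x \<in> carrier V" and U0: "\<zero>\<^bsub>V\<^esub> \<in> U"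
    and Uadd: "\<And>x y. x \<in> U \<Longrightarrow> y \<in> U \<Longrightarrow> x \<oplus>\<^bsub>V\<^esub> y \<in> U"
    and Usm: "\<And>k x. k \<in> carrier K \<Longrightarrow> x \<in> U \<Longrightarrow> k \<odot>\<^bsub>V\<^esub> x \<in> U"
    and Uker: "\<And>x. x \<in> U \<Longrightarrow> f x = \<zero>\<^bsub>W\<^esub> \<Longrightarrow> x = \<zero>\<^bsub>V\<^esub>"
    using U unfolding sub_def by blast+
  have onto: "\<exists>x\<in>U. f x = w" if w: "w \<in> carrier W" for w
  proof (rule ccontr)
    assume no: "\<not> (\<exists>x\<in>U. f x = w)"
    obtain v where v: "v \<in> carrier V" "f v = w" using surj w by (metis imageE)
    \<comment> \<open>Adjoining a preimage of the missed vector \<open>w\<close> yields a larger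
      subspace of the same kind.\<close>
    define T where "T = {x \<oplus>\<^bsub>V\<^esub> k \<odot>\<^bsub>V\<^esub> v | x k. x \<in> U \<and> k \<in> carrier K}"
    have mem: "x \<oplus>\<^bsub>V\<^esub> k \<odot>\<^bsub>V\<^esub> v \<in> T" if "x \<in> U" "k \<in> carrier K" for x k
      using that by (auto simp: T_def)
    have "sub T" unfolding sub_def
    proof (intro conjI ballI impI)
      show "T \<subseteq> carrier V" using UV v by (auto simp: T_def)
      show "\<zero>\<^bsub>V\<^esub> \<in> T" using mem[OF U0, of "\<zero>\<^bsub>K\<^esub>"] v by simp
    next
      fix x y assume "x \<in> T" "y \<in> T"
      then obtain a k b l where "x = a \<oplus>\<^bsub>V\<^esub> k \<odot>\<^bsub>V\<^esub> v" "a \<in> U" "k \<in> carrier K"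
          "y = b \<oplus>\<^bsub>V\<^esub> l \<odot>\<^bsub>V\<^esub> v" "b \<in> U" "l \<in> carrier K"
        by (auto simp: T_def)
      then show "x \<oplus>\<^bsub>V\<^esub> y \<in> T"
        using mem[OF Uadd[of a b], of "k \<oplus>\<^bsub>K\<^esub> l"] v UV
        by (simp add: f.V.smult_l_distr f.V.M.a_ac)
    next
      fix k x assume "k \<in> carrier K" "x \<in> T"
      then obtain a l where "x = a \<oplus>\<^bsub>V\<^esub> l \<odot>\<^bsub>V\<^esub> v" "a \<in> U" "l \<in> carrier K"
        by (auto simp: T_def)
      then show "k \<odot>\<^bsub>V\<^esub> x \<in> T"
        using mem[OF Usm[of k a], of "k \<otimes>\<^bsub>K\<^esub> l"] v UV \<open>k \<in> carrier K\<close>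
        by (simp add: f.V.smult_r_distr f.V.smult_assoc1)
    next
      fix x assume "x \<in> T" and fx: "f x = \<zero>\<^bsub>W\<^esub>"
      then obtain a k where x: "x = a \<oplus>\<^bsub>V\<^esub> k \<odot>\<^bsub>V\<^esub> v" "a \<in> U" "k \<in> carrier K"
        by (auto simp: T_def)
      \<comment> \<open>Otherwise \<open>k\<close> is invertible and \<open>w\<close> is the image
        of \<open>- inv k a\<close>, which lies in \<open>U\<close>, contrary to the choice of
        \<open>w\<close>.\<close>
      have "k = \<zero>"
      proof (rule ccontr)
        assume "k \<noteq> \<zero>"
        with x(3) have k: "k \<in> Units K" by (simp add: K.field_Units)
        have "f a \<oplus>\<^bsub>W\<^esub> k \<odot>\<^bsub>W\<^esub> w = \<zero>\<^bsub>W\<^esub>" using fx x v UV by simp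
        then have "k \<odot>\<^bsub>W\<^esub> w = \<ominus>\<^bsub>W\<^esub> f a"
          using x w UV by (simp add: f.W.M.eq_neg_iff f.W.M.a_comm)
        then have "inv k \<odot>\<^bsub>W\<^esub> (k \<odot>\<^bsub>W\<^esub> w) = inv k \<odot>\<^bsub>W\<^esub> (\<ominus>\<^bsub>W\<^esub> f a)" by simp
        then have "w = f ((\<ominus>\<^bsub>K\<^esub> (inv k)) \<odot>\<^bsub>V\<^esub> a)"
          using k x w UV by (simp add: f.W.smult_assoc1[symmetric] f.W.smult_l_minus f.W.smult_r_minus)
        with no Usm[of "\<ominus>\<^bsub>K\<^esub> (inv k)" a] k x show False by auto
      qed
      then show "x = \<zero>\<^bsub>V\<^esub>" using fx x UV v Uker[of a] by simp
    qed
    moreover have "U \<subseteq> T"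
      using mem[of _ "\<zero>\<^bsub>K\<^esub>"] v UV by auto
    ultimately have "T = U" by (rule max)
    moreover have "v \<in> T" using mem[OF U0, of "\<one>\<^bsub>K\<^esub>"] v by simp
    ultimately show False using no v by blast
  qed
  have inj: "x = y" if "x \<in> U" "y \<in> U" "f x = f y" for x y
  proof -
    \<comment> \<open>\<open>U\<close> is known to be closed under sums and scalars, so
      \<open>x - y\<close> is formed with the scalar \<open>-1\<close>.\<close>
    have "x \<oplus>\<^bsub>V\<^esub> (\<ominus>\<^bsub>K\<^esub> \<one>\<^bsub>K\<^esub>) \<odot>\<^bsub>V\<^esub> y = \<zero>\<^bsub>V\<^esub>"
      using that UV by (intro Uker Uadd Usm) (simp_all add: f.W.smult_l_minus f.V.smult_l_minus f.W.M.r_neg)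
    then show ?thesis using that UV by (simp add: f.V.smult_l_minus f.V.M.diff_simps)
  qed
  define t where "t w = (THE x. x \<in> U \<and> f x = w)" for w
  have t: "t w \<in> U" "f (t w) = w" if "w \<in> carrier W" for w
    using theI'[of "\<lambda>x. x \<in> U \<and> f x = w"] onto[OF that] inj unfolding t_def by metis+
  have "t \<in> linear_maps K W V"
    by (rule linear_mapsI) (use t UV in \<open>auto intro!: inj intro: Uadd Usm\<close>)
  with t show ?thesis by blast
qed

section \<open>Bimodules and crossed biextensions\<close>

lemma (in module) smult_diff: "\<lbrakk>a \<in> carrier R; x \<in> carrier M; y \<in> carrier M\<rbrakk> \<Longrightarrow>
    a \<odot>\<^bsub>M\<^esub> (x \<ominus>\<^bsub>M\<^esub> y) = a \<odot>\<^bsub>M\<^esub> x \<ominus>\<^bsub>M\<^esub> a \<odot>\<^bsub>M\<^esub> y"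
  by (simp add: M.minus_eq smult_r_distr smult_r_minus)

context ring
begin

lemma l_diff_distr: "\<lbrakk>x \<in> carrier R; y \<in> carrier R; z \<in> carrier R\<rbrakk> \<Longrightarrow> (x \<ominus> y) \<otimes> z = x \<otimes> z \<ominus> y \<otimes> z"
  by (simp add: minus_eq l_distr l_minus)

lemma r_diff_distr: "\<lbrakk>x \<in> carrier R; y \<in> carrier R; z \<in> carrier R\<rbrakk> \<Longrightarrow> z \<otimes> (x \<ominus> y) = z \<otimes> x \<ominus> z \<otimes> y"
  by (simp add: minus_eq r_distr r_minus)

end

section \<open>Bilinear maps\<close>

definition bilinear_maps ::
  "('k, 'r) ring_scheme \<Rightarrow> ('k, 'v, 's) module_scheme \<Rightarrow> ('k, 'w, 't) module_scheme \<Rightarrow>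
   ('k, 'u, 'q) module_scheme \<Rightarrow> ('v \<Rightarrow> 'w \<Rightarrow> 'u) set"
where
  "bilinear_maps K V W U = {g. (\<forall>x\<in>carrier V. g x \<in> linear_maps K W U) \<and>
     (\<forall>y\<in>carrier W. (\<lambda>x. g x y) \<in> linear_maps K V U)}"

lemma bilinear_mapsI:
  assumes "\<And>x y. \<lbrakk>x \<in> carrier V; y \<in> carrier W\<rbrakk> \<Longrightarrow> g x y \<in> carrier U"
    and "\<And>x x' y. \<lbrakk>x \<in> carrier V; x' \<in> carrier V; y \<in> carrier W\<rbrakk> \<Longrightarrow> g (x \<oplus>\<^bsub>V\<^esub> x') y = g x y \<oplus>\<^bsub>U\<^esub> g x' y"
    and "\<And>x y y'. \<lbrakk>x \<in> carrier V; y \<in> carrier W; y' \<in> carrier W\<rbrakk> \<Longrightarrow> g x (y \<oplus>\<^bsub>W\<^esub> y') = g x y \<oplus>\<^bsub>U\<^esub> g x y'"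
    and "\<And>k x y. \<lbrakk>k \<in> carrier K; x \<in> carrier V; y \<in> carrier W\<rbrakk> \<Longrightarrow> g (k \<odot>\<^bsub>V\<^esub> x) y = k \<odot>\<^bsub>U\<^esub> g x y"
    and "\<And>k x y. \<lbrakk>k \<in> carrier K; x \<in> carrier V; y \<in> carrier W\<rbrakk> \<Longrightarrow> g x (k \<odot>\<^bsub>W\<^esub> y) = k \<odot>\<^bsub>U\<^esub> g x y"
  shows "g \<in> bilinear_maps K V W U"
  unfolding bilinear_maps_def using assms by (auto intro!: linear_mapsI)

locale bilin_map = V: module K V + W: module K W + U: module K U
  for K :: "('k, 'r) ring_scheme" (structure) and V :: "('k, 'v, 's) module_scheme" (structure)
    and W :: "('k, 'w, 't) module_scheme" (structure) and U :: "('k, 'u, 'q) module_scheme" (structure) +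
  fixes g :: "'v \<Rightarrow> 'w \<Rightarrow> 'u"
  assumes bilin: "g \<in> bilinear_maps K V W U"
begin

lemma lin_map_right: "x \<in> carrier V \<Longrightarrow> lin_map K W U (g x)"
  using bilin by unfold_locales (auto simp: bilinear_maps_def)

lemma lin_map_left: "y \<in> carrier W \<Longrightarrow> lin_map K V U (\<lambda>x. g x y)"
  using bilin by unfold_locales (auto simp: bilinear_maps_def)

lemmas closed [simp, intro] = lin_map.closed[OF lin_map_right]
  and add_right = lin_map.add[OF lin_map_right]
  and add_left = lin_map.add[OF lin_map_left]
  and diff_right = lin_map.diff[OF lin_map_right]
  and diff_left = lin_map.diff[OF lin_map_left]
  and neg_right = lin_map.neg[OF lin_map_right]
  and neg_left = lin_map.neg[OF lin_map_left]
  and smult_right = lin_map.smult[OF lin_map_right]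
  and smult_left = lin_map.smult[OF lin_map_left]
  and zero_right [simp] = lin_map.zero[OF lin_map_right]
  and zero_left [simp] = lin_map.zero[OF lin_map_left]

lemmas expand = add_right add_left diff_right diff_left neg_right neg_left smult_right smult_left

end

context assoc_algebra
begin

lemma mult_bilin: "bilin_map K A A A (\<otimes>\<^bsub>A\<^esub>)"
  by unfold_locales
    (auto intro!: bilinear_mapsI simp: l_distr r_distr smult_mult_left smult_mult_right)

lemmas mult_expand = bilin_map.expand[OF mult_bilin]

end

sublocale bimodule \<subseteq> l: bilin_map K C B B "lact B"
  by unfold_locales (auto intro!: bilinear_mapsI
    simp: lact_closed lact_add_left lact_add_right lact_smult_left lact_smult_right)

sublocale bimodule \<subseteq> r: bilin_map K B C B "ract B"
  by unfold_locales (auto intro!: bilinear_mapsI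
    simp: ract_closed ract_add_left ract_add_right ract_smult_left ract_smult_right)

lemmas (in bimodule) act_expand = l.expand r.expand

text \<open>The splittings \<open>s\<close> and \<open>r\<close> are choices, fixed once so that all
  later formulas are explicit. From \<open>d (r a) = a - s (p a)\<close> the value
  \<open>r (s c)\<close> lies in \<open>j B\<close>, but it does not have to vanish.\<close>

locale biext =
  fixes K :: "('k, 'r) ring_scheme" (structure)
    and X :: "('k, 'b, 'a2, 'a1, 'c) biext"
    and s :: "'c \<Rightarrow> 'a1" and r :: "'a1 \<Rightarrow> 'a2"
  assumes K_field: "field K" and X_biext: "crossed_biextension K X"
    and s_linear: "s \<in> linear_maps K (bx_C X) (bx_A1 X)"
    and p_s [simp]: "c \<in> carrier (bx_C X) \<Longrightarrow> bx_p X (s c) = c"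
    and r_linear: "r \<in> linear_maps K (bx_A1 X) (bx_A2 X)"
    and d_r: "a \<in> carrier (bx_A1 X) \<Longrightarrow> bx_d X (r a) = a \<ominus>\<^bsub>bx_A1 X\<^esub> s (bx_p X a)"
begin

abbreviation "B \<equiv> bx_B X"
abbreviation "A2 \<equiv> bx_A2 X"
abbreviation "A1 \<equiv> bx_A1 X"
abbreviation "C \<equiv> bx_C X"
abbreviation "j \<equiv> bx_j X"
abbreviation "d \<equiv> bx_d X"
abbreviation "p \<equiv> bx_p X"

lemma K_cring: "cring K"
proof -
  interpret field K by (rule K_field)
  show ?thesis by (rule is_cring)
qed

lemma crossed: "crossed_bimodule K A1 A2 d"
  using X_biext by (simp add: crossed_biextension_def)

sublocale C: assoc_algebra K C
  using X_biext by (simp add: crossed_biextension_def)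

sublocale A1: assoc_algebra K A1
  using crossed by (simp add: crossed_bimodule_def)

sublocale B: module K B
  using X_biext by (simp add: crossed_biextension_def)

sublocale A2: bimodule K A1 A2
  using crossed by (simp add: crossed_bimodule_def)

lemma p_hom: "p \<in> algebra_homs K A1 C"
  using X_biext by (simp add: crossed_biextension_def)

sublocale j: lin_map K B A2 j
  using X_biext by unfold_locales (simp add: crossed_biextension_def)

sublocale p: lin_map K A1 C p
  using p_hom by unfold_locales (simp add: algebra_homs_def)

sublocale d: lin_map K A2 A1 d
  using crossed by unfold_locales
    (auto simp: crossed_bimodule_def bimodule_morphism_def linear_maps_def regular_bimodule_def with_actions_def)

sublocale s: lin_map K C A1 s
  by unfold_locales (rule s_linear)

sublocale r: lin_map K A1 A2 r
  by unfold_locales (rule r_linear)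

lemma p_mult [simp]: "\<lbrakk>a \<in> carrier A1; b \<in> carrier A1\<rbrakk> \<Longrightarrow> p (a \<otimes>\<^bsub>A1\<^esub> b) = p a \<otimes>\<^bsub>C\<^esub> p b"
  and p_one [simp]: "p \<one>\<^bsub>A1\<^esub> = \<one>\<^bsub>C\<^esub>"
  using p_hom by (auto simp: algebra_homs_def ring_hom_def)

lemma d_lact [simp]: "\<lbrakk>a \<in> carrier A1; x \<in> carrier A2\<rbrakk> \<Longrightarrow> d (lact A2 a x) = a \<otimes>\<^bsub>A1\<^esub> d x"
  and d_ract [simp]: "\<lbrakk>a \<in> carrier A1; x \<in> carrier A2\<rbrakk> \<Longrightarrow> d (ract A2 x a) = d x \<otimes>\<^bsub>A1\<^esub> a"
  using crossed by (auto simp: crossed_bimodule_def bimodule_morphism_def regular_bimodule_def with_actions_def)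

lemma peiffer: "\<lbrakk>x \<in> carrier A2; y \<in> carrier A2\<rbrakk> \<Longrightarrow> lact A2 (d x) y = ract A2 x (d y)"
  using crossed by (auto simp: crossed_bimodule_def)

lemma d_j [simp]: "b \<in> carrier B \<Longrightarrow> d (j b) = \<zero>\<^bsub>A1\<^esub>"
  and j_exact: "\<lbrakk>x \<in> carrier A2; d x = \<zero>\<^bsub>A1\<^esub>\<rbrakk> \<Longrightarrow> x \<in> j ` carrier B"
proof -
  have *: "j ` carrier B = {a \<in> carrier A2. d a = \<zero>\<^bsub>A1\<^esub>}"
    using X_biext by (simp add: crossed_biextension_def)
  show "b \<in> carrier B \<Longrightarrow> d (j b) = \<zero>\<^bsub>A1\<^esub>" using * by auto
  show "\<lbrakk>x \<in> carrier A2; d x = \<zero>\<^bsub>A1\<^esub>\<rbrakk> \<Longrightarrow> x \<in> j ` carrier B" unfolding * by simp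
qed

lemma p_d [simp]: "x \<in> carrier A2 \<Longrightarrow> p (d x) = \<zero>\<^bsub>C\<^esub>"
proof -
  have "d ` carrier A2 = {a \<in> carrier A1. p a = \<zero>\<^bsub>C\<^esub>}"
    using X_biext by (simp add: crossed_biextension_def)
  then show "x \<in> carrier A2 \<Longrightarrow> p (d x) = \<zero>\<^bsub>C\<^esub>" by auto
qed

lemma j_inj: "inj_on j (carrier B)"
  using X_biext by (simp add: crossed_biextension_def)

lemma j_eqD: "\<lbrakk>j b = j b'; b \<in> carrier B; b' \<in> carrier B\<rbrakk> \<Longrightarrow> b = b'"
  using j_inj by (auto dest: inj_onD)

lemma j_eq_iff: "\<lbrakk>b \<in> carrier B; b' \<in> carrier B\<rbrakk> \<Longrightarrow> b = b' \<longleftrightarrow> j b = j b'"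
  using j_eqD by auto

definition jinv :: "'a2 \<Rightarrow> 'b" where "jinv = the_inv_into (carrier B) j"

lemma jinv_closed [simp, intro]: "\<lbrakk>x \<in> carrier A2; d x = \<zero>\<^bsub>A1\<^esub>\<rbrakk> \<Longrightarrow> jinv x \<in> carrier B"
  and j_jinv [simp]: "\<lbrakk>x \<in> carrier A2; d x = \<zero>\<^bsub>A1\<^esub>\<rbrakk> \<Longrightarrow> j (jinv x) = x"
  unfolding jinv_def using j_exact j_inj
  by (metis the_inv_into_into order_refl, metis f_the_inv_into_f)

lemma r_section: "\<lbrakk>a \<in> carrier A1; p a = \<zero>\<^bsub>C\<^esub>\<rbrakk> \<Longrightarrow> d (r a) = a"
  by (simp add: d_r)

lemma r_s_d: "\<lbrakk>x \<in> carrier A2\<rbrakk> \<Longrightarrow> d (r (d x)) = d x"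
  by (simp add: d_r)

lemma s_p_eq: "a \<in> carrier A1 \<Longrightarrow> s (p a) \<oplus>\<^bsub>A1\<^esub> d (r a) = a"
  by (simp add: d_r A1.M.diff_simps)

text \<open>The image of \<open>d\<close> annihilates the kernel of \<open>d\<close>:
  \<open>d x * j b = x * d (j b) = 0\<close> by the Peiffer identity. This makes the induced action
  of \<open>C\<close> on \<open>B\<close> well defined.\<close>

lemma lact_j_cong:
  assumes "a \<in> carrier A1" "a' \<in> carrier A1" "p a = p a'" "b \<in> carrier B"
  shows "lact A2 a (j b) = lact A2 a' (j b)"
proof -
  \<comment> \<open>\<open>a - a'\<close> is in the kernel of \<open>p\<close>, where
    \<open>r\<close> is a section of \<open>d\<close>.\<close>
  have "a \<ominus>\<^bsub>A1\<^esub> a' = d (r (a \<ominus>\<^bsub>A1\<^esub> a'))" using assms by (intro r_section[symmetric]) simp_all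
  then have "lact A2 (a \<ominus>\<^bsub>A1\<^esub> a') (j b) = ract A2 (r (a \<ominus>\<^bsub>A1\<^esub> a')) (d (j b))"
    using assms by (metis A1.M.minus_closed j.closed peiffer r.closed)
  then show ?thesis using assms by (simp add: A2.act_expand A2.M.diff_eq_eq)
qed

lemma ract_j_cong:
  assumes "a \<in> carrier A1" "a' \<in> carrier A1" "p a = p a'" "b \<in> carrier B"
  shows "ract A2 (j b) a = ract A2 (j b) a'"
proof -
  have "a \<ominus>\<^bsub>A1\<^esub> a' = d (r (a \<ominus>\<^bsub>A1\<^esub> a'))" using assms by (intro r_section[symmetric]) simp_all
  then have "ract A2 (j b) (a \<ominus>\<^bsub>A1\<^esub> a') = lact A2 (d (j b)) (r (a \<ominus>\<^bsub>A1\<^esub> a'))"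
    using assms by (metis A1.M.minus_closed j.closed peiffer r.closed)
  then show ?thesis using assms by (simp add: A2.act_expand A2.M.diff_eq_eq)
qed

text \<open>Eliminates the definite description: all lifts of \<open>p a\<close> give the same value
  by \<open>lact_j_cong\<close>.\<close>

lemma lact_bx:
  assumes "a \<in> carrier A1" "b \<in> carrier B"
  shows "lact (bx_bimodule X) (p a) b = jinv (lact A2 a (j b))"
proof -
  have "lact (bx_bimodule X) (p a) b = (THE b'. b' \<in> carrier B \<and>
      (\<exists>a'\<in>carrier A1. p a' = p a \<and> j b' = lact A2 a' (j b)))"
    by (simp add: bx_bimodule_def with_actions_def)
  also have "\<dots> = jinv (lact A2 a (j b))"
  proof (rule the_equality)
    show "jinv (lact A2 a (j b)) \<in> carrier B \<and>
      (\<exists>a'\<in>carrier A1. p a' = p a \<and> j (jinv (lact A2 a (j b))) = lact A2 a' (j b))"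
      using assms by auto
  next
    fix b' assume "b' \<in> carrier B \<and> (\<exists>a'\<in>carrier A1. p a' = p a \<and> j b' = lact A2 a' (j b))"
    then show "b' = jinv (lact A2 a (j b))"
      using assms by (intro j_eqD) (auto intro: lact_j_cong)
  qed
  finally show ?thesis .
qed

lemma ract_bx:
  assumes "a \<in> carrier A1" "b \<in> carrier B"
  shows "ract (bx_bimodule X) b (p a) = jinv (ract A2 (j b) a)"
proof -
  have "ract (bx_bimodule X) b (p a) = (THE b'. b' \<in> carrier B \<and>
      (\<exists>a'\<in>carrier A1. p a' = p a \<and> j b' = ract A2 (j b) a'))"
    by (simp add: bx_bimodule_def with_actions_def)
  also have "\<dots> = jinv (ract A2 (j b) a)"
  proof (rule the_equality)
    show "jinv (ract A2 (j b) a) \<in> carrier B \<and>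
      (\<exists>a'\<in>carrier A1. p a' = p a \<and> j (jinv (ract A2 (j b) a)) = ract A2 (j b) a')"
      using assms by auto
  next
    fix b' assume "b' \<in> carrier B \<and> (\<exists>a'\<in>carrier A1. p a' = p a \<and> j b' = ract A2 (j b) a')"
    then show "b' = jinv (ract A2 (j b) a)"
      using assms by (intro j_eqD) (auto intro: ract_j_cong)
  qed
  finally show ?thesis .
qed

text \<open>Since \<open>p (s c s c') = c c'\<close>, the map \<open>r\<close> already takes care of
  \<open>s (c c')\<close>: for an \<open>r\<close> built from \<open>q\<close> this is the
  \<open>f\<close> of the associated cocycle.\<close>

definition f :: "'c \<Rightarrow> 'c \<Rightarrow> 'a2" where "f c c' = r (s c \<otimes>\<^bsub>A1\<^esub> s c')"

lemma f_bilin: "bilin_map K C C A2 f"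
  by unfold_locales (auto intro!: bilinear_mapsI simp: f_def A1.mult_expand)

sublocale f: bilin_map K C C A2 f by (rule f_bilin)

lemma d_f: "\<lbrakk>c \<in> carrier C; c' \<in> carrier C\<rbrakk> \<Longrightarrow>
    d (f c c') = s c \<otimes>\<^bsub>A1\<^esub> s c' \<ominus>\<^bsub>A1\<^esub> s (c \<otimes>\<^bsub>C\<^esub> c')"
  by (simp add: f_def d_r)

definition obstruction :: "'c \<Rightarrow> 'c \<Rightarrow> 'c \<Rightarrow> 'a2" where
  "obstruction c c' c'' = lact A2 (s c) (f c' c'') \<ominus>\<^bsub>A2\<^esub> f (c \<otimes>\<^bsub>C\<^esub> c') c''
     \<oplus>\<^bsub>A2\<^esub> f c (c' \<otimes>\<^bsub>C\<^esub> c'') \<ominus>\<^bsub>A2\<^esub> ract A2 (f c c') (s c'')"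

text \<open>In a butterfly with linear maps \<open>\<sigma>\<close> from \<open>C\<close> to \<open>E\<close> and \<open>t a = \<sigma> (p a) + \<kappa> (r a)\<close>, the element \<open>w a b\<close>
  is the contribution of \<open>\<kappa>\<close> to \<open>t a t b - t (a b)\<close>.\<close>

definition w :: "'a1 \<Rightarrow> 'a1 \<Rightarrow> 'a2" where
  "w a b = f (p a) (p b) \<oplus>\<^bsub>A2\<^esub> ract A2 (r a) b \<oplus>\<^bsub>A2\<^esub> lact A2 (s (p a)) (r b) \<ominus>\<^bsub>A2\<^esub> r (a \<otimes>\<^bsub>A1\<^esub> b)"

lemma w_bilin: "bilin_map K A1 A1 A2 w"
  by unfold_locales (auto intro!: bilinear_mapsI simp: w_def f.expand A1.mult_expand A2.act_expand
      A2.smult_diff A2.smult_r_distr A2.M.diff_simps)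

sublocale w: bilin_map K A1 A1 A2 w by (rule w_bilin)

text \<open>Hence \<open>w a b\<close> comes from \<open>B\<close>, which is what allows \<phi> to
  be applied to it.\<close>

lemma d_w [simp]: "\<lbrakk>a \<in> carrier A1; b \<in> carrier A1\<rbrakk> \<Longrightarrow> d (w a b) = \<zero>\<^bsub>A1\<^esub>"
  by (simp add: w_def d_f d_r A1.mult_expand A1.l_diff_distr A1.r_diff_distr A1.M.diff_simps)

text \<open>\<open>w\<close> is the pullback of \<open>f\<close> plus the Hochschild coboundary of
  \<open>r\<close>, with \<open>A1\<close> acting on the left through \<open>s p\<close> and on the
  right directly. The left action is not multiplicative; its defect
  \<open>d (f (p a) (p b))\<close>, acting on \<open>r c\<close>, is cancelled through the Peiffer
  identity by the difference between \<open>f (p a) (p b) * c\<close> and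
  \<open>f (p a) (p b) * s (p c)\<close>.\<close>

lemma w_coboundary:
  assumes "a \<in> carrier A1" "b \<in> carrier A1" "c \<in> carrier A1"
  shows "lact A2 (s (p a)) (w b c) \<ominus>\<^bsub>A2\<^esub> w (a \<otimes>\<^bsub>A1\<^esub> b) c \<oplus>\<^bsub>A2\<^esub> w a (b \<otimes>\<^bsub>A1\<^esub> c) \<ominus>\<^bsub>A2\<^esub> ract A2 (w a b) c
    = obstruction (p a) (p b) (p c)"
proof -
  let ?F = "f (p a) (p b)"
  have 1: "ract A2 ?F c = ract A2 ?F (s (p c)) \<oplus>\<^bsub>A2\<^esub> ract A2 ?F (d (r c))"
    using assms by (subst s_p_eq[of c, symmetric]) (simp_all add: A2.act_expand)
  have 2: "ract A2 ?F (d (r c)) = lact A2 (s (p a)) (lact A2 (s (p b)) (r c)) \<ominus>\<^bsub>A2\<^esub> lact A2 (s (p a \<otimes>\<^bsub>C\<^esub> p b)) (r c)"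
    using assms by (simp add: peiffer[symmetric] d_f A2.act_expand A2.lact_mult)
  show ?thesis
    using assms
    by (simp add: w_def obstruction_def A2.act_expand A2.lact_mult A2.ract_mult A2.lact_ract 1 2
      A1.m_assoc A2.M.diff_simps)
qed

text \<open>Because \<open>p (d x) = 0\<close>, the terms of \<open>w\<close> containing
  \<open>f\<close> and \<open>s\<close> vanish. This prepares the behaviour of the \<kappa>
  component of the model under the right action.\<close>

lemma w_d_left:
  assumes "x \<in> carrier A2" "b \<in> carrier A1"
  shows "ract A2 x b \<ominus>\<^bsub>A2\<^esub> r (d x \<otimes>\<^bsub>A1\<^esub> b) = w (d x) b \<oplus>\<^bsub>A2\<^esub> ract A2 (x \<ominus>\<^bsub>A2\<^esub> r (d x)) b"
  using assms by (simp add: w_def A2.act_expand A2.M.diff_simps)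

text \<open>Not a mirror image of \<open>w_d_left\<close>, since \<open>w\<close> lets its left
  argument act through \<open>s p\<close> only. The missing part \<open>d (r b)\<close> of
  \<open>b\<close> is supplied by the Peiffer identity.\<close>

lemma w_d_right:
  assumes "x \<in> carrier A2" "b \<in> carrier A1"
  shows "lact A2 b x \<ominus>\<^bsub>A2\<^esub> r (b \<otimes>\<^bsub>A1\<^esub> d x) = w b (d x) \<oplus>\<^bsub>A2\<^esub> lact A2 b (x \<ominus>\<^bsub>A2\<^esub> r (d x))"
proof -
  have 1: "ract A2 (r b) (d x) = lact A2 (d (r b)) x" using assms by (simp add: peiffer)
  have 2: "lact A2 b y = lact A2 (s (p b)) y \<oplus>\<^bsub>A2\<^esub> lact A2 (d (r b)) y" if "y \<in> carrier A2" for y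
    using assms that by (subst s_p_eq[of b, symmetric]) (simp_all add: A2.act_expand)
  have 3: "lact A2 (d (r b)) (r (d x)) = lact A2 (d (r b)) x"
    using assms by (simp add: peiffer r_s_d)
  show ?thesis using assms
    by (simp add: w_def A2.act_expand 1 2 3 A2.M.diff_simps)
qed

end

section \<open>The butterfly of a nonabelian cocycle\<close>

locale biext_pair = X: biext K X s r + Y: biext K X' s' r'
  for K :: "('k, 'r) ring_scheme" (structure)
    and X :: "('k, 'b, 'a2, 'a1, 'c) biext" and s :: "'c \<Rightarrow> 'a1" and r :: "'a1 \<Rightarrow> 'a2"
    and X' :: "('k, 'y, 'x2, 'x1, 'd) biext" and s' :: "'d \<Rightarrow> 'x1" and r' :: "'x1 \<Rightarrow> 'x2"
begin

abbreviation "B \<equiv> bx_B X"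
abbreviation "A2 \<equiv> bx_A2 X"
abbreviation "A1 \<equiv> bx_A1 X"
abbreviation "C \<equiv> bx_C X"
abbreviation "j \<equiv> bx_j X"
abbreviation "d \<equiv> bx_d X"
abbreviation "p \<equiv> bx_p X"
abbreviation "B' \<equiv> bx_B X'"
abbreviation "A2' \<equiv> bx_A2 X'"
abbreviation "A1' \<equiv> bx_A1 X'"
abbreviation "C' \<equiv> bx_C X'"
abbreviation "j' \<equiv> bx_j X'"
abbreviation "d' \<equiv> bx_d X'"
abbreviation "p' \<equiv> bx_p X'"

end

text \<open>A nonabelian 2-cocycle \<open>(S, m)\<close> on \<open>A1\<close> with values in the
  crossed bimodule \<open>X'\<close>, together with data \<open>k\<close> over \<open>A2\<close>. In
  a butterfly with a suitable linear section \<open>t\<close> of \<delta> these are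
  \<open>S = \<gamma> t\<close>, \<open>\<iota> (m a b) = t a t b - t (a b)\<close> and
  \<open>\<iota> (k x) = \<kappa> x - t (d x)\<close>. About the unit only
  \<open>p' (S 1) = 1\<close> is assumed.\<close>

locale butterfly_data = biext_pair K X s r X' s' r'
  for K :: "('k, 'r) ring_scheme" (structure)
    and X :: "('k, 'b, 'a2, 'a1, 'c) biext" and s :: "'c \<Rightarrow> 'a1" and r :: "'a1 \<Rightarrow> 'a2"
    and X' :: "('k, 'y, 'x2, 'x1, 'd) biext" and s' :: "'d \<Rightarrow> 'x1" and r' :: "'x1 \<Rightarrow> 'x2" +
  fixes S :: "'a1 \<Rightarrow> 'x1" and m :: "'a1 \<Rightarrow> 'a1 \<Rightarrow> 'x2" and k :: "'a2 \<Rightarrow> 'x2"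
  assumes S_lin: "lin_map K A1 A1' S"
    and m_bilin: "bilin_map K A1 A1 A2' m"
    and k_lin: "lin_map K A2 A2' k"
    and d_m: "\<lbrakk>a \<in> carrier A1; b \<in> carrier A1\<rbrakk> \<Longrightarrow> d' (m a b) = S a \<otimes>\<^bsub>A1'\<^esub> S b \<ominus>\<^bsub>A1'\<^esub> S (a \<otimes>\<^bsub>A1\<^esub> b)"
    and m_cocycle: "\<lbrakk>a \<in> carrier A1; b \<in> carrier A1; c \<in> carrier A1\<rbrakk> \<Longrightarrow>
      lact A2' (S a) (m b c) \<ominus>\<^bsub>A2'\<^esub> m (a \<otimes>\<^bsub>A1\<^esub> b) c \<oplus>\<^bsub>A2'\<^esub> m a (b \<otimes>\<^bsub>A1\<^esub> c)
        \<ominus>\<^bsub>A2'\<^esub> ract A2' (m a b) (S c) = \<zero>\<^bsub>A2'\<^esub>"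
    and p_S_one: "p' (S \<one>\<^bsub>A1\<^esub>) = \<one>\<^bsub>C'\<^esub>"
    and S_d [simp]: "x \<in> carrier A2 \<Longrightarrow> S (d x) = \<zero>\<^bsub>A1'\<^esub>"
    and d_k [simp]: "x \<in> carrier A2 \<Longrightarrow> d' (k x) = \<zero>\<^bsub>A1'\<^esub>"
    and k_ract: "\<lbrakk>x \<in> carrier A2; b \<in> carrier A1\<rbrakk> \<Longrightarrow>
      k (ract A2 x b) = m (d x) b \<oplus>\<^bsub>A2'\<^esub> ract A2' (k x) (S b)"
    and k_lact: "\<lbrakk>x \<in> carrier A2; b \<in> carrier A1\<rbrakk> \<Longrightarrow>
      k (lact A2 b x) = m b (d x) \<oplus>\<^bsub>A2'\<^esub> lact A2' (S b) (k x)"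
begin

sublocale S: lin_map K A1 A1' S by (rule S_lin)
sublocale m: bilin_map K A1 A1 A2' m by (rule m_bilin)
sublocale k: lin_map K A2 A2' k by (rule k_lin)

text \<open>The pair \<open>(a, x)\<close> stands for \<open>t a + \<iota> x\<close>, and this is
  its image under \<gamma>.\<close>

definition Gamma :: "'a1 \<times> 'x2 \<Rightarrow> 'x1" where
  "Gamma e = S (fst e) \<oplus>\<^bsub>A1'\<^esub> d' (snd e)"

text \<open>The pair \<open>(1, x)\<close> can only be a unit if \<open>d' x = 1 - S 1\<close>.  Any \<open>x\<^sub>0\<close> with this property determines the
  solution \<open>x\<close>: the cocycle identity at \<open>(1, 1, b)\<close> and the Peiffer identity give
  \<open>m 1 b = (x\<^sub>0 * S 1 - x\<^sub>0 + m 1 1) * S b\<close>, and \<open>x\<^sub>0 - x\<^sub>0 * S 1 = x\<^sub>0 * d' x\<^sub>0\<close>.\<close>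

definition unit1 :: 'x2 where
  "unit1 = r' (\<one>\<^bsub>A1'\<^esub> \<ominus>\<^bsub>A1'\<^esub> S \<one>\<^bsub>A1\<^esub>)"

definition unit2 :: 'x2 where
  "unit2 = ract A2' unit1 (d' unit1) \<ominus>\<^bsub>A2'\<^esub> m \<one>\<^bsub>A1\<^esub> \<one>\<^bsub>A1\<^esub>"

text \<open>Read off from \<open>(t a + \<iota> x) (t b + \<iota> y)\<close>: \<open>t a t b\<close>
  contributes \<open>m a b\<close>, the factor \<open>\<iota> x\<close> meets the whole second
  element through \<gamma>, and \<open>t a\<close> meets \<open>\<iota> y\<close> through
  \<open>S a\<close>.\<close>

definition model_mult :: "'a1 \<times> 'x2 \<Rightarrow> 'a1 \<times> 'x2 \<Rightarrow> 'a1 \<times> 'x2" where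
  "model_mult e e' = (fst e \<otimes>\<^bsub>A1\<^esub> fst e',
     m (fst e) (fst e') \<oplus>\<^bsub>A2'\<^esub> ract A2' (snd e) (Gamma e') \<oplus>\<^bsub>A2'\<^esub> lact A2' (S (fst e)) (snd e'))"

definition model_algebra :: "('k, 'a1 \<times> 'x2) module" where
  "model_algebra = \<lparr>carrier = carrier A1 \<times> carrier A2', monoid.mult = model_mult,
     one = (\<one>\<^bsub>A1\<^esub>, unit2), ring.zero = (\<zero>\<^bsub>A1\<^esub>, \<zero>\<^bsub>A2'\<^esub>),
     ring.add = (\<lambda>e e'. (fst e \<oplus>\<^bsub>A1\<^esub> fst e', snd e \<oplus>\<^bsub>A2'\<^esub> snd e')),
     smult = (\<lambda>t e. (t \<odot>\<^bsub>A1\<^esub> fst e, t \<odot>\<^bsub>A2'\<^esub> snd e))\<rparr>"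

definition model :: "('k, 'a2, 'a1, 'x2, 'x1, 'a1 \<times> 'x2) bfly" where
  "model = \<lparr>bf_E = model_algebra, bf_kappa = (\<lambda>x. (d x, k x)), bf_iota = (\<lambda>x. (\<zero>\<^bsub>A1\<^esub>, x)),
     bf_delta = fst, bf_gamma = Gamma\<rparr>"

lemma unit1_closed [simp]: "unit1 \<in> carrier A2'"
  and d_unit1: "d' unit1 = \<one>\<^bsub>A1'\<^esub> \<ominus>\<^bsub>A1'\<^esub> S \<one>\<^bsub>A1\<^esub>"
proof -
  show "unit1 \<in> carrier A2'" by (simp add: unit1_def)
  have "p' (\<one>\<^bsub>A1'\<^esub> \<ominus>\<^bsub>A1'\<^esub> S \<one>\<^bsub>A1\<^esub>) = \<zero>\<^bsub>C'\<^esub>" by (simp add: p_S_one)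
  then show "d' unit1 = \<one>\<^bsub>A1'\<^esub> \<ominus>\<^bsub>A1'\<^esub> S \<one>\<^bsub>A1\<^esub>"
    unfolding unit1_def by (intro Y.r_section) simp_all
qed

lemma unit2_closed [simp]: "unit2 \<in> carrier A2'"
  by (simp add: unit2_def)

text \<open>With \<open>n = S 1\<close> this is \<open>(1 - n)^2 - (n^2 - n) = 1 - n\<close>:
  correcting \<open>unit1\<close> leaves its image unchanged.\<close>

lemma d_unit2: "d' unit2 = \<one>\<^bsub>A1'\<^esub> \<ominus>\<^bsub>A1'\<^esub> S \<one>\<^bsub>A1\<^esub>"
  by (simp add: unit2_def d_unit1 d_m Y.A1.mult_expand Y.A1.l_diff_distr Y.A1.r_diff_distr Y.A1.M.diff_simps)

text \<open>Exactly what makes \<open>(1, unit2)\<close> a left unit for the pairs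
  \<open>(b, 0)\<close>. Write \<open>1 = S 1 + d' unit1\<close>: on \<open>m 1 b\<close> the first
  summand acts by the cocycle identity at \<open>(1, 1, b)\<close>, the second by the Peiffer
  identity.\<close>

lemma m_one_left:
  assumes "b \<in> carrier A1"
  shows "m \<one>\<^bsub>A1\<^esub> b = \<ominus>\<^bsub>A2'\<^esub> (ract A2' unit2 (S b))"
proof -
  let ?n = "S \<one>\<^bsub>A1\<^esub>"
  have 1: "lact A2' ?n (m \<one>\<^bsub>A1\<^esub> b) = ract A2' (m \<one>\<^bsub>A1\<^esub> \<one>\<^bsub>A1\<^esub>) (S b)"
    using m_cocycle[of "\<one>\<^bsub>A1\<^esub>" "\<one>\<^bsub>A1\<^esub>" b] assms by (simp add: Y.A2.M.diff_simps)
  have 2: "lact A2' (d' unit1) (m \<one>\<^bsub>A1\<^esub> b) = ract A2' unit1 (d' (m \<one>\<^bsub>A1\<^esub> b))"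
    using assms by (simp add: Y.peiffer)
  have "m \<one>\<^bsub>A1\<^esub> b = lact A2' ?n (m \<one>\<^bsub>A1\<^esub> b) \<oplus>\<^bsub>A2'\<^esub> lact A2' (d' unit1) (m \<one>\<^bsub>A1\<^esub> b)"
    using assms by (simp add: d_unit1 Y.A2.act_expand Y.A2.lact_one Y.A2.M.diff_simps)
  also have "\<dots> = \<ominus>\<^bsub>A2'\<^esub> (ract A2' unit2 (S b))"
    unfolding 1 2 using assms
    by (simp add: unit2_def d_m d_unit1 Y.A2.act_expand Y.A2.ract_mult Y.A2.ract_one Y.A2.M.diff_simps)
  finally show ?thesis .
qed

text \<open>The cocycle identity is now taken at \<open>(b, 1, 1)\<close>. The one-sided formula for
  \<open>unit2\<close> serves here too, because \<open>unit1 * d' unit1 = d' unit1 * unit1\<close>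
  by the Peiffer identity.\<close>

lemma m_one_right:
  assumes "b \<in> carrier A1"
  shows "m b \<one>\<^bsub>A1\<^esub> = \<ominus>\<^bsub>A2'\<^esub> (lact A2' (S b) unit2)"
proof -
  let ?n = "S \<one>\<^bsub>A1\<^esub>"
  have 1: "ract A2' (m b \<one>\<^bsub>A1\<^esub>) ?n = lact A2' (S b) (m \<one>\<^bsub>A1\<^esub> \<one>\<^bsub>A1\<^esub>)"
    using m_cocycle[of b "\<one>\<^bsub>A1\<^esub>" "\<one>\<^bsub>A1\<^esub>"] assms by (simp add: Y.A2.M.diff_simps)
  have 2: "ract A2' (m b \<one>\<^bsub>A1\<^esub>) (d' unit1) = lact A2' (d' (m b \<one>\<^bsub>A1\<^esub>)) unit1"
    using assms by (simp add: Y.peiffer)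
  have "m b \<one>\<^bsub>A1\<^esub> = ract A2' (m b \<one>\<^bsub>A1\<^esub>) ?n \<oplus>\<^bsub>A2'\<^esub> ract A2' (m b \<one>\<^bsub>A1\<^esub>) (d' unit1)"
    using assms by (simp add: d_unit1 Y.A2.act_expand Y.A2.ract_one Y.A2.M.diff_simps)
  also have "\<dots> = \<ominus>\<^bsub>A2'\<^esub> (lact A2' (S b) unit2)"
    unfolding 1 2 unit2_def Y.peiffer[OF unit1_closed unit1_closed, symmetric] using assms
    by (simp add: d_m d_unit1 Y.A2.act_expand Y.A2.lact_mult Y.A2.lact_one Y.A2.M.diff_simps)
  finally show ?thesis .
qed

section \<open>Algebra and butterfly axioms for the model\<close>

lemma model_simps [simp]:
  "carrier model_algebra = carrier A1 \<times> carrier A2'"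
  "monoid.mult model_algebra = model_mult"
  "\<one>\<^bsub>model_algebra\<^esub> = (\<one>\<^bsub>A1\<^esub>, unit2)"
  "\<zero>\<^bsub>model_algebra\<^esub> = (\<zero>\<^bsub>A1\<^esub>, \<zero>\<^bsub>A2'\<^esub>)"
  "e \<oplus>\<^bsub>model_algebra\<^esub> e' = (fst e \<oplus>\<^bsub>A1\<^esub> fst e', snd e \<oplus>\<^bsub>A2'\<^esub> snd e')"
  "t \<odot>\<^bsub>model_algebra\<^esub> e = (t \<odot>\<^bsub>A1\<^esub> fst e, t \<odot>\<^bsub>A2'\<^esub> snd e)"
  by (simp_all add: model_algebra_def)

lemma model_sel [simp]:
  "bf_E model = model_algebra" "bf_kappa model = (\<lambda>x. (d x, k x))" "bf_iota model = (\<lambda>x. (\<zero>\<^bsub>A1\<^esub>, x))"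
  "bf_delta model = fst" "bf_gamma model = Gamma"
  by (simp_all add: model_def)

lemma Gamma_closed [simp]: "e \<in> carrier A1 \<times> carrier A2' \<Longrightarrow> Gamma e \<in> carrier A1'"
  by (auto simp: Gamma_def)

lemma model_mult_closed [simp]: "\<lbrakk>e \<in> carrier A1 \<times> carrier A2'; e' \<in> carrier A1 \<times> carrier A2'\<rbrakk> \<Longrightarrow>
    model_mult e e' \<in> carrier A1 \<times> carrier A2'"
  by (auto simp: model_mult_def)

lemma Gamma_mult: "\<lbrakk>e \<in> carrier A1 \<times> carrier A2'; e' \<in> carrier A1 \<times> carrier A2'\<rbrakk> \<Longrightarrow>
    Gamma (model_mult e e') = Gamma e \<otimes>\<^bsub>A1'\<^esub> Gamma e'"
  by (auto simp: model_mult_def Gamma_def d_m Y.A1.mult_expand Y.A1.M.diff_simps)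

lemma model_assoc:
  assumes "e1 \<in> carrier A1 \<times> carrier A2'" "e2 \<in> carrier A1 \<times> carrier A2'" "e3 \<in> carrier A1 \<times> carrier A2'"
  shows "model_mult (model_mult e1 e2) e3 = model_mult e1 (model_mult e2 e3)"
proof -
  obtain a x b y c z where e: "e1 = (a, x)" "e2 = (b, y)" "e3 = (c, z)" by (metis surj_pair)
  have [simp]: "a \<in> carrier A1" "b \<in> carrier A1" "c \<in> carrier A1"
      "x \<in> carrier A2'" "y \<in> carrier A2'" "z \<in> carrier A2'"
    using assms e by auto
  \<comment> \<open>\<open>S\<close> is multiplicative up to \<open>d' (m a b)\<close>, whose action
    on \<open>z\<close> becomes an action of \<open>d' z\<close> on \<open>m a b\<close>. It cancels
    the corresponding part of \<open>m a b * Gamma (c, z)\<close> and leaves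
    \<open>m a b * S c\<close>, the term needed for the cocycle identity.\<close>
  have 1: "lact A2' (S (a \<otimes>\<^bsub>A1\<^esub> b)) z = lact A2' (S a) (lact A2' (S b) z) \<ominus>\<^bsub>A2'\<^esub> ract A2' (m a b) (d' z)"
    by (simp add: Y.peiffer[symmetric] d_m Y.A2.act_expand Y.A2.lact_mult Y.A2.M.diff_simps)
  have 2: "m (a \<otimes>\<^bsub>A1\<^esub> b) c \<oplus>\<^bsub>A2'\<^esub> ract A2' (m a b) (S c) = lact A2' (S a) (m b c) \<oplus>\<^bsub>A2'\<^esub> m a (b \<otimes>\<^bsub>A1\<^esub> c)"
    using m_cocycle[of a b c] by (simp add: Y.A2.M.diff_simps)
  have 3: "Gamma (model_mult (b, y) (c, z)) = Gamma (b, y) \<otimes>\<^bsub>A1'\<^esub> Gamma (c, z)"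
    by (simp add: Gamma_mult)
  have "snd (model_mult (model_mult e1 e2) e3) = (m (a \<otimes>\<^bsub>A1\<^esub> b) c \<oplus>\<^bsub>A2'\<^esub> ract A2' (m a b) (S c))
      \<oplus>\<^bsub>A2'\<^esub> (ract A2' (ract A2' x (Gamma (b, y))) (Gamma (c, z))
      \<oplus>\<^bsub>A2'\<^esub> ract A2' (lact A2' (S a) y) (Gamma (c, z)) \<oplus>\<^bsub>A2'\<^esub> lact A2' (S a) (lact A2' (S b) z))"
    unfolding e model_mult_def fst_conv snd_conv 1
    by (simp add: Y.A2.act_expand Y.A2.M.diff_simps Gamma_def[of "(c, z)"])
  also have "\<dots> = snd (model_mult e1 (model_mult e2 e3))"
    unfolding 2 e model_mult_def[of "(a, x)"] 3 fst_conv snd_conv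
    unfolding model_mult_def fst_conv snd_conv
    by (simp add: Y.A2.act_expand Y.A2.ract_mult Y.A2.lact_ract Y.A2.M.diff_simps)
  finally have snd: "snd (model_mult (model_mult e1 e2) e3) = snd (model_mult e1 (model_mult e2 e3))" .
  have "fst (model_mult (model_mult e1 e2) e3) = fst (model_mult e1 (model_mult e2 e3))"
    by (simp add: model_mult_def e X.A1.m_assoc)
  with snd show ?thesis by (simp add: prod_eq_iff)
qed

lemma model_one_left:
  assumes "e \<in> carrier A1 \<times> carrier A2'"
  shows "model_mult (\<one>\<^bsub>A1\<^esub>, unit2) e = e"
proof -
  obtain b y where e: "e = (b, y)" "b \<in> carrier A1" "y \<in> carrier A2'" using assms by auto
  then have 1: "ract A2' unit2 (d' y) = y \<ominus>\<^bsub>A2'\<^esub> lact A2' (S \<one>\<^bsub>A1\<^esub>) y"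
    by (simp add: Y.peiffer[symmetric] d_unit2 Y.A2.act_expand Y.A2.lact_one)
  from e show ?thesis
    by (simp add: model_mult_def Gamma_def 1 m_one_left Y.A2.act_expand Y.A2.M.diff_simps)
qed

lemma model_one_right:
  assumes "e \<in> carrier A1 \<times> carrier A2'"
  shows "model_mult e (\<one>\<^bsub>A1\<^esub>, unit2) = e"
proof -
  obtain b y where e: "e = (b, y)" "b \<in> carrier A1" "y \<in> carrier A2'" using assms by auto
  then show ?thesis
    by (simp add: model_mult_def Gamma_def m_one_right d_unit2 Y.A2.act_expand Y.A2.ract_one Y.A2.M.diff_simps)
qed

lemma model_algebra: "assoc_algebra K model_algebra"
proof -
  have grp: "abelian_group model_algebra"
  proof (rule abelian_groupI)
    fix x assume "x \<in> carrier model_algebra"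
    then show "\<exists>y\<in>carrier model_algebra. y \<oplus>\<^bsub>model_algebra\<^esub> x = \<zero>\<^bsub>model_algebra\<^esub>"
      by (intro bexI[of _ "(\<ominus>\<^bsub>A1\<^esub> fst x, \<ominus>\<^bsub>A2'\<^esub> snd x)"]) (auto simp: X.A1.M.l_neg Y.A2.M.l_neg)
  qed (auto simp: X.A1.M.a_ac Y.A2.M.a_ac)
  have mod: "module K model_algebra"
    by (rule moduleI[OF X.K_cring grp])
      (auto simp: X.A1.smult_l_distr X.A1.smult_r_distr X.A1.smult_assoc1
        Y.A2.smult_l_distr Y.A2.smult_r_distr Y.A2.smult_assoc1)
  have mon: "monoid model_algebra"
    by (rule monoidI) (auto simp: model_assoc model_one_left model_one_right simp del: mem_Times_iff
      intro!: model_mult_closed)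
  have ring: "ring model_algebra"
    by (rule ringI[OF grp mon])
      (auto simp: model_mult_def Gamma_def X.A1.l_distr X.A1.r_distr m.expand Y.A2.act_expand Y.A2.M.diff_simps)
  interpret M: module K model_algebra by (rule mod)
  interpret R: ring model_algebra by (rule ring)
  show ?thesis
    by unfold_locales
      (auto simp: model_mult_def Gamma_def X.A1.smult_mult_left X.A1.smult_mult_right m.expand
        Y.A2.act_expand Y.A2.smult_r_distr Y.A1.smult_r_distr)
qed

text \<open>The axioms on \<kappa> are where \<open>k\<close> enters: \<open>k_ract\<close> and
  \<open>k_lact\<close> give the products with \<open>(b, 0)\<close>, while \<open>S_d\<close> and
  \<open>d_k\<close> kill every term containing the \<open>A2'\<close> component of the other
  factor.\<close>

lemma butterfly_model: "butterfly K X X' model"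
proof -
  have one: "Gamma (\<one>\<^bsub>A1\<^esub>, unit2) = \<one>\<^bsub>A1'\<^esub>"
    by (simp add: Gamma_def d_unit2 Y.A1.M.diff_simps)
  show ?thesis
    unfolding butterfly_def model_sel
  proof (intro conjI ballI)
    show "assoc_algebra K model_algebra" by (rule model_algebra)
    show "fst \<in> algebra_homs K model_algebra A1"
      by (auto simp: algebra_homs_def ring_hom_def linear_maps_def model_mult_def)
    show "fst ` carrier model_algebra = carrier A1"
      using Y.A2.M.zero_closed by force
    show "(\<lambda>x. (\<zero>\<^bsub>A1\<^esub>, x)) \<in> linear_maps K A2' model_algebra"
      by (auto simp: linear_maps_def)
    show "Gamma \<in> algebra_homs K model_algebra A1'"
    proof -
      have "Gamma (model_mult x y) = Gamma x \<otimes>\<^bsub>A1'\<^esub> Gamma y"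
        if "x \<in> carrier model_algebra" "y \<in> carrier model_algebra" for x y
        using that by (simp add: Gamma_mult)
      moreover have "Gamma \<in> linear_maps K model_algebra A1'"
        by (rule linear_mapsI) (auto simp: Gamma_def Y.A1.smult_r_distr Y.A1.M.a_ac)
      ultimately show ?thesis
        by (auto simp: algebra_homs_def ring_hom_def one linear_maps_def)
    qed
    show "(\<lambda>x. (d x, k x)) \<in> linear_maps K A2 model_algebra"
      by (auto simp: linear_maps_def)
  qed (auto simp: inj_on_def Gamma_def model_mult_def k_ract k_lact Y.A2.act_expand Y.peiffer[symmetric]
      Y.A2.M.a_ac)
qed

end

section \<open>Isomorphisms of butterflies\<close>

locale butterfly_on = biext_pair K X s r X' s' r'
  for K (structure) and X s r X' s' r' +
  fixes F
  assumes butterfly: "butterfly K X X' F"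
begin

abbreviation "E \<equiv> bf_E F"
abbreviation "\<kappa> \<equiv> bf_kappa F"
abbreviation "\<iota> \<equiv> bf_iota F"
abbreviation "\<delta> \<equiv> bf_delta F"
abbreviation "\<gamma> \<equiv> bf_gamma F"

sublocale E: assoc_algebra K E
  using butterfly by (simp add: butterfly_def)

sublocale \<kappa>: lin_map K A2 E \<kappa>
  using butterfly by unfold_locales (simp add: butterfly_def)

sublocale \<iota>: lin_map K A2' E \<iota>
  using butterfly by unfold_locales (simp add: butterfly_def)

sublocale \<delta>: lin_map K E A1 \<delta>
  using butterfly by unfold_locales (simp add: butterfly_def algebra_homs_def)

sublocale \<gamma>: lin_map K E A1' \<gamma>
  using butterfly by unfold_locales (simp add: butterfly_def algebra_homs_def)

lemma \<delta>_mult [simp]: "\<lbrakk>x \<in> carrier E; y \<in> carrier E\<rbrakk> \<Longrightarrow> \<delta> (x \<otimes>\<^bsub>E\<^esub> y) = \<delta> x \<otimes>\<^bsub>A1\<^esub> \<delta> y"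
  and \<delta>_one [simp]: "\<delta> \<one>\<^bsub>E\<^esub> = \<one>\<^bsub>A1\<^esub>"
  and \<gamma>_mult [simp]: "\<lbrakk>x \<in> carrier E; y \<in> carrier E\<rbrakk> \<Longrightarrow> \<gamma> (x \<otimes>\<^bsub>E\<^esub> y) = \<gamma> x \<otimes>\<^bsub>A1'\<^esub> \<gamma> y"
  and \<gamma>_one [simp]: "\<gamma> \<one>\<^bsub>E\<^esub> = \<one>\<^bsub>A1'\<^esub>"
  using butterfly by (auto simp: butterfly_def algebra_homs_def ring_hom_def)

lemma \<delta>_\<kappa> [simp]: "x \<in> carrier A2 \<Longrightarrow> \<delta> (\<kappa> x) = d x"
  and \<gamma>_\<iota> [simp]: "y \<in> carrier A2' \<Longrightarrow> \<gamma> (\<iota> y) = d' y"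
  and \<gamma>_\<kappa> [simp]: "x \<in> carrier A2 \<Longrightarrow> \<gamma> (\<kappa> x) = \<zero>\<^bsub>A1'\<^esub>"
  and \<delta>_surj: "\<delta> ` carrier E = carrier A1"
  and \<iota>_inj: "inj_on \<iota> (carrier A2')"
  and \<iota>_image: "\<iota> ` carrier A2' = {e \<in> carrier E. \<delta> e = \<zero>\<^bsub>A1\<^esub>}"
  using butterfly by (auto simp: butterfly_def)

lemma \<delta>_\<iota> [simp]: "y \<in> carrier A2' \<Longrightarrow> \<delta> (\<iota> y) = \<zero>\<^bsub>A1\<^esub>"
  using \<iota>_image by blast

lemma \<iota>_exact: "\<lbrakk>e \<in> carrier E; \<delta> e = \<zero>\<^bsub>A1\<^esub>\<rbrakk> \<Longrightarrow> \<exists>y\<in>carrier A2'. \<iota> y = e"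
proof -
  assume "e \<in> carrier E" "\<delta> e = \<zero>\<^bsub>A1\<^esub>"
  then have "e \<in> \<iota> ` carrier A2'" unfolding \<iota>_image by simp
  then show ?thesis by auto
qed

lemma \<iota>_eqD: "\<lbrakk>\<iota> x = \<iota> y; x \<in> carrier A2'; y \<in> carrier A2'\<rbrakk> \<Longrightarrow> x = y"
  using \<iota>_inj by (auto dest: inj_onD)

lemma \<iota>_mult_left: "\<lbrakk>y \<in> carrier A2'; e \<in> carrier E\<rbrakk> \<Longrightarrow> \<iota> y \<otimes>\<^bsub>E\<^esub> e = \<iota> (ract A2' y (\<gamma> e))"
  and \<iota>_mult_right: "\<lbrakk>y \<in> carrier A2'; e \<in> carrier E\<rbrakk> \<Longrightarrow> e \<otimes>\<^bsub>E\<^esub> \<iota> y = \<iota> (lact A2' (\<gamma> e) y)"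
  and \<kappa>_mult_left: "\<lbrakk>x \<in> carrier A2; e \<in> carrier E\<rbrakk> \<Longrightarrow> \<kappa> x \<otimes>\<^bsub>E\<^esub> e = \<kappa> (ract A2 x (\<delta> e))"
  and \<kappa>_mult_right: "\<lbrakk>x \<in> carrier A2; e \<in> carrier E\<rbrakk> \<Longrightarrow> e \<otimes>\<^bsub>E\<^esub> \<kappa> x = \<kappa> (lact A2 (\<delta> e) x)"
proof -
  \<comment> \<open>The axiom quantifies over \<open>A2\<close> and \<open>A2'\<close> at once; each
    single law follows by inserting zero for the other variable.\<close>
  have *: "\<forall>a\<in>carrier A2. \<forall>a'\<in>carrier A2'. \<forall>e\<in>carrier E.
        \<iota> (ract A2' a' (\<gamma> e)) = \<iota> a' \<otimes>\<^bsub>E\<^esub> e \<and> \<iota> (lact A2' (\<gamma> e) a') = e \<otimes>\<^bsub>E\<^esub> \<iota> a' \<and>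
        \<kappa> (ract A2 a (\<delta> e)) = \<kappa> a \<otimes>\<^bsub>E\<^esub> e \<and> \<kappa> (lact A2 (\<delta> e) a) = e \<otimes>\<^bsub>E\<^esub> \<kappa> a"
    using butterfly by (simp add: butterfly_def)
  show "\<lbrakk>y \<in> carrier A2'; e \<in> carrier E\<rbrakk> \<Longrightarrow> \<iota> y \<otimes>\<^bsub>E\<^esub> e = \<iota> (ract A2' y (\<gamma> e))"
    and "\<lbrakk>y \<in> carrier A2'; e \<in> carrier E\<rbrakk> \<Longrightarrow> e \<otimes>\<^bsub>E\<^esub> \<iota> y = \<iota> (lact A2' (\<gamma> e) y)"
    using *[rule_format, OF X.A2.M.zero_closed] by simp_all
  show "\<lbrakk>x \<in> carrier A2; e \<in> carrier E\<rbrakk> \<Longrightarrow> \<kappa> x \<otimes>\<^bsub>E\<^esub> e = \<kappa> (ract A2 x (\<delta> e))"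
    and "\<lbrakk>x \<in> carrier A2; e \<in> carrier E\<rbrakk> \<Longrightarrow> e \<otimes>\<^bsub>E\<^esub> \<kappa> x = \<kappa> (lact A2 (\<delta> e) x)"
    using *[rule_format, OF _ Y.A2.M.zero_closed] by simp_all
qed

end

locale butterfly_pair = F: butterfly_on K X s r X' s' r' F + F': butterfly_on K X s r X' s' r' F'
  for K (structure) and X s r X' s' r' F F'

text \<open>The five lemma for the extensions of \<open>A1\<close> by \<open>A2'\<close> underlying
  \<open>E\<close> and \<open>E'\<close>: \<alpha> induces the identity on the sub and on the
  quotient.\<close>

lemma (in butterfly_pair) linear_compatible_bij:
  assumes "lin_map K F.E F'.E \<alpha>"
    and \<alpha>_\<iota>: "\<And>y. y \<in> carrier F.A2' \<Longrightarrow> \<alpha> (F.\<iota> y) = F'.\<iota> y"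
    and \<alpha>_\<delta>: "\<And>e. e \<in> carrier F.E \<Longrightarrow> F'.\<delta> (\<alpha> e) = F.\<delta> e"
  shows "bij_betw \<alpha> (carrier F.E) (carrier F'.E)"
proof -
  interpret \<alpha>: lin_map K F.E F'.E \<alpha> by fact
  have "e = \<zero>\<^bsub>F.E\<^esub>" if e: "e \<in> carrier F.E" "\<alpha> e = \<zero>\<^bsub>F'.E\<^esub>" for e
  proof -
    have "F.\<delta> e = \<zero>\<^bsub>F.A1\<^esub>" using \<alpha>_\<delta>[OF e(1)] e(2) by simp
    then obtain y where y: "y \<in> carrier F.A2'" "F.\<iota> y = e" using F.\<iota>_exact e(1) by blast
    then have "F'.\<iota> y = F'.\<iota> \<zero>\<^bsub>F.A2'\<^esub>" using \<alpha>_\<iota> e(2) by force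
    then have "y = \<zero>\<^bsub>F.A2'\<^esub>" using y(1) F'.\<iota>_eqD by blast
    then show ?thesis using y by simp
  qed
  then have inj: "inj_on \<alpha> (carrier F.E)" by (rule \<alpha>.inj_onI_kernel)
  have "e' \<in> \<alpha> ` carrier F.E" if e': "e' \<in> carrier F'.E" for e'
  proof -
    have "F'.\<delta> e' \<in> F.\<delta> ` carrier F.E" using e' by (simp add: F.\<delta>_surj)
    then obtain e where e: "e \<in> carrier F.E" "F.\<delta> e = F'.\<delta> e'" by force
    then have "F'.\<delta> (e' \<ominus>\<^bsub>F'.E\<^esub> \<alpha> e) = \<zero>\<^bsub>F.A1\<^esub>" using e' \<alpha>_\<delta> by simp
    then obtain y where y: "y \<in> carrier F.A2'" "F'.\<iota> y = e' \<ominus>\<^bsub>F'.E\<^esub> \<alpha> e"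
      using F'.\<iota>_exact e e' by (meson F'.E.M.minus_closed \<alpha>.closed)
    have "\<alpha> (e \<oplus>\<^bsub>F.E\<^esub> F.\<iota> y) = e'" using y e e' \<alpha>_\<iota> by (simp add: F'.E.M.diff_simps)
    then show ?thesis using e y by (metis F.E.M.a_closed F.\<iota>.closed imageI)
  qed
  then have "\<alpha> ` carrier F.E = carrier F'.E" by auto
  with inj show ?thesis by (simp add: bij_betw_def)
qed

text \<open>The unit takes care of itself: by surjectivity some \<open>e\<close> is sent to
  \<open>1\<close>, and \<open>\<alpha> 1 \<alpha> e = \<alpha> e\<close> then reads
  \<open>\<alpha> 1 = 1\<close>. This spares comparing the computed units of models.\<close>

lemma (in butterfly_pair) butterfly_isoI:
  assumes \<alpha>: "lin_map K F.E F'.E \<alpha>"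
    and mult: "\<And>x y. \<lbrakk>x \<in> carrier F.E; y \<in> carrier F.E\<rbrakk> \<Longrightarrow> \<alpha> (x \<otimes>\<^bsub>F.E\<^esub> y) = \<alpha> x \<otimes>\<^bsub>F'.E\<^esub> \<alpha> y"
    and \<iota>: "\<And>y. y \<in> carrier F.A2' \<Longrightarrow> \<alpha> (F.\<iota> y) = F'.\<iota> y"
    and \<kappa>: "\<And>x. x \<in> carrier F.A2 \<Longrightarrow> \<alpha> (F.\<kappa> x) = F'.\<kappa> x"
    and \<delta>: "\<And>e. e \<in> carrier F.E \<Longrightarrow> F'.\<delta> (\<alpha> e) = F.\<delta> e"
    and \<gamma>: "\<And>e. e \<in> carrier F.E \<Longrightarrow> F'.\<gamma> (\<alpha> e) = F.\<gamma> e"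
  shows "butterfly_iso K X X' F F'"
proof -
  interpret \<alpha>: lin_map K F.E F'.E \<alpha> by fact
  have "\<alpha> ` carrier F.E = carrier F'.E"
    using linear_compatible_bij[OF \<alpha> \<iota> \<delta>] by (simp add: bij_betw_def)
  then obtain e where e: "e \<in> carrier F.E" "\<alpha> e = \<one>\<^bsub>F'.E\<^esub>"
    by (metis F'.E.one_closed imageE)
  have "\<alpha> \<one>\<^bsub>F.E\<^esub> \<otimes>\<^bsub>F'.E\<^esub> \<alpha> e = \<alpha> e" using mult[OF F.E.one_closed e(1)] e(1) by simp
  then have "\<alpha> \<one>\<^bsub>F.E\<^esub> = \<one>\<^bsub>F'.E\<^esub>" unfolding e(2) by simp
  then have "\<alpha> \<in> algebra_homs K F.E F'.E"
    using mult \<alpha>.lin by (auto simp: algebra_homs_def ring_hom_def)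
  then show ?thesis unfolding butterfly_iso_def using \<iota> \<kappa> \<delta> \<gamma> by blast
qed

locale butterfly_iso_map = butterfly_pair K X s r X' s' r' F F'
  for K (structure) and X s r X' s' r' F F' +
  fixes \<alpha>
  assumes lin: "lin_map K (bf_E F) (bf_E F') \<alpha>"
    and mult: "\<lbrakk>x \<in> carrier (bf_E F); y \<in> carrier (bf_E F)\<rbrakk> \<Longrightarrow> \<alpha> (x \<otimes>\<^bsub>bf_E F\<^esub> y) = \<alpha> x \<otimes>\<^bsub>bf_E F'\<^esub> \<alpha> y"
    and one: "\<alpha> \<one>\<^bsub>bf_E F\<^esub> = \<one>\<^bsub>bf_E F'\<^esub>"
    and \<iota>: "v \<in> carrier (bx_A2 X') \<Longrightarrow> \<alpha> (bf_iota F v) = bf_iota F' v"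
    and \<kappa>: "z \<in> carrier (bx_A2 X) \<Longrightarrow> \<alpha> (bf_kappa F z) = bf_kappa F' z"
    and \<delta>: "e \<in> carrier (bf_E F) \<Longrightarrow> bf_delta F' (\<alpha> e) = bf_delta F e"
    and \<gamma>: "e \<in> carrier (bf_E F) \<Longrightarrow> bf_gamma F' (\<alpha> e) = bf_gamma F e"
    and bij: "bij_betw \<alpha> (carrier (bf_E F)) (carrier (bf_E F'))"

lemma (in butterfly_pair) butterfly_isoE:
  assumes "butterfly_iso K X X' F F'"
  obtains \<alpha> where "butterfly_iso_map K X s r X' s' r' F F' \<alpha>"
proof -
  from assms obtain \<alpha> where \<alpha>: "\<alpha> \<in> algebra_homs K F.E F'.E"
    "\<And>y. y \<in> carrier F.A2' \<Longrightarrow> \<alpha> (F.\<iota> y) = F'.\<iota> y"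
    "\<And>x. x \<in> carrier F.A2 \<Longrightarrow> \<alpha> (F.\<kappa> x) = F'.\<kappa> x"
    "\<And>e. e \<in> carrier F.E \<Longrightarrow> F'.\<delta> (\<alpha> e) = F.\<delta> e"
    "\<And>e. e \<in> carrier F.E \<Longrightarrow> F'.\<gamma> (\<alpha> e) = F.\<gamma> e"
    unfolding butterfly_iso_def by blast
  have lin: "lin_map K F.E F'.E \<alpha>"
    using \<alpha>(1) by unfold_locales (simp add: algebra_homs_def)
  show thesis
    by (rule that, rule butterfly_iso_map.intro[OF butterfly_pair_axioms],
        rule butterfly_iso_map_axioms.intro[OF lin _ _ \<alpha>(2-5) linear_compatible_bij[OF lin \<alpha>(2) \<alpha>(4)]])
      (use \<alpha>(1) in \<open>auto simp: algebra_homs_def ring_hom_def\<close>)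
qed

context biext_pair
begin

lemma butterfly_onI: "butterfly K X X' F \<Longrightarrow> butterfly_on K X s r X' s' r' F"
  by unfold_locales

lemma butterfly_pairI: "\<lbrakk>butterfly K X X' F; butterfly K X X' F'\<rbrakk> \<Longrightarrow> butterfly_pair K X s r X' s' r' F F'"
  by (intro butterfly_pair.intro butterfly_onI)

lemma butterfly_iso_refl: "butterfly_iso K X X' F F"
  unfolding butterfly_iso_def
  by (intro bexI[of _ "\<lambda>x. x"]) (auto simp: algebra_homs_def ring_hom_def linear_maps_def)

lemma butterfly_iso_trans:
  assumes "butterfly_iso K X X' F F'" "butterfly_iso K X X' F' F''"
  shows "butterfly_iso K X X' F F''"
proof -
  from assms(1) obtain \<alpha> where \<alpha>: "\<alpha> \<in> algebra_homs K (bf_E F) (bf_E F')"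
    "\<forall>x\<in>carrier A2. \<alpha> (bf_kappa F x) = bf_kappa F' x"
    "\<forall>y\<in>carrier A2'. \<alpha> (bf_iota F y) = bf_iota F' y"
    "\<forall>e\<in>carrier (bf_E F). bf_delta F' (\<alpha> e) = bf_delta F e \<and> bf_gamma F' (\<alpha> e) = bf_gamma F e"
    unfolding butterfly_iso_def by blast
  from assms(2) obtain \<beta> where \<beta>: "\<beta> \<in> algebra_homs K (bf_E F') (bf_E F'')"
    "\<forall>x\<in>carrier A2. \<beta> (bf_kappa F' x) = bf_kappa F'' x"
    "\<forall>y\<in>carrier A2'. \<beta> (bf_iota F' y) = bf_iota F'' y"
    "\<forall>e\<in>carrier (bf_E F'). bf_delta F'' (\<beta> e) = bf_delta F' e \<and> bf_gamma F'' (\<beta> e) = bf_gamma F' e"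
    unfolding butterfly_iso_def by blast
  show ?thesis unfolding butterfly_iso_def
  proof (intro bexI[of _ "\<beta> \<circ> \<alpha>"])
    show "\<beta> \<circ> \<alpha> \<in> algebra_homs K (bf_E F) (bf_E F'')"
      using \<alpha>(1) \<beta>(1) by (auto simp: algebra_homs_def ring_hom_def linear_maps_def Pi_iff)
    have "\<alpha> e \<in> carrier (bf_E F')" if "e \<in> carrier (bf_E F)" for e
      using \<alpha>(1) that by (auto simp: algebra_homs_def linear_maps_def)
    then show "(\<forall>a\<in>carrier A2. (\<beta> \<circ> \<alpha>) (bf_kappa F a) = bf_kappa F'' a) \<and>
      (\<forall>a'\<in>carrier A2'. (\<beta> \<circ> \<alpha>) (bf_iota F a') = bf_iota F'' a') \<and>
      (\<forall>e\<in>carrier (bf_E F). bf_delta F'' ((\<beta> \<circ> \<alpha>) e) = bf_delta F e \<and>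
        bf_gamma F'' ((\<beta> \<circ> \<alpha>) e) = bf_gamma F e)"
      using \<alpha> \<beta> by simp
  qed
qed

lemma butterfly_iso_sym:
  assumes F: "butterfly K X X' F" "butterfly K X X' F'" and iso: "butterfly_iso K X X' F F'"
  shows "butterfly_iso K X X' F' F"
proof -
  interpret FF: butterfly_pair K X s r X' s' r' F F' by (rule butterfly_pairI[OF F])
  interpret FF': butterfly_pair K X s r X' s' r' F' F by (rule butterfly_pairI[OF F(2,1)])
  from iso obtain \<alpha> where "butterfly_iso_map K X s r X' s' r' F F' \<alpha>" by (rule FF.butterfly_isoE)
  then interpret A: butterfly_iso_map K X s r X' s' r' F F' \<alpha> .
  interpret \<alpha>: lin_map K FF.F.E FF.F'.E \<alpha> by (rule A.lin)
  define \<beta> where "\<beta> = the_inv_into (carrier FF.F.E) \<alpha>"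
  have inj: "inj_on \<alpha> (carrier FF.F.E)" and im: "\<alpha> ` carrier FF.F.E = carrier FF.F'.E"
    using A.bij by (rule bij_betw_imp_inj_on, rule bij_betw_imp_surj_on)
  have \<beta>_\<alpha> [simp]: "\<beta> (\<alpha> e) = e" if "e \<in> carrier FF.F.E" for e
    unfolding \<beta>_def using inj that by (rule the_inv_into_f_f)
  have \<beta>_closed [simp]: "\<beta> e \<in> carrier FF.F.E" and \<alpha>_\<beta> [simp]: "\<alpha> (\<beta> e) = e"
    if "e \<in> carrier FF.F'.E" for e
  proof -
    have "e \<in> \<alpha> ` carrier FF.F.E" unfolding im by (rule that)
    then obtain e0 where "e0 \<in> carrier FF.F.E" "e = \<alpha> e0" by (rule imageE)
    then show "\<beta> e \<in> carrier FF.F.E" "\<alpha> (\<beta> e) = e" by simp_all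
  qed
  have \<beta>_eq: "\<beta> e = e0" if "e0 \<in> carrier FF.F.E" "\<alpha> e0 = e" for e e0
    using that by auto
  show ?thesis
  proof (rule FF'.butterfly_isoI)
    show "lin_map K FF.F'.E FF.F.E \<beta>"
      by unfold_locales (auto intro!: linear_mapsI \<beta>_eq)
    show "\<beta> (x \<otimes>\<^bsub>FF.F'.E\<^esub> y) = \<beta> x \<otimes>\<^bsub>FF.F.E\<^esub> \<beta> y" if "x \<in> carrier FF.F'.E" "y \<in> carrier FF.F'.E" for x y
      using that by (auto intro!: \<beta>_eq simp: A.mult)
  qed (auto intro!: \<beta>_eq simp: A.\<iota> A.\<kappa> A.\<delta>[symmetric] A.\<gamma>[symmetric])
qed

text \<open>The induced morphism of bimodules is an isomorphism invariant, so whether a butterfly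
  lies over \<open>(\<phi>\<^sub>0, \<phi>)\<close> can be decided on an isomorphic model.\<close>

lemma butterfly_over_iso:
  assumes F: "butterfly K X X' F" "butterfly K X X' F'" and iso: "butterfly_iso K X X' F F'"
    and over: "butterfly_over X X' F \<phi>\<^sub>0 \<phi>" and \<phi>: "\<phi> \<in> carrier B \<rightarrow> carrier B'"
  shows "butterfly_over X X' F' \<phi>\<^sub>0 \<phi>"
proof -
  interpret FF: butterfly_pair K X s r X' s' r' F F' by (rule butterfly_pairI[OF F])
  from iso obtain \<alpha> where "butterfly_iso_map K X s r X' s' r' F F' \<alpha>" by (rule FF.butterfly_isoE)
  then interpret A: butterfly_iso_map K X s r X' s' r' F F' \<alpha> .
  interpret \<alpha>: lin_map K FF.F.E FF.F'.E \<alpha> by (rule A.lin)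
  show ?thesis unfolding butterfly_over_def
  proof (intro conjI ballI)
    fix e' assume "e' \<in> carrier FF.F'.E"
    then obtain e where "e \<in> carrier FF.F.E" "\<alpha> e = e'" using A.bij by (metis bij_betw_def imageE)
    then show "\<phi>\<^sub>0 (p (FF.F'.\<delta> e')) = p' (FF.F'.\<gamma> e')"
      using over A.\<delta> A.\<gamma> by (auto simp: butterfly_over_def)
  next
    fix b assume b: "b \<in> carrier B"
    then have \<phi>b: "\<phi> b \<in> carrier B'" using \<phi> by blast
    have "\<alpha> (FF.F.\<kappa> (j b) \<oplus>\<^bsub>FF.F.E\<^esub> FF.F.\<iota> (j' (\<phi> b))) = \<zero>\<^bsub>FF.F'.E\<^esub>"
      using over b by (auto simp: butterfly_over_def)
    then show "FF.F'.\<kappa> (j b) \<oplus>\<^bsub>FF.F'.E\<^esub> FF.F'.\<iota> (j' (\<phi> b)) = \<zero>\<^bsub>FF.F'.E\<^esub>"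
      using b \<phi>b by (simp add: A.\<iota> A.\<kappa>)
  qed
qed

end

section \<open>Transport of structure\<close>

text \<open>\<open>E\<close> is merely a structure with closed operations; a bijection respecting
  them pulls all algebra axioms back from \<open>E'\<close>. Both copies on another type and twisted
  butterflies obtain their axioms in this way.\<close>

locale algebra_transport = E': assoc_algebra K E'
  for K :: "('k, 'r) ring_scheme" (structure) and E :: "('k, 'e, 's) module_scheme"
    and E' :: "('k, 'f, 't) module_scheme" +
  fixes \<alpha> :: "'e \<Rightarrow> 'f"
  assumes bij: "bij_betw \<alpha> (carrier E) (carrier E')"
    and add: "\<lbrakk>x \<in> carrier E; y \<in> carrier E\<rbrakk> \<Longrightarrow> x \<oplus>\<^bsub>E\<^esub> y \<in> carrier E \<and> \<alpha> (x \<oplus>\<^bsub>E\<^esub> y) = \<alpha> x \<oplus>\<^bsub>E'\<^esub> \<alpha> y"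
    and mult: "\<lbrakk>x \<in> carrier E; y \<in> carrier E\<rbrakk> \<Longrightarrow> x \<otimes>\<^bsub>E\<^esub> y \<in> carrier E \<and> \<alpha> (x \<otimes>\<^bsub>E\<^esub> y) = \<alpha> x \<otimes>\<^bsub>E'\<^esub> \<alpha> y"
    and smult: "\<lbrakk>k \<in> carrier K; x \<in> carrier E\<rbrakk> \<Longrightarrow> k \<odot>\<^bsub>E\<^esub> x \<in> carrier E \<and> \<alpha> (k \<odot>\<^bsub>E\<^esub> x) = k \<odot>\<^bsub>E'\<^esub> \<alpha> x"
    and zero: "\<zero>\<^bsub>E\<^esub> \<in> carrier E \<and> \<alpha> \<zero>\<^bsub>E\<^esub> = \<zero>\<^bsub>E'\<^esub>"
    and one: "\<one>\<^bsub>E\<^esub> \<in> carrier E \<and> \<alpha> \<one>\<^bsub>E\<^esub> = \<one>\<^bsub>E'\<^esub>"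
begin

lemma \<alpha>_closed [simp]: "x \<in> carrier E \<Longrightarrow> \<alpha> x \<in> carrier E'"
  using bij by (auto simp: bij_betw_def)

lemma \<alpha>_eqI: "\<lbrakk>x \<in> carrier E; y \<in> carrier E; \<alpha> x = \<alpha> y\<rbrakk> \<Longrightarrow> x = y"
  using bij by (auto simp: bij_betw_def dest: inj_onD)

lemma \<alpha>_surj: "y \<in> carrier E' \<Longrightarrow> \<exists>x\<in>carrier E. \<alpha> x = y"
  using bij by (metis bij_betw_def imageE)

lemma assoc_algebra: "assoc_algebra K E"
proof -
  note [simp] = add mult smult zero one
  have grp: "abelian_group E"
  proof (rule abelian_groupI)
    fix x assume x: "x \<in> carrier E"
    obtain y where y: "y \<in> carrier E" "\<alpha> y = \<ominus>\<^bsub>E'\<^esub> \<alpha> x" using \<alpha>_surj x by (meson E'.M.a_inv_closed \<alpha>_closed)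
    then show "\<exists>y\<in>carrier E. y \<oplus>\<^bsub>E\<^esub> x = \<zero>\<^bsub>E\<^esub>"
      using x by (intro bexI[of _ y] \<alpha>_eqI) (simp_all add: E'.M.l_neg)
  qed (auto intro!: \<alpha>_eqI simp: E'.M.a_ac)
  have mon: "monoid E"
    by (rule monoidI) (auto intro!: \<alpha>_eqI simp: E'.m_assoc)
  have ring: "ring E"
    by (rule ringI[OF grp mon]) (auto intro!: \<alpha>_eqI simp: E'.l_distr E'.r_distr)
  have mod: "module K E"
    by (rule moduleI[OF E'.R.is_cring grp])
      (auto intro!: \<alpha>_eqI simp: E'.smult_l_distr E'.smult_r_distr E'.smult_assoc1)
  interpret M: module K E by (rule mod)
  interpret R: ring E by (rule ring)
  show ?thesis
    by unfold_locales (auto intro!: \<alpha>_eqI simp: E'.smult_mult_left E'.smult_mult_right)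
qed

end

lemma (in biext_pair) butterfly_transport:
  assumes F': "butterfly K X X' F'" and "algebra_transport K (bf_E F) (bf_E F') \<alpha>"
    and \<kappa>: "\<And>x. x \<in> carrier A2 \<Longrightarrow> bf_kappa F x \<in> carrier (bf_E F) \<and> \<alpha> (bf_kappa F x) = bf_kappa F' x"
    and \<iota>: "\<And>y. y \<in> carrier A2' \<Longrightarrow> bf_iota F y \<in> carrier (bf_E F) \<and> \<alpha> (bf_iota F y) = bf_iota F' y"
    and \<delta>: "\<And>e. e \<in> carrier (bf_E F) \<Longrightarrow> bf_delta F' (\<alpha> e) = bf_delta F e"
    and \<gamma>: "\<And>e. e \<in> carrier (bf_E F) \<Longrightarrow> bf_gamma F' (\<alpha> e) = bf_gamma F e"
  shows "butterfly K X X' F" and "butterfly_iso K X X' F F'"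
proof -
  interpret F': butterfly_on K X s r X' s' r' F' by (rule butterfly_onI[OF F'])
  interpret \<alpha>: algebra_transport K "bf_E F" "bf_E F'" \<alpha> by fact
  note [simp] = \<alpha>.add \<alpha>.mult \<alpha>.smult \<alpha>.zero \<alpha>.one \<kappa> \<iota>
  note [simp] = \<delta>[symmetric] \<gamma>[symmetric]
  show "butterfly K X X' F" unfolding butterfly_def
  proof (intro conjI ballI)
    show "assoc_algebra K (bf_E F)" by (rule \<alpha>.assoc_algebra)
    show "bf_delta F \<in> algebra_homs K (bf_E F) A1"
      by (auto simp: algebra_homs_def ring_hom_def linear_maps_def)
    show "bf_gamma F \<in> algebra_homs K (bf_E F) A1'"
      by (auto simp: algebra_homs_def ring_hom_def linear_maps_def)
    show "bf_kappa F \<in> linear_maps K A2 (bf_E F)" "bf_iota F \<in> linear_maps K A2' (bf_E F)"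
      by (auto simp: linear_maps_def intro!: \<alpha>.\<alpha>_eqI)
    show "bf_delta F ` carrier (bf_E F) = carrier A1"
    proof
      show "bf_delta F ` carrier (bf_E F) \<subseteq> carrier A1" by auto
      show "carrier A1 \<subseteq> bf_delta F ` carrier (bf_E F)"
      proof
        fix a assume "a \<in> carrier A1"
        then obtain e' where "e' \<in> carrier F'.E" "F'.\<delta> e' = a" using F'.\<delta>_surj by (metis imageE)
        moreover then obtain e where "e \<in> carrier (bf_E F)" "\<alpha> e = e'" using \<alpha>.\<alpha>_surj by blast
        ultimately show "a \<in> bf_delta F ` carrier (bf_E F)" by (intro image_eqI[of _ _ e]) auto
      qed
    qed
    show "inj_on (bf_iota F) (carrier A2')"
    proof (rule inj_onI)
      fix x y assume "x \<in> carrier A2'" "y \<in> carrier A2'" "bf_iota F x = bf_iota F y"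
      then show "x = y" using \<iota>[of x] \<iota>[of y] by (intro F'.\<iota>_eqD) simp_all
    qed
    show "bf_iota F ` carrier A2' = {e \<in> carrier (bf_E F). bf_delta F e = \<zero>\<^bsub>A1\<^esub>}"
    proof
      show "bf_iota F ` carrier A2' \<subseteq> {e \<in> carrier (bf_E F). bf_delta F e = \<zero>\<^bsub>A1\<^esub>}" by auto
      show "{e \<in> carrier (bf_E F). bf_delta F e = \<zero>\<^bsub>A1\<^esub>} \<subseteq> bf_iota F ` carrier A2'"
      proof
        fix e assume e: "e \<in> {e \<in> carrier (bf_E F). bf_delta F e = \<zero>\<^bsub>A1\<^esub>}"
        then obtain y where "y \<in> carrier A2'" "F'.\<iota> y = \<alpha> e"
          using F'.\<iota>_exact[of "\<alpha> e"] by auto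
        with e show "e \<in> bf_iota F ` carrier A2'" by (intro image_eqI[of _ _ y] \<alpha>.\<alpha>_eqI) simp_all
      qed
    qed
  next
    fix a a' e assume a: "a \<in> carrier A2" "a' \<in> carrier A2'" "e \<in> carrier (bf_E F)"
    show "bf_iota F (ract A2' a' (bf_gamma F e)) = bf_iota F a' \<otimes>\<^bsub>bf_E F\<^esub> e"
      by (rule \<alpha>.\<alpha>_eqI) (simp_all add: a F'.\<iota>_mult_left)
    show "bf_iota F (lact A2' (bf_gamma F e) a') = e \<otimes>\<^bsub>bf_E F\<^esub> bf_iota F a'"
      by (rule \<alpha>.\<alpha>_eqI) (simp_all add: a F'.\<iota>_mult_right)
    show "bf_kappa F (ract A2 a (bf_delta F e)) = bf_kappa F a \<otimes>\<^bsub>bf_E F\<^esub> e"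
      by (rule \<alpha>.\<alpha>_eqI) (simp_all add: a F'.\<kappa>_mult_left)
    show "bf_kappa F (lact A2 (bf_delta F e) a) = e \<otimes>\<^bsub>bf_E F\<^esub> bf_kappa F a"
      by (rule \<alpha>.\<alpha>_eqI) (simp_all add: a F'.\<kappa>_mult_right)
  qed simp_all
  have "\<alpha> \<in> algebra_homs K (bf_E F) (bf_E F')"
    by (auto simp: algebra_homs_def ring_hom_def linear_maps_def)
  then show "butterfly_iso K X X' F F'"
    unfolding butterfly_iso_def by (intro bexI[of _ \<alpha>] conjI ballI) (simp_all add: \<delta> \<gamma> del: \<delta>[symmetric] \<gamma>[symmetric])
qed

section \<open>Simply transitive actions of quotient groups\<close>

text \<open>The map \<open>t\<close> is an action only up to \<open>R\<close>, as twisting is an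
  action only up to isomorphism. Passing to classes makes it strict; since the stabilizer of each
  class is \<open>N\<close>, the quotient by \<open>N\<close> acts freely, and transitivity modulo
  \<open>R\<close> gives the rest.\<close>

lemma simply_transitive_quotient_action:
  fixes G (structure) and t :: "'g \<Rightarrow> 's \<Rightarrow> 's"
  assumes N: "N \<lhd> G" and R: "equiv U R" "S \<subseteq> U"
    and closed: "\<And>g x. \<lbrakk>g \<in> carrier G; x \<in> S\<rbrakk> \<Longrightarrow> t g x \<in> S"
    and cong: "\<And>g x y. \<lbrakk>g \<in> carrier G; x \<in> S; y \<in> S; (x, y) \<in> R\<rbrakk> \<Longrightarrow> (t g x, t g y) \<in> R"
    and mult: "\<And>g h x. \<lbrakk>g \<in> carrier G; h \<in> carrier G; x \<in> S\<rbrakk> \<Longrightarrow> (t (g \<otimes> h) x, t g (t h x)) \<in> R"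
    and free: "\<And>g x. \<lbrakk>g \<in> carrier G; x \<in> S\<rbrakk> \<Longrightarrow> (t g x, x) \<in> R \<longleftrightarrow> g \<in> N"
    and transitive: "\<And>x y. \<lbrakk>x \<in> S; y \<in> S\<rbrakk> \<Longrightarrow> \<exists>g\<in>carrier G. (t g x, y) \<in> R"
  shows "\<exists>\<psi>. simply_transitive_action (G Mod N) (S // R) \<psi> \<and>
    (\<forall>g\<in>carrier G. \<forall>x\<in>S. \<psi> (N #> g) (R `` {x}) = R `` {t g x})"
proof -
  interpret N: normal N G by (rule N)
  have class_eq: "R `` {x} = R `` {y} \<longleftrightarrow> (x, y) \<in> R" if "x \<in> S" "y \<in> S" for x y
    using eq_equiv_class_iff[OF R(1)] R(2) that by blast
  have coset_eq: "N #> g = N #> h \<longleftrightarrow> g \<otimes> inv h \<in> N" if gh: "g \<in> carrier G" "h \<in> carrier G" for g h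
  proof
    assume "N #> g = N #> h"
    then have "g \<in> N #> h" using N.rcos_self[OF gh(1) N.subgroup_axioms] by simp
    then obtain n where n: "n \<in> N" "g = n \<otimes> h" by (auto simp: r_coset_def)
    then show "g \<otimes> inv h \<in> N" using gh by (simp add: N.m_assoc)
  next
    assume "g \<otimes> inv h \<in> N"
    then have "(g \<otimes> inv h) \<otimes> h \<in> N #> h" by (auto simp: r_coset_def)
    then have "g \<in> N #> h" using gh by (simp add: N.m_assoc)
    then show "N #> g = N #> h" using gh N.repr_independence N.subgroup_axioms by blast
  qed
  have step: "R `` {t (g \<otimes> h) x} = R `` {t g (t h x)}" if "g \<in> carrier G" "h \<in> carrier G" "x \<in> S" for g h x
    using that by (simp add: class_eq closed mult)
  have fixes_class: "R `` {t n x} = R `` {x}" if "n \<in> N" "x \<in> S" for n x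
    using that by (simp add: class_eq closed free)
  have wd: "R `` {t g x} = R `` {t h y}"
    if gh: "g \<in> carrier G" "h \<in> carrier G" "N #> g = N #> h" and xy: "x \<in> S" "y \<in> S" "R `` {x} = R `` {y}"
    for g h x y
  proof -
    \<comment> \<open>Write \<open>g\<close> as \<open>(g inv h) h\<close>: the first factor lies in
      \<open>N\<close> and fixes every class, so only \<open>h\<close> matters, and
      \<open>cong\<close> exchanges the representatives.\<close>
    have n: "g \<otimes> inv h \<in> N" using gh coset_eq by blast
    have "R `` {t g x} = R `` {t ((g \<otimes> inv h) \<otimes> h) x}" using gh by (simp add: N.m_assoc)
    also have "\<dots> = R `` {t (g \<otimes> inv h) (t h x)}" using gh xy by (intro step) simp_all
    also have "\<dots> = R `` {t h x}" using n gh xy closed by (intro fixes_class) simp_all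
    also have "\<dots> = R `` {t h y}" using gh xy by (simp add: class_eq closed cong)
    finally show ?thesis .
  qed
  \<comment> \<open>Neither the coset nor the class has a preferred representative;
    \<open>wd\<close> makes the described value unique. The map is restricted to
    \<open>S // R\<close> because elements of \<open>Bij\<close> are extensional.\<close>
  define \<psi> where "\<psi> A = (\<lambda>Q\<in>S // R. THE P. \<exists>g\<in>carrier G. \<exists>x\<in>S. A = N #> g \<and> Q = R `` {x} \<and> P = R `` {t g x})" for A
  have \<psi>: "\<psi> (N #> g) (R `` {x}) = R `` {t g x}" if "g \<in> carrier G" "x \<in> S" for g x
  proof -
    have "(THE P. \<exists>g'\<in>carrier G. \<exists>x'\<in>S. N #> g = N #> g' \<and> R `` {x} = R `` {x'} \<and> P = R `` {t g' x'}) = R `` {t g x}"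
      using that wd by (intro the_equality) blast+
    then show ?thesis using that by (simp add: \<psi>_def quotientI)
  qed
  have G: "carrier (G Mod N) = (\<lambda>g. N #> g) ` carrier G"
    by (auto simp: FactGroup_def RCOSETS_def)
  have Q: "S // R = (\<lambda>x. R `` {x}) ` S"
    by (auto simp: quotient_def)
  have Gm: "(N #> g) \<otimes>\<^bsub>G Mod N\<^esub> (N #> h) = N #> (g \<otimes> h)" if "g \<in> carrier G" "h \<in> carrier G" for g h
    using that by (simp add: N.rcos_sum)
  have maps: "\<psi> (N #> g) P \<in> S // R" if "g \<in> carrier G" "P \<in> S // R" for g P
    using that unfolding Q by (auto simp: \<psi> closed)
  have comp: "\<psi> (N #> g) (\<psi> (N #> h) P) = \<psi> (N #> (g \<otimes> h)) P"
    if "g \<in> carrier G" "h \<in> carrier G" "P \<in> S // R" for g h P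
    using that unfolding Q by (auto simp: \<psi> closed step)
  have unit: "\<psi> (N #> \<one>) P = P" if "P \<in> S // R" for P
    using that unfolding Q by (auto simp: \<psi> fixes_class)
  have Bij: "\<psi> (N #> g) \<in> Bij (S // R)" if g: "g \<in> carrier G" for g
  proof -
    have "bij_betw (\<psi> (N #> g)) (S // R) (S // R)"
      by (rule bij_betw_byWitness[where f' = "\<psi> (N #> inv g)"])
        (use g maps in \<open>auto simp: comp unit\<close>)
    then show ?thesis by (simp add: Bij_def \<psi>_def)
  qed
  have hom: "group_hom (G Mod N) (BijGroup (S // R)) \<psi>"
  proof (intro group_hom.intro group_hom_axioms.intro homI)
    show "group (G Mod N)" by (rule N.factorgroup_is_group)
    show "group (BijGroup (S // R))" by (rule group_BijGroup)
    fix A assume "A \<in> carrier (G Mod N)"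
    then show "\<psi> A \<in> carrier (BijGroup (S // R))"
      unfolding G by (auto simp: BijGroup_def Bij)
  next
    fix A A' assume "A \<in> carrier (G Mod N)" "A' \<in> carrier (G Mod N)"
    then obtain g h where gh: "g \<in> carrier G" "h \<in> carrier G" "A = N #> g" "A' = N #> h"
      unfolding G by blast
    have "\<psi> (N #> (g \<otimes> h)) = compose (S // R) (\<psi> (N #> g)) (\<psi> (N #> h))"
      by (rule extensionalityI[of _ "S // R"])
        (use gh comp in \<open>auto simp: compose_def\<close>, simp add: \<psi>_def)
    then show "\<psi> (A \<otimes>\<^bsub>G Mod N\<^esub> A') = \<psi> A \<otimes>\<^bsub>BijGroup (S // R)\<^esub> \<psi> A'"
      unfolding gh(3,4) Gm[OF gh(1,2)] using gh by (simp add: BijGroup_def Bij)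
  qed
  have "simply_transitive_action (G Mod N) (S // R) \<psi>"
  proof (intro simply_transitive_action.intro group_action.intro hom simply_transitive_action_axioms.intro)
    fix P P' assume "P \<in> S // R" "P' \<in> S // R"
    then obtain x y where xy: "x \<in> S" "y \<in> S" "P = R `` {x}" "P' = R `` {y}" unfolding Q by blast
    obtain g where g: "g \<in> carrier G" "(t g x, y) \<in> R" using transitive xy by blast
    show "\<exists>!A. A \<in> carrier (G Mod N) \<and> \<psi> A P = P'"
    proof (rule ex1I[of _ "N #> g"])
      show "N #> g \<in> carrier (G Mod N) \<and> \<psi> (N #> g) P = P'"
        using g xy unfolding G by (simp add: \<psi> class_eq closed)
      fix A assume "A \<in> carrier (G Mod N) \<and> \<psi> A P = P'"
      then obtain h where h: "h \<in> carrier G" "A = N #> h" "\<psi> (N #> h) P = P'" unfolding G by blast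
      have "R `` {t g x} = R `` {y}" using g xy by (simp add: class_eq closed)
      moreover have "R `` {t h x} = R `` {y}" using h xy by (simp add: \<psi>)
      ultimately have eq: "R `` {t h x} = R `` {t g x}" by (simp only:)
      \<comment> \<open>\<open>h inv g\<close> fixes the class of \<open>t g x\<close>, hence
        belongs to \<open>N\<close>, and the two cosets agree.\<close>
      have "R `` {t (h \<otimes> inv g) (t g x)} = R `` {t ((h \<otimes> inv g) \<otimes> g) x}"
        using g h xy by (intro step[symmetric]) simp_all
      also have "\<dots> = R `` {t g x}" using eq g h by (simp add: N.m_assoc)
      finally have "h \<otimes> inv g \<in> N" using g h xy free closed by (simp add: class_eq)
      then show "A = N #> g" using coset_eq g h by blast
    qed
  qed
  with \<psi> show ?thesis by blast
qed

section \<open>Hochschild cochains of low degree\<close>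

lemma tuples_1: "tuples C 1 = {[x] | x. x \<in> carrier C}"
  by (auto simp: tuples_def length_Suc_conv)

lemma tuples_2: "tuples C 2 = {[x, y] | x y. x \<in> carrier C \<and> y \<in> carrier C}"
  by (auto simp: tuples_def length_Suc_conv numeral_2_eq_2)

lemma tuples_3: "tuples C 3 = {[x, y, z] | x y z. x \<in> carrier C \<and> y \<in> carrier C \<and> z \<in> carrier C}"
  by (auto simp: tuples_def length_Suc_conv numeral_3_eq_3)

lemma mem_tuples [simp]:
  "[x] \<in> tuples C (Suc 0) \<longleftrightarrow> x \<in> carrier C"
  "[x, y] \<in> tuples C 2 \<longleftrightarrow> x \<in> carrier C \<and> y \<in> carrier C"
  "[x, y, z] \<in> tuples C 3 \<longleftrightarrow> x \<in> carrier C \<and> y \<in> carrier C \<and> z \<in> carrier C"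
  by (simp_all add: tuples_def)

locale hochschild = bimodule K C B
  for K :: "('k, 'r) ring_scheme" (structure) and C :: "('k, 'c, 's) module_scheme" (structure)
    and B :: "('k, 'b, 'c) bimodule" (structure)
begin

lemma cochain1_iff: "f \<in> hoch_cochains K C B 1 \<longleftrightarrow>
    f \<in> extensional (tuples C 1) \<and> (\<lambda>x. f [x]) \<in> linear_maps K C B"
proof -
  have upd: "cs[0 := x] = [x]" if "cs \<in> tuples C 1" for cs :: "'c list" and x
    using that unfolding tuples_1 by auto
  \<comment> \<open>An inhabitant is needed to discard the quantifier over \<open>cs\<close>, which
    no longer occurs once the update is evaluated.\<close>
  have ne: "\<exists>cs. cs \<in> tuples C 1" by (rule exI[of _ "[\<zero>\<^bsub>C\<^esub>]"]) simp
  have "f \<in> hoch_cochains K C B 1 \<longleftrightarrow> f \<in> extensional (tuples C 1) \<and> f \<in> tuples C 1 \<rightarrow> carrier B \<and>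
      (\<forall>cs\<in>tuples C 1.
        (\<forall>x\<in>carrier C. \<forall>y\<in>carrier C. f (cs[0 := x \<oplus>\<^bsub>C\<^esub> y]) = f (cs[0 := x]) \<oplus>\<^bsub>B\<^esub> f (cs[0 := y])) \<and>
        (\<forall>k\<in>carrier K. \<forall>x\<in>carrier C. f (cs[0 := k \<odot>\<^bsub>C\<^esub> x]) = k \<odot>\<^bsub>B\<^esub> f (cs[0 := x])))"
    unfolding hoch_cochains_def PiE_def less_one by blast
  also have "\<dots> \<longleftrightarrow> f \<in> extensional (tuples C 1) \<and> f \<in> tuples C 1 \<rightarrow> carrier B \<and>
        (\<forall>x\<in>carrier C. \<forall>y\<in>carrier C. f [x \<oplus>\<^bsub>C\<^esub> y] = f [x] \<oplus>\<^bsub>B\<^esub> f [y]) \<and>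
        (\<forall>k\<in>carrier K. \<forall>x\<in>carrier C. f [k \<odot>\<^bsub>C\<^esub> x] = k \<odot>\<^bsub>B\<^esub> f [x])"
    using ne by (simp add: upd cong: ball_cong)
  also have "f \<in> tuples C 1 \<rightarrow> carrier B \<longleftrightarrow> (\<lambda>x. f [x]) \<in> carrier C \<rightarrow> carrier B"
    unfolding tuples_1 by blast
  finally show ?thesis by (simp add: linear_maps_def)
qed

lemma cochain2_iff: "g \<in> hoch_cochains K C B 2 \<longleftrightarrow>
    g \<in> extensional (tuples C 2) \<and> (\<lambda>x y. g [x, y]) \<in> bilinear_maps K C C B"
proof
  assume g: "g \<in> hoch_cochains K C B 2"
  then have 1: "g \<in> extensional (tuples C 2)" and "g \<in> tuples C 2 \<rightarrow> carrier B"
    by (simp_all add: hoch_cochains_def PiE_def)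
  then have closed: "\<And>x y. x \<in> carrier C \<Longrightarrow> y \<in> carrier C \<Longrightarrow> g [x, y] \<in> carrier B"
    by (auto simp: tuples_2)
  from g have lin: "\<And>cs i x y. \<lbrakk>cs \<in> tuples C 2; i < 2; x \<in> carrier C; y \<in> carrier C\<rbrakk> \<Longrightarrow>
      g (cs[i := x \<oplus>\<^bsub>C\<^esub> y]) = g (cs[i := x]) \<oplus>\<^bsub>B\<^esub> g (cs[i := y])"
    and sm: "\<And>cs i k x. \<lbrakk>cs \<in> tuples C 2; i < 2; k \<in> carrier K; x \<in> carrier C\<rbrakk> \<Longrightarrow>
      g (cs[i := k \<odot>\<^bsub>C\<^esub> x]) = k \<odot>\<^bsub>B\<^esub> g (cs[i := x])"
    by (simp_all add: hoch_cochains_def)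
  have "(\<lambda>x y. g [x, y]) \<in> bilinear_maps K C C B"
  proof (rule bilinear_mapsI)
    fix x x' y assume c: "x \<in> carrier C" "x' \<in> carrier C" "y \<in> carrier C"
    show "g [x \<oplus>\<^bsub>C\<^esub> x', y] = g [x, y] \<oplus>\<^bsub>B\<^esub> g [x', y]"
      using lin[of "[x, y]" 0 x x'] c by (simp add: tuples_2)
  next
    fix x y y' assume c: "x \<in> carrier C" "y \<in> carrier C" "y' \<in> carrier C"
    show "g [x, y \<oplus>\<^bsub>C\<^esub> y'] = g [x, y] \<oplus>\<^bsub>B\<^esub> g [x, y']"
      using lin[of "[x, y]" 1 y y'] c by (simp add: tuples_2)
  next
    fix k x y assume c: "k \<in> carrier K" "x \<in> carrier C" "y \<in> carrier C"
    show "g [k \<odot>\<^bsub>C\<^esub> x, y] = k \<odot>\<^bsub>B\<^esub> g [x, y]"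
      using sm[of "[x, y]" 0 k x] c by (simp add: tuples_2)
    show "g [x, k \<odot>\<^bsub>C\<^esub> y] = k \<odot>\<^bsub>B\<^esub> g [x, y]"
      using sm[of "[x, y]" 1 k y] c by (simp add: tuples_2)
  qed (rule closed)
  with 1 show "g \<in> extensional (tuples C 2) \<and> (\<lambda>x y. g [x, y]) \<in> bilinear_maps K C C B" by simp
next
  assume g: "g \<in> extensional (tuples C 2) \<and> (\<lambda>x y. g [x, y]) \<in> bilinear_maps K C C B"
  interpret g: bilin_map K C C B "\<lambda>x y. g [x, y]" by unfold_locales (use g in simp)
  show "g \<in> hoch_cochains K C B 2"
    unfolding hoch_cochains_def
  proof (intro CollectI conjI ballI allI impI PiE_I)
    fix cs assume cs: "cs \<in> tuples C 2"
    then obtain a b where ab: "cs = [a, b]" "a \<in> carrier C" "b \<in> carrier C" by (auto simp: tuples_2)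
    then show "g cs \<in> carrier B" by simp
    fix i :: nat assume "i < 2"
    then consider "i = 0" | "i = 1" by linarith
    note i = this
    show "g (cs[i := x \<oplus>\<^bsub>C\<^esub> y]) = g (cs[i := x]) \<oplus>\<^bsub>B\<^esub> g (cs[i := y])"
      if "x \<in> carrier C" "y \<in> carrier C" for x y
      using i that ab by cases (simp_all add: g.expand)
    show "g (cs[i := k \<odot>\<^bsub>C\<^esub> x]) = k \<odot>\<^bsub>B\<^esub> g (cs[i := x])" if "k \<in> carrier K" "x \<in> carrier C" for k x
      using i that ab by cases (simp_all add: g.expand)
  qed (use g in \<open>auto simp: extensional_def\<close>)
qed

lemma cochain1_lin:
  assumes "f \<in> hoch_cochains K C B 1"
  shows "lin_map K C B (\<lambda>x. f [x])"
proof unfold_locales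
  show "(\<lambda>x. f [x]) \<in> linear_maps K C B" using assms unfolding cochain1_iff by (rule conjunct2)
qed

lemma cochain2_bilin:
  assumes "g \<in> hoch_cochains K C B 2"
  shows "bilin_map K C C B (\<lambda>x y. g [x, y])"
proof unfold_locales
  show "(\<lambda>x y. g [x, y]) \<in> bilinear_maps K C C B" using assms unfolding cochain2_iff by (rule conjunct2)
qed

lemma cochain1I: "f \<in> linear_maps K C B \<Longrightarrow> (\<lambda>cs\<in>tuples C 1. f (hd cs)) \<in> hoch_cochains K C B 1"
  unfolding cochain1_iff by (auto simp: linear_maps_def)

lemma cochain2_eqI:
  assumes "g \<in> hoch_cochains K C B 2" "h \<in> hoch_cochains K C B 2"
    and "\<And>x y. \<lbrakk>x \<in> carrier C; y \<in> carrier C\<rbrakk> \<Longrightarrow> g [x, y] = h [x, y]"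
  shows "g = h"
proof (rule extensionalityI[of _ "tuples C 2"])
  show "g \<in> extensional (tuples C 2)" "h \<in> extensional (tuples C 2)"
    using assms(1,2) by (simp_all add: cochain2_iff)
  fix cs assume "cs \<in> tuples C 2"
  then show "g cs = h cs" using assms(3) unfolding tuples_2 by blast
qed

lemma hoch_d1:
  assumes "f \<in> hoch_cochains K C B 1" "a \<in> carrier C" "b \<in> carrier C"
  shows "hoch_d C B 1 f [a, b] = lact B a (f [b]) \<ominus>\<^bsub>B\<^esub> f [a \<otimes>\<^bsub>C\<^esub> b] \<oplus>\<^bsub>B\<^esub> ract B (f [a]) b"
proof -
  interpret f: lin_map K C B "\<lambda>x. f [x]" using assms by (simp add: cochain1_lin)
  have "[a, b] \<in> tuples C (Suc 1)" using assms by (simp add: tuples_def)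
  then show ?thesis using assms f.closed
    by (simp add: hoch_d_def alternating_def B.M.minus_eq lessThan_Suc)
qed

lemma hoch_d2:
  assumes "g \<in> hoch_cochains K C B 2" "a \<in> carrier C" "b \<in> carrier C" "c \<in> carrier C"
  shows "hoch_d C B 2 g [a, b, c] = lact B a (g [b, c]) \<ominus>\<^bsub>B\<^esub> g [a \<otimes>\<^bsub>C\<^esub> b, c] \<oplus>\<^bsub>B\<^esub> g [a, b \<otimes>\<^bsub>C\<^esub> c]
    \<ominus>\<^bsub>B\<^esub> ract B (g [a, b]) c"
proof -
  interpret g: bilin_map K C C B "\<lambda>x y. g [x, y]" using assms by (simp add: cochain2_bilin)
  have "[a, b, c] \<in> tuples C (Suc 2)" using assms by (simp add: tuples_def)
  moreover have "{..<2::nat} = {0, 1}" by auto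
  ultimately show ?thesis using assms g.closed
    by (simp add: hoch_d_def alternating_def B.M.minus_eq B.M.a_ac)
qed

section \<open>Additivity of the differential on 2-cochains\<close>

lemma cochain2_add:
  assumes "g \<in> hoch_cochains K C B 2" "h \<in> hoch_cochains K C B 2"
  shows "(\<lambda>cs\<in>tuples C 2. g cs \<oplus>\<^bsub>B\<^esub> h cs) \<in> hoch_cochains K C B 2"
proof -
  interpret g: bilin_map K C C B "\<lambda>x y. g [x, y]" using assms by (simp add: cochain2_bilin)
  interpret h: bilin_map K C C B "\<lambda>x y. h [x, y]" using assms by (simp add: cochain2_bilin)
  show ?thesis unfolding cochain2_iff
    by (auto intro!: bilinear_mapsI simp: tuples_2 g.expand h.expand B.smult_r_distr B.M.a_ac)
qed

lemma cochain2_neg: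
  assumes "g \<in> hoch_cochains K C B 2"
  shows "(\<lambda>cs\<in>tuples C 2. \<ominus>\<^bsub>B\<^esub> g cs) \<in> hoch_cochains K C B 2"
proof -
  interpret g: bilin_map K C C B "\<lambda>x y. g [x, y]" using assms by (simp add: cochain2_bilin)
  show ?thesis unfolding cochain2_iff
    by (auto intro!: bilinear_mapsI simp: tuples_2 g.expand B.smult_r_minus B.M.minus_add B.M.a_ac)
qed

lemma cochain2_zero: "(\<lambda>cs\<in>tuples C 2. \<zero>\<^bsub>B\<^esub>) \<in> hoch_cochains K C B 2"
  unfolding cochain2_iff by (auto intro!: bilinear_mapsI simp: tuples_2)

lemma hoch_d2_add:
  assumes "g \<in> hoch_cochains K C B 2" "h \<in> hoch_cochains K C B 2"
    and "a \<in> carrier C" "b \<in> carrier C" "c \<in> carrier C"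
  shows "hoch_d C B 2 (\<lambda>cs\<in>tuples C 2. g cs \<oplus>\<^bsub>B\<^esub> h cs) [a, b, c] =
    hoch_d C B 2 g [a, b, c] \<oplus>\<^bsub>B\<^esub> hoch_d C B 2 h [a, b, c]"
proof -
  interpret g: bilin_map K C C B "\<lambda>x y. g [x, y]" using assms by (simp add: cochain2_bilin)
  interpret h: bilin_map K C C B "\<lambda>x y. h [x, y]" using assms by (simp add: cochain2_bilin)
  show ?thesis
    using assms g.closed h.closed
    by (simp add: hoch_d2 cochain2_add act_expand B.M.diff_simps)
qed

lemma hoch_d2_neg:
  assumes "g \<in> hoch_cochains K C B 2" "a \<in> carrier C" "b \<in> carrier C" "c \<in> carrier C"
  shows "hoch_d C B 2 (\<lambda>cs\<in>tuples C 2. \<ominus>\<^bsub>B\<^esub> g cs) [a, b, c] = \<ominus>\<^bsub>B\<^esub> hoch_d C B 2 g [a, b, c]"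
proof -
  interpret g: bilin_map K C C B "\<lambda>x y. g [x, y]" using assms by (simp add: cochain2_bilin)
  show ?thesis
    using assms g.closed
    by (simp add: hoch_d2 cochain2_neg act_expand B.M.diff_simps)
qed

lemma hoch_d2_zero:
  assumes "a \<in> carrier C" "b \<in> carrier C" "c \<in> carrier C"
  shows "hoch_d C B 2 (\<lambda>cs\<in>tuples C 2. \<zero>\<^bsub>B\<^esub>) [a, b, c] = \<zero>\<^bsub>B\<^esub>"
  using assms by (simp add: hoch_d2 cochain2_zero)

lemma hoch_d2_closed:
  assumes "g \<in> hoch_cochains K C B 2" "a \<in> carrier C" "b \<in> carrier C" "c \<in> carrier C"
  shows "hoch_d C B 2 g [a, b, c] \<in> carrier B"
proof -
  interpret g: bilin_map K C C B "\<lambda>x y. g [x, y]" using assms by (simp add: cochain2_bilin)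
  show ?thesis using assms g.closed by (simp add: hoch_d2)
qed

lemma cocycle2_iff: "g \<in> hoch_cocycles K C B 2 \<longleftrightarrow> g \<in> hoch_cochains K C B 2 \<and>
    (\<forall>a\<in>carrier C. \<forall>b\<in>carrier C. \<forall>c\<in>carrier C. hoch_d C B 2 g [a, b, c] = \<zero>\<^bsub>B\<^esub>)"
proof -
  have "hoch_d C B 2 g = (\<lambda>cs\<in>tuples C (Suc 2). \<zero>\<^bsub>B\<^esub>) \<longleftrightarrow>
      (\<forall>cs\<in>tuples C 3. hoch_d C B 2 g cs = \<zero>\<^bsub>B\<^esub>)"
  proof
    assume "\<forall>cs\<in>tuples C 3. hoch_d C B 2 g cs = \<zero>\<^bsub>B\<^esub>"
    then show "hoch_d C B 2 g = (\<lambda>cs\<in>tuples C (Suc 2). \<zero>\<^bsub>B\<^esub>)"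
      by (intro extensionalityI[of _ "tuples C (Suc 2)"]) (simp_all add: hoch_d_def)
  qed simp
  also have "\<dots> \<longleftrightarrow> (\<forall>a\<in>carrier C. \<forall>b\<in>carrier C. \<forall>c\<in>carrier C. hoch_d C B 2 g [a, b, c] = \<zero>\<^bsub>B\<^esub>)"
    unfolding tuples_3 by blast
  finally show ?thesis by (simp add: hoch_cocycles_def)
qed

lemma coboundary2_iff: "g \<in> hoch_coboundaries K C B 2 \<longleftrightarrow>
    (\<exists>f\<in>hoch_cochains K C B 1. g = hoch_d C B 1 f)"
  by (auto simp: hoch_coboundaries_def numeral_2_eq_2)

lemma hoch_d1_cochain:
  assumes "f \<in> hoch_cochains K C B 1"
  shows "hoch_d C B 1 f \<in> hoch_cochains K C B 2"
proof -
  interpret f: lin_map K C B "\<lambda>x. f [x]" using assms by (simp add: cochain1_lin)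
  have "hoch_d C B 1 f \<in> extensional (tuples C 2)" by (simp add: hoch_d_def numeral_2_eq_2)
  moreover have "(\<lambda>x y. hoch_d C B 1 f [x, y]) \<in> bilinear_maps K C C B"
    using assms
    by (intro bilinear_mapsI) (simp_all add: hoch_d1 f.closed[simplified] C.mult_expand act_expand
        B.smult_r_distr B.smult_diff B.M.diff_simps del: One_nat_def)
  ultimately show ?thesis by (simp add: cochain2_iff)
qed

lemma hoch_d1_cocycle:
  assumes "f \<in> hoch_cochains K C B 1"
  shows "hoch_d C B 1 f \<in> hoch_cocycles K C B 2"
proof -
  interpret f: lin_map K C B "\<lambda>x. f [x]" using assms by (simp add: cochain1_lin)
  show ?thesis unfolding cocycle2_iff
  proof (intro conjI ballI hoch_d1_cochain assms)
    fix a b c assume [simp]: "a \<in> carrier C" "b \<in> carrier C" "c \<in> carrier C"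
    note [simp] = f.closed
    show "hoch_d C B 2 (hoch_d C B 1 f) [a, b, c] = \<zero>\<^bsub>B\<^esub>"
      using assms
      by (simp add: hoch_d2 hoch_d1 hoch_d1_cochain act_expand lact_mult ract_mult lact_ract C.m_assoc
          B.M.diff_simps del: One_nat_def)
  qed
qed

end

section \<open>The group of 2-cocycles and equality of classes in degree three\<close>

context hochschild
begin

lemma mem_tuples_1: "[x] \<in> tuples C 1 \<longleftrightarrow> x \<in> carrier C"
  by simp

lemma cochain2_closed: "\<lbrakk>g \<in> hoch_cochains K C B 2; cs \<in> tuples C 2\<rbrakk> \<Longrightarrow> g cs \<in> carrier B"
  by (auto simp: hoch_cochains_def PiE_def)

lemma cocycle2_cochain: "g \<in> hoch_cocycles K C B 2 \<Longrightarrow> g \<in> hoch_cochains K C B 2"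
  by (simp add: cocycle2_iff)

lemma comm_group_cocycles: "comm_group (hoch_cocycle_group K C B 2)"
proof -
  let ?Z = "hoch_cocycle_group K C B 2"
  note closed = cochain2_closed[OF cocycle2_cochain]
  show ?thesis
  proof (rule comm_groupI)
    fix g h assume gh: "g \<in> carrier (?Z)" "h \<in> carrier (?Z)"
    then show "g \<otimes>\<^bsub>?Z\<^esub> h \<in> carrier (?Z)"
      by (simp add: hoch_cocycle_group_def cocycle2_iff cochain2_add hoch_d2_add)
    show "g \<otimes>\<^bsub>?Z\<^esub> h = h \<otimes>\<^bsub>?Z\<^esub> g"
      using gh closed by (auto simp: hoch_cocycle_group_def B.M.a_ac intro!: restrict_ext)
    fix l assume "l \<in> carrier (?Z)"
    then show "g \<otimes>\<^bsub>?Z\<^esub> h \<otimes>\<^bsub>?Z\<^esub> l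
        = g \<otimes>\<^bsub>?Z\<^esub> (h \<otimes>\<^bsub>?Z\<^esub> l)"
      using gh closed by (auto simp: hoch_cocycle_group_def B.M.a_ac intro!: restrict_ext)
  next
    show "\<one>\<^bsub>?Z\<^esub> \<in> carrier (?Z)"
      by (simp add: hoch_cocycle_group_def cocycle2_iff cochain2_zero hoch_d2_zero)
  next
    fix g assume "g \<in> carrier (?Z)"
    then have g: "g \<in> hoch_cocycles K C B 2" by (simp add: hoch_cocycle_group_def)
    then have "(\<lambda>cs\<in>tuples C 2. \<zero>\<^bsub>B\<^esub> \<oplus>\<^bsub>B\<^esub> g cs) = g"
      by (intro extensionalityI[of _ "tuples C 2"]) (simp_all add: closed cocycle2_iff cochain2_iff)
    then show "\<one>\<^bsub>?Z\<^esub> \<otimes>\<^bsub>?Z\<^esub> g = g"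
      by (simp add: hoch_cocycle_group_def cong: restrict_cong)
    have "(\<lambda>cs\<in>tuples C 2. \<ominus>\<^bsub>B\<^esub> g cs) \<in> hoch_cocycles K C B 2"
      using g by (simp add: cocycle2_iff cochain2_neg hoch_d2_neg)
    moreover have "(\<lambda>cs\<in>tuples C 2. \<ominus>\<^bsub>B\<^esub> g cs \<oplus>\<^bsub>B\<^esub> g cs) = (\<lambda>cs\<in>tuples C 2. \<zero>\<^bsub>B\<^esub>)"
      using closed[OF g] by (auto simp: B.M.l_neg intro!: restrict_ext)
    ultimately show "\<exists>h\<in>carrier (?Z).
        h \<otimes>\<^bsub>?Z\<^esub> g = \<one>\<^bsub>?Z\<^esub>"
      by (intro bexI[of _ "\<lambda>cs\<in>tuples C 2. \<ominus>\<^bsub>B\<^esub> g cs"])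
        (simp_all add: hoch_cocycle_group_def cong: restrict_cong)
  qed
qed

lemma hoch_d1_add:
  assumes "f \<in> hoch_cochains K C B 1" "f' \<in> hoch_cochains K C B 1"
  shows "(\<lambda>cs\<in>tuples C 2. hoch_d C B 1 f cs \<oplus>\<^bsub>B\<^esub> hoch_d C B 1 f' cs) \<in> hoch_coboundaries K C B 2"
proof -
  interpret f: lin_map K C B "\<lambda>x. f [x]" using assms by (simp only: cochain1_lin)
  interpret f': lin_map K C B "\<lambda>x. f' [x]" using assms by (simp only: cochain1_lin)
  have "(\<lambda>x. f [x] \<oplus>\<^bsub>B\<^esub> f' [x]) \<in> linear_maps K C B"
    by (rule linear_mapsI) (simp_all add: B.smult_r_distr B.M.a_ac f.closed f'.closed)
  note c = cochain1I[OF this]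
  let ?f = "\<lambda>cs\<in>tuples C 1. f [hd cs] \<oplus>\<^bsub>B\<^esub> f' [hd cs]"
  have "hoch_d C B 1 ?f = (\<lambda>cs\<in>tuples C 2. hoch_d C B 1 f cs \<oplus>\<^bsub>B\<^esub> hoch_d C B 1 f' cs)"
  proof (rule cochain2_eqI)
    fix x y assume [simp]: "x \<in> carrier C" "y \<in> carrier C"
    show "hoch_d C B 1 ?f [x, y] = (\<lambda>cs\<in>tuples C 2. hoch_d C B 1 f cs \<oplus>\<^bsub>B\<^esub> hoch_d C B 1 f' cs) [x, y]"
      using hoch_d1[OF c, of x y] hoch_d1[OF assms(1), of x y] hoch_d1[OF assms(2), of x y]
        f.closed f'.closed
      by (simp add: mem_tuples_1 act_expand B.M.diff_simps del: One_nat_def)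
  qed (intro hoch_d1_cochain c cochain2_add assms)+
  then show ?thesis unfolding coboundary2_iff by (intro bexI[OF _ c]) (rule sym)
qed

lemma hoch_d1_neg:
  assumes "f \<in> hoch_cochains K C B 1"
  shows "(\<lambda>cs\<in>tuples C 2. \<ominus>\<^bsub>B\<^esub> hoch_d C B 1 f cs) \<in> hoch_coboundaries K C B 2"
proof -
  interpret f: lin_map K C B "\<lambda>x. f [x]" using assms by (simp only: cochain1_lin)
  have "(\<lambda>x. \<ominus>\<^bsub>B\<^esub> f [x]) \<in> linear_maps K C B"
    by (rule linear_mapsI) (simp_all add: B.smult_r_minus B.M.minus_add B.M.a_ac f.closed)
  note c = cochain1I[OF this]
  let ?f = "\<lambda>cs\<in>tuples C 1. \<ominus>\<^bsub>B\<^esub> f [hd cs]"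
  have "hoch_d C B 1 ?f = (\<lambda>cs\<in>tuples C 2. \<ominus>\<^bsub>B\<^esub> hoch_d C B 1 f cs)"
  proof (rule cochain2_eqI)
    fix x y assume [simp]: "x \<in> carrier C" "y \<in> carrier C"
    show "hoch_d C B 1 ?f [x, y] = (\<lambda>cs\<in>tuples C 2. \<ominus>\<^bsub>B\<^esub> hoch_d C B 1 f cs) [x, y]"
      using hoch_d1[OF c, of x y] hoch_d1[OF assms(1), of x y] f.closed
      by (simp add: mem_tuples_1 act_expand B.M.diff_simps del: One_nat_def)
  qed (intro hoch_d1_cochain c cochain2_neg assms)+
  then show ?thesis unfolding coboundary2_iff by (intro bexI[OF _ c]) (rule sym)
qed

lemma normal_coboundaries: "hoch_coboundaries K C B 2 \<lhd> hoch_cocycle_group K C B 2"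
proof -
  let ?Z = "hoch_cocycle_group K C B 2"
  interpret Z: comm_group ?Z by (rule comm_group_cocycles)
  have sub: "hoch_coboundaries K C B 2 \<subseteq> carrier (?Z)"
    unfolding hoch_cocycle_group_def by (auto simp: coboundary2_iff hoch_d1_cocycle simp del: One_nat_def)
  have "(\<lambda>x. \<zero>\<^bsub>B\<^esub>) \<in> linear_maps K C B" by (rule linear_mapsI) simp_all
  then have ne: "hoch_d C B 1 (\<lambda>cs\<in>tuples C 1. \<zero>\<^bsub>B\<^esub>) \<in> hoch_coboundaries K C B 2"
    unfolding coboundary2_iff using cochain1I by blast
  have "subgroup (hoch_coboundaries K C B 2) (?Z)"
  proof (rule Z.subgroupI)
    show "hoch_coboundaries K C B 2 \<noteq> {}" using ne by blast
    fix g assume g: "g \<in> hoch_coboundaries K C B 2"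
    then obtain f where f: "f \<in> hoch_cochains K C B 1" "g = hoch_d C B 1 f" unfolding coboundary2_iff by blast
    have h: "(\<lambda>cs\<in>tuples C 2. \<ominus>\<^bsub>B\<^esub> g cs) \<in> hoch_coboundaries K C B 2"
      using hoch_d1_neg[OF f(1)] unfolding f(2) .
    have "g \<in> hoch_cocycles K C B 2" using g sub by (auto simp: hoch_cocycle_group_def)
    then have "(\<lambda>cs\<in>tuples C 2. \<ominus>\<^bsub>B\<^esub> g cs) \<otimes>\<^bsub>?Z\<^esub> g = \<one>\<^bsub>?Z\<^esub>"
      unfolding hoch_cocycle_group_def
      by (auto intro!: restrict_ext simp: B.M.l_neg cochain2_closed[OF cocycle2_cochain])
    then have "inv\<^bsub>?Z\<^esub> g = (\<lambda>cs\<in>tuples C 2. \<ominus>\<^bsub>B\<^esub> g cs)"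
      using g h sub by (intro Z.inv_equality) auto
    with h show "inv\<^bsub>?Z\<^esub> g \<in> hoch_coboundaries K C B 2" by simp
    fix g' assume "g' \<in> hoch_coboundaries K C B 2"
    then obtain f' where f': "f' \<in> hoch_cochains K C B 1" "g' = hoch_d C B 1 f'" unfolding coboundary2_iff by blast
    show "g \<otimes>\<^bsub>?Z\<^esub> g' \<in> hoch_coboundaries K C B 2"
      using hoch_d1_add[OF f(1) f'(1)] unfolding hoch_cocycle_group_def f(2) f'(2) monoid.simps .
  qed (rule sub)
  then show ?thesis by (rule Z.subgroup_imp_normal)
qed

text \<open>\<open>hoch_class\<close> is a translate of the coboundaries under pointwise addition,
  which makes sense for any \<open>B\<close>-valued function on triples. Equality of two translates
  therefore only rests on the additivity of \<open>hoch_d\<close> on 2-cochains.\<close>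

lemma hoch_class3_eq_iff:
  assumes u: "u \<in> tuples C 3 \<rightarrow>\<^sub>E carrier B" and v: "v \<in> tuples C 3 \<rightarrow>\<^sub>E carrier B"
  shows "hoch_class K C B 3 u = hoch_class K C B 3 v \<longleftrightarrow>
    (\<exists>g\<in>hoch_cochains K C B 2. \<forall>a\<in>carrier C. \<forall>b\<in>carrier C. \<forall>c\<in>carrier C.
      u [a, b, c] = hoch_d C B 2 g [a, b, c] \<oplus>\<^bsub>B\<^esub> v [a, b, c])"
proof -
  define shift where "shift g u = (\<lambda>cs\<in>tuples C 3. hoch_d C B 2 g cs \<oplus>\<^bsub>B\<^esub> u cs)" for g u
  have cls: "hoch_class K C B 3 w = (\<lambda>g. shift g w) ` hoch_cochains K C B 2" for w
    by (auto simp: hoch_class_def r_coset_def hoch_cocycle_group_def hoch_coboundaries_def shift_def)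
  have d_closed: "hoch_d C B 2 g cs \<in> carrier B" if "g \<in> hoch_cochains K C B 2" "cs \<in> tuples C 3" for g cs
    using that hoch_d2_closed unfolding tuples_3 by blast
  have w_closed: "w cs \<in> carrier B" if "w \<in> tuples C 3 \<rightarrow>\<^sub>E carrier B" "cs \<in> tuples C 3" for w cs
    using that by (auto simp: PiE_def)
  have shift_zero: "shift (\<lambda>cs\<in>tuples C 2. \<zero>\<^bsub>B\<^esub>) u = u"
  proof (rule extensionalityI[of _ "tuples C 3"])
    fix cs assume cs: "cs \<in> tuples C 3"
    then have "hoch_d C B 2 (\<lambda>cs\<in>tuples C 2. \<zero>\<^bsub>B\<^esub>) cs = \<zero>\<^bsub>B\<^esub>"
      using hoch_d2_zero unfolding tuples_3 by blast
    then show "shift (\<lambda>cs\<in>tuples C 2. \<zero>\<^bsub>B\<^esub>) u cs = u cs" using cs w_closed[OF u] by (simp add: shift_def)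
  qed (use u in \<open>auto simp: shift_def PiE_def\<close>)
  have shift_add: "shift g (shift h w) = shift (\<lambda>cs\<in>tuples C 2. g cs \<oplus>\<^bsub>B\<^esub> h cs) w"
    if "g \<in> hoch_cochains K C B 2" "h \<in> hoch_cochains K C B 2" "w \<in> tuples C 3 \<rightarrow>\<^sub>E carrier B" for g h w
    unfolding shift_def
  proof (rule restrict_ext)
    fix cs assume cs: "cs \<in> tuples C 3"
    then have "hoch_d C B 2 (\<lambda>cs\<in>tuples C 2. g cs \<oplus>\<^bsub>B\<^esub> h cs) cs = hoch_d C B 2 g cs \<oplus>\<^bsub>B\<^esub> hoch_d C B 2 h cs"
      using hoch_d2_add[OF that(1,2)] unfolding tuples_3 by blast
    then show "hoch_d C B 2 g cs \<oplus>\<^bsub>B\<^esub> (\<lambda>cs\<in>tuples C 3. hoch_d C B 2 h cs \<oplus>\<^bsub>B\<^esub> w cs) cs =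
        hoch_d C B 2 (\<lambda>cs\<in>tuples C 2. g cs \<oplus>\<^bsub>B\<^esub> h cs) cs \<oplus>\<^bsub>B\<^esub> w cs"
      using cs d_closed that w_closed[OF that(3)] by (simp add: B.M.a_assoc)
  qed
  have "u = shift g v" if "\<forall>a\<in>carrier C. \<forall>b\<in>carrier C. \<forall>c\<in>carrier C.
      u [a, b, c] = hoch_d C B 2 g [a, b, c] \<oplus>\<^bsub>B\<^esub> v [a, b, c]" for g
  proof (rule extensionalityI[of _ "tuples C 3"])
    fix cs assume cs: "cs \<in> tuples C 3"
    then show "u cs = shift g v cs" using that unfolding shift_def tuples_3 by auto
  qed (use u in \<open>auto simp: shift_def PiE_def\<close>)
  moreover have "u [a, b, c] = hoch_d C B 2 g [a, b, c] \<oplus>\<^bsub>B\<^esub> v [a, b, c]"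
    if "u = shift g v" "a \<in> carrier C" "b \<in> carrier C" "c \<in> carrier C" for g a b c
    unfolding that(1) shift_def using that(2-) by simp
  ultimately have iff: "(\<forall>a\<in>carrier C. \<forall>b\<in>carrier C. \<forall>c\<in>carrier C.
      u [a, b, c] = hoch_d C B 2 g [a, b, c] \<oplus>\<^bsub>B\<^esub> v [a, b, c]) \<longleftrightarrow> u = shift g v" for g
    by blast
  have "hoch_class K C B 3 u = hoch_class K C B 3 v" if g: "g \<in> hoch_cochains K C B 2" "u = shift g v" for g
  proof -
    \<comment> \<open>For the reverse inclusion the translate by \<open>h\<close> of
      \<open>v\<close> is the translate by \<open>h - g\<close> of \<open>u\<close>.\<close>
    let ?n = "\<lambda>cs\<in>tuples C 2. \<ominus>\<^bsub>B\<^esub> g cs"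
    have n: "?n \<in> hoch_cochains K C B 2" using g(1) by (rule cochain2_neg)
    have "shift h u \<in> (\<lambda>g. shift g v) ` hoch_cochains K C B 2" if "h \<in> hoch_cochains K C B 2" for h
      using shift_add[OF that g(1) v] cochain2_add[OF that g(1)] g(2) by blast
    moreover have "shift h v \<in> (\<lambda>g. shift g u) ` hoch_cochains K C B 2" if h: "h \<in> hoch_cochains K C B 2" for h
    proof -
      have "shift (\<lambda>cs\<in>tuples C 2. h cs \<oplus>\<^bsub>B\<^esub> ?n cs) u = shift (\<lambda>cs\<in>tuples C 2. (\<lambda>cs\<in>tuples C 2. h cs \<oplus>\<^bsub>B\<^esub> ?n cs) cs \<oplus>\<^bsub>B\<^esub> g cs) v"
        unfolding g(2) by (rule shift_add[OF cochain2_add[OF h n] g(1) v])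
      also have "(\<lambda>cs\<in>tuples C 2. (\<lambda>cs\<in>tuples C 2. h cs \<oplus>\<^bsub>B\<^esub> ?n cs) cs \<oplus>\<^bsub>B\<^esub> g cs) = h"
        by (rule cochain2_eqI[OF cochain2_add[OF cochain2_add[OF h n] g(1)] h])
          (simp add: cochain2_closed[OF h] cochain2_closed[OF g(1)] B.M.a_assoc B.M.l_neg)
      finally have eq: "shift (\<lambda>cs\<in>tuples C 2. h cs \<oplus>\<^bsub>B\<^esub> ?n cs) u = shift h v" .
      show ?thesis unfolding eq[symmetric] by (rule imageI[OF cochain2_add[OF h n]])
    qed
    ultimately show ?thesis unfolding cls by blast
  qed
  moreover have "\<exists>g\<in>hoch_cochains K C B 2. u = shift g v" if "hoch_class K C B 3 u = hoch_class K C B 3 v"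
  proof -
    have "u \<in> hoch_class K C B 3 u" unfolding cls by (rule image_eqI[where x = "\<lambda>cs\<in>tuples C 2. \<zero>\<^bsub>B\<^esub>"]) (simp_all only: shift_zero cochain2_zero)
    then show ?thesis unfolding that unfolding cls by blast
  qed
  ultimately show ?thesis unfolding iff by blast
qed

end

section \<open>The bimodule of a crossed biextension\<close>

lemma with_actions_simps [simp]:
  "carrier (with_actions V l r) = carrier V"
  "x \<oplus>\<^bsub>with_actions V l r\<^esub> y = x \<oplus>\<^bsub>V\<^esub> y"
  "\<zero>\<^bsub>with_actions V l r\<^esub> = \<zero>\<^bsub>V\<^esub>"
  "k \<odot>\<^bsub>with_actions V l r\<^esub> x = k \<odot>\<^bsub>V\<^esub> x"
  "lact (with_actions V l r) = l"
  "ract (with_actions V l r) = r"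
  by (simp_all add: with_actions_def)

lemma a_inv_with_actions [simp]: "\<ominus>\<^bsub>with_actions V l r\<^esub> x = \<ominus>\<^bsub>V\<^esub> x"
  by (simp add: with_actions_def a_inv_def m_inv_def)

lemma a_minus_with_actions [simp]: "x \<ominus>\<^bsub>with_actions V l r\<^esub> y = x \<ominus>\<^bsub>V\<^esub> y"
  by (simp add: a_minus_def)

lemma module_with_actions:
  assumes "module K V"
  shows "module K (with_actions V l r)"
proof -
  interpret V: module K V by fact
  have "abelian_group (with_actions V l r)"
  proof (rule abelian_groupI)
    fix x assume "x \<in> carrier (with_actions V l r)"
    then show "\<exists>y\<in>carrier (with_actions V l r). y \<oplus>\<^bsub>with_actions V l r\<^esub> x = \<zero>\<^bsub>with_actions V l r\<^esub>"
      by (intro bexI[of _ "\<ominus>\<^bsub>V\<^esub> x"]) (simp_all add: V.M.l_neg)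
  qed (simp_all add: V.M.a_ac)
  then show ?thesis
    by (intro moduleI V.R.is_cring) (simp_all add: V.smult_l_distr V.smult_r_distr V.smult_assoc1)
qed

lemma bimodule_pullback:
  assumes B: "bimodule K C' B" and C: "assoc_algebra K C" and h: "h \<in> algebra_homs K C C'"
  shows "bimodule K C (pullback_bimodule h B)"
proof -
  interpret B: bimodule K C' B by fact
  interpret C: assoc_algebra K C by fact
  interpret P: module K "pullback_bimodule h B"
    unfolding pullback_bimodule_def by (rule module_with_actions) unfold_locales
  have [simp]: "h x \<in> carrier C'" if "x \<in> carrier C" for x
    using h that by (auto simp: algebra_homs_def linear_maps_def)
  have [simp]: "h (x \<oplus>\<^bsub>C\<^esub> y) = h x \<oplus>\<^bsub>C'\<^esub> h y" "h (x \<otimes>\<^bsub>C\<^esub> y) = h x \<otimes>\<^bsub>C'\<^esub> h y"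
    if "x \<in> carrier C" "y \<in> carrier C" for x y
    using h that by (auto simp: algebra_homs_def linear_maps_def ring_hom_def)
  have [simp]: "h (k \<odot>\<^bsub>C\<^esub> x) = k \<odot>\<^bsub>C'\<^esub> h x" if "k \<in> carrier K" "x \<in> carrier C" for k x
    using h that by (auto simp: algebra_homs_def linear_maps_def)
  have [simp]: "h \<one>\<^bsub>C\<^esub> = \<one>\<^bsub>C'\<^esub>" using h by (auto simp: algebra_homs_def ring_hom_def)
  show ?thesis
    by unfold_locales (simp_all add: pullback_bimodule_def B.act_expand B.lact_one B.ract_one
        B.lact_mult B.ract_mult B.lact_ract)
qed

context biext
begin

lemma lact_bx_closed [simp]: "\<lbrakk>c \<in> carrier C; b \<in> carrier B\<rbrakk> \<Longrightarrow> lact (bx_bimodule X) c b \<in> carrier B"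
  and j_lact_bx: "\<lbrakk>c \<in> carrier C; b \<in> carrier B\<rbrakk> \<Longrightarrow> j (lact (bx_bimodule X) c b) = lact A2 (s c) (j b)"
  using lact_bx[of "s c" b] by simp_all

lemma ract_bx_closed [simp]: "\<lbrakk>c \<in> carrier C; b \<in> carrier B\<rbrakk> \<Longrightarrow> ract (bx_bimodule X) b c \<in> carrier B"
  and j_ract_bx: "\<lbrakk>c \<in> carrier C; b \<in> carrier B\<rbrakk> \<Longrightarrow> j (ract (bx_bimodule X) b c) = ract A2 (j b) (s c)"
  using ract_bx[of "s c" b] by simp_all

lemma bx_bimodule_simps [simp]:
  "carrier (bx_bimodule X) = carrier B"
  "x \<oplus>\<^bsub>bx_bimodule X\<^esub> y = x \<oplus>\<^bsub>B\<^esub> y"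
  "\<zero>\<^bsub>bx_bimodule X\<^esub> = \<zero>\<^bsub>B\<^esub>"
  "k \<odot>\<^bsub>bx_bimodule X\<^esub> x = k \<odot>\<^bsub>B\<^esub> x"
  "\<ominus>\<^bsub>bx_bimodule X\<^esub> x = \<ominus>\<^bsub>B\<^esub> x"
  "x \<ominus>\<^bsub>bx_bimodule X\<^esub> y = x \<ominus>\<^bsub>B\<^esub> y"
  by (simp_all add: bx_bimodule_def)

text \<open>The axioms are tested after applying the injective \<open>j\<close>. Although
  \<open>s\<close> is not multiplicative, \<open>s 1\<close> and \<open>1\<close>, as well as
  \<open>s (c c')\<close> and \<open>s c s c'\<close>, have equal images under \<open>p\<close> and
  hence act alike on \<open>j B\<close>.\<close>

lemma bimodule_bx: "bimodule K C (bx_bimodule X)"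
proof -
  interpret M: module K "bx_bimodule X"
    unfolding bx_bimodule_def by (rule module_with_actions) unfold_locales
  have [simp]: "lact A2 (s \<one>\<^bsub>C\<^esub>) (j b) = j b" "ract A2 (j b) (s \<one>\<^bsub>C\<^esub>) = j b" if "b \<in> carrier B" for b
    using lact_j_cong[of "s \<one>\<^bsub>C\<^esub>" "\<one>\<^bsub>A1\<^esub>" b] ract_j_cong[of "s \<one>\<^bsub>C\<^esub>" "\<one>\<^bsub>A1\<^esub>" b] that
    by (simp_all add: A2.lact_one A2.ract_one)
  have [simp]: "lact A2 (s (c \<otimes>\<^bsub>C\<^esub> c')) (j b) = lact A2 (s c) (lact A2 (s c') (j b))"
    "ract A2 (j b) (s (c \<otimes>\<^bsub>C\<^esub> c')) = ract A2 (ract A2 (j b) (s c)) (s c')"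
    if "c \<in> carrier C" "c' \<in> carrier C" "b \<in> carrier B" for b c c'
    using lact_j_cong[of "s (c \<otimes>\<^bsub>C\<^esub> c')" "s c \<otimes>\<^bsub>A1\<^esub> s c'" b] ract_j_cong[of "s (c \<otimes>\<^bsub>C\<^esub> c')" "s c \<otimes>\<^bsub>A1\<^esub> s c'" b] that
    by (simp_all add: A2.lact_mult A2.ract_mult)
  show ?thesis
    by unfold_locales (simp_all add: j_eq_iff j_lact_bx j_ract_bx A2.act_expand A2.lact_ract)
qed

end

section \<open>Butterflies over a morphism of bimodules\<close>

locale biext_morphism = biext_pair K X s r X' s' r'
  for K :: "('k, 'r) ring_scheme" (structure)
    and X :: "('k, 'b, 'a2, 'a1, 'c) biext" and s :: "'c \<Rightarrow> 'a1" and r :: "'a1 \<Rightarrow> 'a2"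
    and X' :: "('k, 'y, 'x2, 'x1, 'd) biext" and s' :: "'d \<Rightarrow> 'x1" and r' :: "'x1 \<Rightarrow> 'x2" +
  fixes \<phi>\<^sub>0 :: "'c \<Rightarrow> 'd" and \<phi> :: "'b \<Rightarrow> 'y" and \<epsilon> :: "'c list \<Rightarrow> 'b" and \<epsilon>' :: "'d list \<Rightarrow> 'y"
  assumes morphism: "bimodule_morphism K C (bx_bimodule X) C' (bx_bimodule X') \<phi>\<^sub>0 \<phi>"
    and \<epsilon>: "\<epsilon> \<in> tuples C 3 \<rightarrow>\<^sub>E carrier B"
    and j_\<epsilon>: "\<lbrakk>a \<in> carrier C; b \<in> carrier C; c \<in> carrier C\<rbrakk> \<Longrightarrow> j (\<epsilon> [a, b, c]) = X.obstruction a b c"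
    and \<epsilon>': "\<epsilon>' \<in> tuples C' 3 \<rightarrow>\<^sub>E carrier B'"
    and j_\<epsilon>': "\<lbrakk>a' \<in> carrier C'; b' \<in> carrier C'; c' \<in> carrier C'\<rbrakk> \<Longrightarrow> j' (\<epsilon>' [a', b', c']) = Y.obstruction a' b' c'"
begin

abbreviation "P \<equiv> pullback_bimodule \<phi>\<^sub>0 (bx_bimodule X')"

lemma \<phi>\<^sub>0_hom: "\<phi>\<^sub>0 \<in> algebra_homs K C C'"
  using morphism by (simp add: bimodule_morphism_def)

sublocale \<phi>\<^sub>0: lin_map K C C' \<phi>\<^sub>0
proof unfold_locales
  show "\<phi>\<^sub>0 \<in> linear_maps K C C'"
    using \<phi>\<^sub>0_hom unfolding algebra_homs_def by (rule IntD2)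
qed

sublocale \<phi>: lin_map K B B' \<phi>
proof unfold_locales
  have "\<phi> \<in> linear_maps K (bx_bimodule X) (bx_bimodule X')"
    using morphism unfolding bimodule_morphism_def by blast
  then show "\<phi> \<in> linear_maps K B B'" by (simp add: linear_maps_def)
qed

lemma hochschild_P: "hochschild K C P"
  by (rule hochschild.intro[OF bimodule_pullback[OF Y.bimodule_bx X.C.assoc_algebra_axioms \<phi>\<^sub>0_hom]])

sublocale P: hochschild K C P by (rule hochschild_P)

lemma \<phi>\<^sub>0_mult [simp]: "\<lbrakk>a \<in> carrier C; b \<in> carrier C\<rbrakk> \<Longrightarrow> \<phi>\<^sub>0 (a \<otimes>\<^bsub>C\<^esub> b) = \<phi>\<^sub>0 a \<otimes>\<^bsub>C'\<^esub> \<phi>\<^sub>0 b"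
  and \<phi>\<^sub>0_one [simp]: "\<phi>\<^sub>0 \<one>\<^bsub>C\<^esub> = \<one>\<^bsub>C'\<^esub>"
  using \<phi>\<^sub>0_hom by (auto simp: algebra_homs_def ring_hom_def)

lemma P_simps [simp]:
  "carrier P = carrier B'"
  "x \<oplus>\<^bsub>P\<^esub> y = x \<oplus>\<^bsub>B'\<^esub> y"
  "\<zero>\<^bsub>P\<^esub> = \<zero>\<^bsub>B'\<^esub>"
  "k \<odot>\<^bsub>P\<^esub> x = k \<odot>\<^bsub>B'\<^esub> x"
  "\<ominus>\<^bsub>P\<^esub> x = \<ominus>\<^bsub>B'\<^esub> x"
  "x \<ominus>\<^bsub>P\<^esub> y = x \<ominus>\<^bsub>B'\<^esub> y"
  "lact P c x = lact (bx_bimodule X') (\<phi>\<^sub>0 c) x"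
  "ract P x c = ract (bx_bimodule X') x (\<phi>\<^sub>0 c)"
  by (simp_all add: pullback_bimodule_def)

lemma linear_maps_P: "linear_maps K V P = linear_maps K V B'"
  by (simp add: linear_maps_def)

lemma bilinear_maps_P: "bilinear_maps K V W P = bilinear_maps K V W B'"
  by (simp add: bilinear_maps_def linear_maps_P)

lemma cochain2_bilin: "h \<in> hoch_cochains K C P 2 \<Longrightarrow> bilin_map K C C B' (\<lambda>x y. h [x, y])"
  using P.cochain2_iff bilinear_maps_P by unfold_locales blast

text \<open>The map \<open>j' \<phi> j^{-1}\<close>, meaningful on the kernel of \<open>d\<close>
  only. In a butterfly over \<open>(\<phi>\<^sub>0, \<phi>)\<close> one has
  \<open>\<kappa> = - \<iota> \<psi>\<close> there, which is how elements of \<open>A2\<close> get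
  into \<open>A2'\<close>.\<close>

definition \<psi> :: "'a2 \<Rightarrow> 'x2" where "\<psi> x = j' (\<phi> (X.jinv x))"

definition S :: "'a1 \<Rightarrow> 'x1" where "S a = s' (\<phi>\<^sub>0 (p a))"

text \<open>If \<open>\<iota> j' h\<close> is the defect of \<sigma>, then \<iota> of this element
  is \<open>t a t b - t (a b)\<close>; the last term is \<open>\<kappa> (w a b)\<close> rewritten
  through \<psi>, whence the sign.\<close>

definition m :: "('c list \<Rightarrow> 'y) \<Rightarrow> 'a1 \<Rightarrow> 'a1 \<Rightarrow> 'x2" where
  "m h a b = Y.f (\<phi>\<^sub>0 (p a)) (\<phi>\<^sub>0 (p b)) \<oplus>\<^bsub>A2'\<^esub> j' (h [p a, p b]) \<ominus>\<^bsub>A2'\<^esub> \<psi> (X.w a b)"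

text \<open>As \<open>p (d x) = 0\<close>, \<open>\<kappa> x - t (d x)\<close> equals
  \<open>\<kappa> (x - r (d x))\<close>, whose argument is in the kernel of
  \<open>d\<close>.\<close>

definition k :: "'a2 \<Rightarrow> 'x2" where "k x = \<ominus>\<^bsub>A2'\<^esub> \<psi> (x \<ominus>\<^bsub>A2\<^esub> r (d x))"

lemma jinv_j [simp]: "b \<in> carrier B \<Longrightarrow> X.jinv (j b) = b"
  by (rule X.j_eqD) simp_all

lemma \<psi>_j: "b \<in> carrier B \<Longrightarrow> \<psi> (j b) = j' (\<phi> b)"
  by (simp add: \<psi>_def)

lemma \<psi>_closed [simp]: "\<lbrakk>x \<in> carrier A2; d x = \<zero>\<^bsub>A1\<^esub>\<rbrakk> \<Longrightarrow> \<psi> x \<in> carrier A2'"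
  and d_\<psi> [simp]: "\<lbrakk>x \<in> carrier A2; d x = \<zero>\<^bsub>A1\<^esub>\<rbrakk> \<Longrightarrow> d' (\<psi> x) = \<zero>\<^bsub>A1'\<^esub>"
  by (simp_all add: \<psi>_def)

lemma kernel_cases:
  assumes "x \<in> carrier A2" "d x = \<zero>\<^bsub>A1\<^esub>"
  obtains b where "b \<in> carrier B" "x = j b"
  using assms X.j_exact by blast

lemma \<psi>_add: "\<lbrakk>x \<in> carrier A2; d x = \<zero>\<^bsub>A1\<^esub>; y \<in> carrier A2; d y = \<zero>\<^bsub>A1\<^esub>\<rbrakk> \<Longrightarrow>
    \<psi> (x \<oplus>\<^bsub>A2\<^esub> y) = \<psi> x \<oplus>\<^bsub>A2'\<^esub> \<psi> y"
proof (elim kernel_cases)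
  fix b b' assume b: "b \<in> carrier B" "x = j b" "b' \<in> carrier B" "y = j b'"
  then have "\<psi> (x \<oplus>\<^bsub>A2\<^esub> y) = \<psi> (j (b \<oplus>\<^bsub>B\<^esub> b'))" by simp
  then show ?thesis using b by (simp add: \<psi>_j del: X.j.add)
qed

lemma \<psi>_diff: "\<lbrakk>x \<in> carrier A2; d x = \<zero>\<^bsub>A1\<^esub>; y \<in> carrier A2; d y = \<zero>\<^bsub>A1\<^esub>\<rbrakk> \<Longrightarrow>
    \<psi> (x \<ominus>\<^bsub>A2\<^esub> y) = \<psi> x \<ominus>\<^bsub>A2'\<^esub> \<psi> y"
proof (elim kernel_cases)
  fix b b' assume b: "b \<in> carrier B" "x = j b" "b' \<in> carrier B" "y = j b'"
  then have "\<psi> (x \<ominus>\<^bsub>A2\<^esub> y) = \<psi> (j (b \<ominus>\<^bsub>B\<^esub> b'))" by simp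
  then show ?thesis using b by (simp add: \<psi>_j del: X.j.diff)
qed

lemma \<psi>_smult: "\<lbrakk>t \<in> carrier K; x \<in> carrier A2; d x = \<zero>\<^bsub>A1\<^esub>\<rbrakk> \<Longrightarrow> \<psi> (t \<odot>\<^bsub>A2\<^esub> x) = t \<odot>\<^bsub>A2'\<^esub> \<psi> x"
proof (elim kernel_cases)
  fix b assume t: "t \<in> carrier K" and b: "b \<in> carrier B" "x = j b"
  then have "\<psi> (t \<odot>\<^bsub>A2\<^esub> x) = \<psi> (j (t \<odot>\<^bsub>B\<^esub> b))" by simp
  then show ?thesis using t b by (simp add: \<psi>_j del: X.j.smult)
qed

lemma \<psi>_lact:
  assumes "a \<in> carrier A1" "x \<in> carrier A2" "d x = \<zero>\<^bsub>A1\<^esub>"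
  shows "\<psi> (lact A2 a x) = lact A2' (S a) (\<psi> x)"
proof -
  obtain b where b: "b \<in> carrier B" "x = j b" using assms(2,3) by (rule kernel_cases)
  have "\<psi> (lact A2 a x) = j' (\<phi> (lact (bx_bimodule X) (p a) b))"
    using assms b by (simp add: \<psi>_def X.lact_bx)
  also have "\<dots> = j' (lact (bx_bimodule X') (\<phi>\<^sub>0 (p a)) (\<phi> b))"
    using morphism assms b by (simp add: bimodule_morphism_def)
  finally show ?thesis using assms b by (simp add: S_def Y.j_lact_bx \<psi>_j)
qed

lemma \<psi>_ract:
  assumes "a \<in> carrier A1" "x \<in> carrier A2" "d x = \<zero>\<^bsub>A1\<^esub>"
  shows "\<psi> (ract A2 x a) = ract A2' (\<psi> x) (S a)"
proof -
  obtain b where b: "b \<in> carrier B" "x = j b" using assms(2,3) by (rule kernel_cases)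
  have "\<psi> (ract A2 x a) = j' (\<phi> (ract (bx_bimodule X) b (p a)))"
    using assms b by (simp add: \<psi>_def X.ract_bx)
  also have "\<dots> = j' (ract (bx_bimodule X') (\<phi> b) (\<phi>\<^sub>0 (p a)))"
    using morphism assms b by (simp add: bimodule_morphism_def)
  finally show ?thesis using assms b by (simp add: S_def Y.j_ract_bx \<psi>_j)
qed

lemma S_lin: "lin_map K A1 A1' S"
  by unfold_locales (auto intro!: linear_mapsI simp: S_def)

sublocale S: lin_map K A1 A1' S by (rule S_lin)

lemma k_lin: "lin_map K A2 A2' k"
proof unfold_locales
  have "\<psi> (x \<oplus>\<^bsub>A2\<^esub> y \<ominus>\<^bsub>A2\<^esub> r (d (x \<oplus>\<^bsub>A2\<^esub> y))) = \<psi> (x \<ominus>\<^bsub>A2\<^esub> r (d x)) \<oplus>\<^bsub>A2'\<^esub> \<psi> (y \<ominus>\<^bsub>A2\<^esub> r (d y))"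
    if "x \<in> carrier A2" "y \<in> carrier A2" for x y
  proof -
    have "x \<oplus>\<^bsub>A2\<^esub> y \<ominus>\<^bsub>A2\<^esub> r (d (x \<oplus>\<^bsub>A2\<^esub> y)) = (x \<ominus>\<^bsub>A2\<^esub> r (d x)) \<oplus>\<^bsub>A2\<^esub> (y \<ominus>\<^bsub>A2\<^esub> r (d y))"
      using that by (simp add: X.A2.M.diff_simps)
    then show ?thesis using that by (simp add: \<psi>_add X.r_s_d del: X.r.add X.d.add)
  qed
  moreover have "\<psi> (t \<odot>\<^bsub>A2\<^esub> x \<ominus>\<^bsub>A2\<^esub> r (d (t \<odot>\<^bsub>A2\<^esub> x))) = t \<odot>\<^bsub>A2'\<^esub> \<psi> (x \<ominus>\<^bsub>A2\<^esub> r (d x))"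
    if "t \<in> carrier K" "x \<in> carrier A2" for t x
    using that by (simp add: X.r_s_d flip: \<psi>_smult X.A2.smult_diff)
  ultimately show "k \<in> linear_maps K A2 A2'"
    by (intro linear_mapsI) (simp_all add: k_def X.r_s_d Y.A2.M.minus_add Y.A2.M.a_ac Y.A2.smult_r_minus)
qed

sublocale k: lin_map K A2 A2' k by (rule k_lin)

lemma m_bilin:
  assumes "h \<in> hoch_cochains K C P 2"
  shows "bilin_map K A1 A1 A2' (m h)"
proof -
  interpret h: bilin_map K C C B' "\<lambda>x y. h [x, y]" using assms by (rule cochain2_bilin)
  note [simp] = h.closed
  have "m h \<in> bilinear_maps K A1 A1 A2'"
    by (rule bilinear_mapsI) (simp_all add: m_def h.expand Y.f.expand X.w.expand \<psi>_add \<psi>_smult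
        Y.A2.smult_r_distr Y.A2.smult_diff Y.A2.M.diff_simps)
  then show ?thesis by unfold_locales
qed

text \<open>This is \<open>w_coboundary\<close> carried over by \<psi>. The two unlike actions used
  there, through \<open>s p\<close> and directly, both turn into actions through \<open>S\<close>,
  because \<open>S a\<close> depends on \<open>p a\<close> only.\<close>

lemma \<psi>_coboundary:
  assumes "a \<in> carrier A1" "b \<in> carrier A1" "c \<in> carrier A1"
  shows "lact A2' (S a) (\<psi> (X.w b c)) \<ominus>\<^bsub>A2'\<^esub> \<psi> (X.w (a \<otimes>\<^bsub>A1\<^esub> b) c) \<oplus>\<^bsub>A2'\<^esub> \<psi> (X.w a (b \<otimes>\<^bsub>A1\<^esub> c))
      \<ominus>\<^bsub>A2'\<^esub> ract A2' (\<psi> (X.w a b)) (S c) = j' (\<phi> (\<epsilon> [p a, p b, p c]))"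
proof -
  have e: "\<epsilon> [p a, p b, p c] \<in> carrier B" using \<epsilon> assms by (auto simp: PiE_def)
  have "S (s (p a)) = S a" using assms by (simp add: S_def)
  then have "lact A2' (S a) (\<psi> (X.w b c)) = \<psi> (lact A2 (s (p a)) (X.w b c))"
    using assms by (simp add: \<psi>_lact)
  moreover have "ract A2' (\<psi> (X.w a b)) (S c) = \<psi> (ract A2 (X.w a b) c)"
    using assms by (simp add: \<psi>_ract)
  ultimately have "lact A2' (S a) (\<psi> (X.w b c)) \<ominus>\<^bsub>A2'\<^esub> \<psi> (X.w (a \<otimes>\<^bsub>A1\<^esub> b) c) \<oplus>\<^bsub>A2'\<^esub> \<psi> (X.w a (b \<otimes>\<^bsub>A1\<^esub> c))
      \<ominus>\<^bsub>A2'\<^esub> ract A2' (\<psi> (X.w a b)) (S c) = \<psi> (lact A2 (s (p a)) (X.w b c) \<ominus>\<^bsub>A2\<^esub> X.w (a \<otimes>\<^bsub>A1\<^esub> b) c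
      \<oplus>\<^bsub>A2\<^esub> X.w a (b \<otimes>\<^bsub>A1\<^esub> c) \<ominus>\<^bsub>A2\<^esub> ract A2 (X.w a b) c)"
    using assms by (simp add: \<psi>_add \<psi>_diff)
  also have "\<dots> = \<psi> (j (\<epsilon> [p a, p b, p c]))"
    using assms by (simp only: X.w_coboundary j_\<epsilon> X.p.closed)
  finally show ?thesis using e by (simp only: \<psi>_j)
qed

text \<open>The three summands of \<open>m\<close> are treated separately: the \<open>Y.f\<close>
  part yields \<epsilon>', the part with \<open>h\<close> yields its differential, and the \<psi>
  part yields \<epsilon>. As \<open>j'\<close> is injective, the cocycle identity for
  \<open>m h\<close> becomes a statement about cochains with values in \<open>B'\<close>.\<close>

lemma m_coboundary:
  assumes h: "h \<in> hoch_cochains K C P 2"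
    and abc: "a \<in> carrier A1" "b \<in> carrier A1" "c \<in> carrier A1"
  shows "lact A2' (S a) (m h b c) \<ominus>\<^bsub>A2'\<^esub> m h (a \<otimes>\<^bsub>A1\<^esub> b) c \<oplus>\<^bsub>A2'\<^esub> m h a (b \<otimes>\<^bsub>A1\<^esub> c) \<ominus>\<^bsub>A2'\<^esub> ract A2' (m h a b) (S c)
    = j' (hoch_d C P 2 h [p a, p b, p c] \<oplus>\<^bsub>B'\<^esub> \<epsilon>' [\<phi>\<^sub>0 (p a), \<phi>\<^sub>0 (p b), \<phi>\<^sub>0 (p c)]
        \<ominus>\<^bsub>B'\<^esub> \<phi> (\<epsilon> [p a, p b, p c]))"
proof -
  interpret h: bilin_map K C C B' "\<lambda>x y. h [x, y]" using h by (rule cochain2_bilin)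
  note [simp] = abc h.closed
  let ?F = "\<lambda>a b. Y.f (\<phi>\<^sub>0 (p a)) (\<phi>\<^sub>0 (p b))"
  let ?H = "\<lambda>a b. j' (h [p a, p b])"
  have 1: "j' (\<epsilon>' [\<phi>\<^sub>0 (p a), \<phi>\<^sub>0 (p b), \<phi>\<^sub>0 (p c)]) = lact A2' (S a) (?F b c) \<ominus>\<^bsub>A2'\<^esub> ?F (a \<otimes>\<^bsub>A1\<^esub> b) c
      \<oplus>\<^bsub>A2'\<^esub> ?F a (b \<otimes>\<^bsub>A1\<^esub> c) \<ominus>\<^bsub>A2'\<^esub> ract A2' (?F a b) (S c)"
    by (simp add: j_\<epsilon>' Y.obstruction_def S_def)
  have 2: "j' (hoch_d C P 2 h [p a, p b, p c]) = lact A2' (S a) (?H b c) \<ominus>\<^bsub>A2'\<^esub> ?H (a \<otimes>\<^bsub>A1\<^esub> b) c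
      \<oplus>\<^bsub>A2'\<^esub> ?H a (b \<otimes>\<^bsub>A1\<^esub> c) \<ominus>\<^bsub>A2'\<^esub> ract A2' (?H a b) (S c)"
    using h by (simp add: P.hoch_d2 Y.j_lact_bx Y.j_ract_bx S_def)
  have e: "\<epsilon> [p a, p b, p c] \<in> carrier B" "\<epsilon>' [\<phi>\<^sub>0 (p a), \<phi>\<^sub>0 (p b), \<phi>\<^sub>0 (p c)] \<in> carrier B'"
      "hoch_d C P 2 h [p a, p b, p c] \<in> carrier B'"
    using \<epsilon> \<epsilon>' P.hoch_d2_closed[OF h] by (auto simp: PiE_def)
  then have "j' (hoch_d C P 2 h [p a, p b, p c] \<oplus>\<^bsub>B'\<^esub> \<epsilon>' [\<phi>\<^sub>0 (p a), \<phi>\<^sub>0 (p b), \<phi>\<^sub>0 (p c)]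
        \<ominus>\<^bsub>B'\<^esub> \<phi> (\<epsilon> [p a, p b, p c])) =
      j' (hoch_d C P 2 h [p a, p b, p c]) \<oplus>\<^bsub>A2'\<^esub> j' (\<epsilon>' [\<phi>\<^sub>0 (p a), \<phi>\<^sub>0 (p b), \<phi>\<^sub>0 (p c)])
      \<ominus>\<^bsub>A2'\<^esub> j' (\<phi> (\<epsilon> [p a, p b, p c]))"
    by simp
  then show ?thesis
    unfolding 1 2 \<psi>_coboundary[OF abc, symmetric]
    by (simp add: m_def Y.A2.act_expand Y.A2.M.diff_simps)
qed

text \<open>The cochains \<open>h\<close> with \<open>\<phi> \<cdot> \<epsilon> = d h + \<epsilon>' \<cdot> (\<phi>\<^sub>0 \<otimes> \<phi>\<^sub>0 \<otimes> \<phi>\<^sub>0)\<close> are those for which \<open>m h\<close> is a nonabelian cocycle.\<close>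

definition H :: "('c list \<Rightarrow> 'y) set" where
  "H = {h \<in> hoch_cochains K C P 2. \<forall>a\<in>carrier C. \<forall>b\<in>carrier C. \<forall>c\<in>carrier C.
     \<phi> (\<epsilon> [a, b, c]) = hoch_d C P 2 h [a, b, c] \<oplus>\<^bsub>B'\<^esub> \<epsilon>' [\<phi>\<^sub>0 a, \<phi>\<^sub>0 b, \<phi>\<^sub>0 c]}"

lemma butterfly_data_H:
  assumes "h \<in> H"
  shows "butterfly_data K X s r X' s' r' S (m h) k"
proof -
  have h: "h \<in> hoch_cochains K C P 2" using assms by (simp add: H_def)
  interpret h: bilin_map K C C B' "\<lambda>x y. h [x, y]" using h by (rule cochain2_bilin)
  interpret m: bilin_map K A1 A1 A2' "m h" using h by (rule m_bilin)
  note [simp] = h.closed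
  show ?thesis
  proof unfold_locales
    fix a b assume ab: "a \<in> carrier A1" "b \<in> carrier A1"
    then show "d' (m h a b) = S a \<otimes>\<^bsub>A1'\<^esub> S b \<ominus>\<^bsub>A1'\<^esub> S (a \<otimes>\<^bsub>A1\<^esub> b)"
      by (simp add: m_def Y.d_f S_def)
    fix c assume c: "c \<in> carrier A1"
    have "\<phi> (\<epsilon> [p a, p b, p c]) = hoch_d C P 2 h [p a, p b, p c] \<oplus>\<^bsub>B'\<^esub> \<epsilon>' [\<phi>\<^sub>0 (p a), \<phi>\<^sub>0 (p b), \<phi>\<^sub>0 (p c)]"
      using assms ab c by (simp add: H_def)
    moreover have "\<phi> (\<epsilon> [p a, p b, p c]) \<in> carrier B'" using \<epsilon> ab c by (auto simp: PiE_def)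
    ultimately show "lact A2' (S a) (m h b c) \<ominus>\<^bsub>A2'\<^esub> m h (a \<otimes>\<^bsub>A1\<^esub> b) c \<oplus>\<^bsub>A2'\<^esub> m h a (b \<otimes>\<^bsub>A1\<^esub> c)
        \<ominus>\<^bsub>A2'\<^esub> ract A2' (m h a b) (S c) = \<zero>\<^bsub>A2'\<^esub>"
      unfolding m_coboundary[OF h ab c] by (metis Y.B.M.diff_self Y.j.zero)
  next
    show "p' (S \<one>\<^bsub>A1\<^esub>) = \<one>\<^bsub>C'\<^esub>" by (simp add: S_def)
  next
    fix x assume x: "x \<in> carrier A2"
    then show "S (d x) = \<zero>\<^bsub>A1'\<^esub>" "d' (k x) = \<zero>\<^bsub>A1'\<^esub>" by (simp_all add: S_def k_def X.r_s_d)
    fix b assume b: "b \<in> carrier A1"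
    \<comment> \<open>\<psi> is applied to \<open>w_d_left\<close>; it is additive here because both
      summands on the right lie in the kernel of \<open>d\<close>.\<close>
    have "\<psi> (ract A2 x b \<ominus>\<^bsub>A2\<^esub> r (d x \<otimes>\<^bsub>A1\<^esub> b)) = \<psi> (X.w (d x) b) \<oplus>\<^bsub>A2'\<^esub> ract A2' (\<psi> (x \<ominus>\<^bsub>A2\<^esub> r (d x))) (S b)"
      unfolding X.w_d_left[OF x b] using x b by (simp add: \<psi>_add X.r_s_d flip: \<psi>_ract)
    then show "k (ract A2 x b) = m h (d x) b \<oplus>\<^bsub>A2'\<^esub> ract A2' (k x) (S b)"
      using x b by (simp add: k_def m_def X.r_s_d Y.A2.act_expand Y.A2.M.diff_simps)
    have "\<psi> (lact A2 b x \<ominus>\<^bsub>A2\<^esub> r (b \<otimes>\<^bsub>A1\<^esub> d x)) = \<psi> (X.w b (d x)) \<oplus>\<^bsub>A2'\<^esub> lact A2' (S b) (\<psi> (x \<ominus>\<^bsub>A2\<^esub> r (d x)))"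
      unfolding X.w_d_right[OF x b] using x b by (simp add: \<psi>_add X.r_s_d flip: \<psi>_lact)
    then show "k (lact A2 b x) = m h b (d x) \<oplus>\<^bsub>A2'\<^esub> lact A2' (S b) (k x)"
      using x b by (simp add: k_def m_def X.r_s_d Y.A2.act_expand Y.A2.M.diff_simps)
  qed
qed


end

text \<open>Transport of structure along \<open>u\<close>. Models are built on pairs, and this puts
  a copy of them into any type that has enough room.\<close>

lemma (in biext_pair) butterfly_copy:
  fixes F :: "('k, 'a2, 'a1, 'x2, 'x1, 'f) bfly" and u :: "'f \<Rightarrow> 'e"
  assumes F: "butterfly K X X' F" and u: "inj_on u (carrier (bf_E F))"
  shows "\<exists>F' :: ('k, 'a2, 'a1, 'x2, 'x1, 'e) bfly. butterfly K X X' F' \<and> butterfly_iso K X X' F' F"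
proof -
  interpret F: butterfly_on K X s r X' s' r' F by (rule butterfly_onI[OF F])
  define v where "v = the_inv_into (carrier F.E) u"
  have v [simp]: "v (u e) = e" if "e \<in> carrier F.E" for e
    unfolding v_def using u that by (rule the_inv_into_f_f)
  define E' where "E' = \<lparr>carrier = u ` carrier F.E, monoid.mult = (\<lambda>x y. u (v x \<otimes>\<^bsub>F.E\<^esub> v y)),
    one = u \<one>\<^bsub>F.E\<^esub>, ring.zero = u \<zero>\<^bsub>F.E\<^esub>, ring.add = (\<lambda>x y. u (v x \<oplus>\<^bsub>F.E\<^esub> v y)),
    smult = (\<lambda>t x. u (t \<odot>\<^bsub>F.E\<^esub> v x))\<rparr>"
  define F' where "F' = \<lparr>bf_E = E', bf_kappa = (\<lambda>x. u (F.\<kappa> x)), bf_iota = (\<lambda>y. u (F.\<iota> y)),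
    bf_delta = (\<lambda>x. F.\<delta> (v x)), bf_gamma = (\<lambda>x. F.\<gamma> (v x))\<rparr>"
  have sel: "bf_E F' = E'" "bf_kappa F' = (\<lambda>x. u (F.\<kappa> x))" "bf_iota F' = (\<lambda>y. u (F.\<iota> y))"
    "bf_delta F' = (\<lambda>x. F.\<delta> (v x))" "bf_gamma F' = (\<lambda>x. F.\<gamma> (v x))"
    by (simp_all add: F'_def)
  have bij: "bij_betw v (u ` carrier F.E) (carrier F.E)"
    unfolding v_def using u by (simp add: bij_betw_imageI bij_betw_the_inv_into)
  have tr: "algebra_transport K (bf_E F') F.E v"
    unfolding sel
    by (intro algebra_transport.intro F.E.assoc_algebra_axioms algebra_transport_axioms.intro)
      (auto simp: E'_def bij)
  show ?thesis
    by (intro exI[of _ F'] conjI butterfly_transport[OF F tr]) (auto simp: sel E'_def)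
qed

section \<open>Twisting and isomorphism\<close>

locale twist_pair = butterfly_pair K X s r X' s' r' F F'
  for K (structure) and X s r X' s' r' F F' +
  fixes g
  assumes g_closed [simp]: "\<lbrakk>x \<in> carrier (bx_C X); y \<in> carrier (bx_C X)\<rbrakk> \<Longrightarrow> g [x, y] \<in> carrier (bx_B X')"
    and iso: "butterfly_iso K X X' F F'"
    and F'_twist: "butterfly K X X' (twist_butterfly X X' g F')"

lemma twist_butterfly_sel [simp]:
  "bf_kappa (twist_butterfly X X' g F) = bf_kappa F"
  "bf_iota (twist_butterfly X X' g F) = bf_iota F"
  "bf_delta (twist_butterfly X X' g F) = bf_delta F"
  "bf_gamma (twist_butterfly X X' g F) = bf_gamma F"
  "carrier (bf_E (twist_butterfly X X' g F)) = carrier (bf_E F)"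
  "\<zero>\<^bsub>bf_E (twist_butterfly X X' g F)\<^esub> = \<zero>\<^bsub>bf_E F\<^esub>"
  "x \<oplus>\<^bsub>bf_E (twist_butterfly X X' g F)\<^esub> y = x \<oplus>\<^bsub>bf_E F\<^esub> y"
  "t \<odot>\<^bsub>bf_E (twist_butterfly X X' g F)\<^esub> x = t \<odot>\<^bsub>bf_E F\<^esub> x"
  "x \<otimes>\<^bsub>bf_E (twist_butterfly X X' g F)\<^esub> y = x \<otimes>\<^bsub>bf_E F\<^esub> y \<oplus>\<^bsub>bf_E F\<^esub>
     bf_iota F (bx_j X' (g [bx_p X (bf_delta F x), bx_p X (bf_delta F y)]))"
  "\<one>\<^bsub>bf_E (twist_butterfly X X' g F)\<^esub> = \<one>\<^bsub>bf_E F\<^esub> \<ominus>\<^bsub>bf_E F\<^esub> bf_iota F (bx_j X' (g [\<one>\<^bsub>bx_C X\<^esub>, \<one>\<^bsub>bx_C X\<^esub>]))"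
  by (simp_all add: twist_butterfly_def)

text \<open>The twist is expressed through \<iota> and \<open>p \<delta>\<close>, which an
  isomorphism preserves; so the isomorphism from \<open>F\<close> to \<open>F'\<close> respects the
  twisted products as well. Twisting then only has to be understood on models.\<close>

lemma (in twist_pair) twist_transport:
  shows "butterfly K X X' (twist_butterfly X X' g F)"
    and "butterfly_iso K X X' (twist_butterfly X X' g F) (twist_butterfly X X' g F')"
proof -
  from iso obtain \<alpha> where "butterfly_iso_map K X s r X' s' r' F F' \<alpha>" by (rule butterfly_isoE)
  then interpret A: butterfly_iso_map K X s r X' s' r' F F' \<alpha> .
  interpret \<alpha>: lin_map K F.E F'.E \<alpha> by (rule A.lin)
  have "assoc_algebra K (bf_E (twist_butterfly X X' g F'))"
    using F'_twist by (simp add: butterfly_def)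
  moreover have "algebra_transport_axioms K (bf_E (twist_butterfly X X' g F)) (bf_E (twist_butterfly X X' g F')) \<alpha>"
    by (rule algebra_transport_axioms.intro) (simp_all add: A.bij A.mult A.one A.\<iota> A.\<delta>)
  ultimately have tr: "algebra_transport K (bf_E (twist_butterfly X X' g F)) (bf_E (twist_butterfly X X' g F')) \<alpha>"
    by (rule algebra_transport.intro)
  show "butterfly K X X' (twist_butterfly X X' g F)"
    "butterfly_iso K X X' (twist_butterfly X X' g F) (twist_butterfly X X' g F')"
    by (rule F.butterfly_transport[OF F'_twist tr]; simp add: A.\<iota> A.\<kappa> A.\<delta> A.\<gamma>)+
qed

section \<open>Model butterflies and 2-cocycles\<close>

context biext_morphism
begin

abbreviation "model h \<equiv> butterfly_data.model X X' r' S (m h) k"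

lemma H_cochain: "h \<in> H \<Longrightarrow> h \<in> hoch_cochains K C P 2"
  by (simp add: H_def)

lemma model_butterfly: "h \<in> H \<Longrightarrow> butterfly K X X' (model h)"
  by (rule butterfly_data.butterfly_model[OF butterfly_data_H])

lemma model_over:
  assumes "h \<in> H"
  shows "butterfly_over X X' (model h) \<phi>\<^sub>0 \<phi>"
proof -
  interpret M: butterfly_data K X s r X' s' r' S "m h" k by (rule butterfly_data_H[OF assms])
  show ?thesis
    unfolding butterfly_over_def
    by (auto simp: M.Gamma_def k_def \<psi>_j S_def Y.A2.M.l_neg)
qed

text \<open>Compatibility with \<iota> and \<delta> forces an isomorphism to be
  \<open>(a, x) \<mapsto> (a, x + y a)\<close>. Compatibility with \<gamma> puts \<open>y\<close>
  into the kernel of \<open>d'\<close>, that with \<kappa> makes it vanish on the image of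
  \<open>d\<close>; so \<open>y\<close> is a linear map from \<open>C\<close> to \<open>B'\<close>
  in disguise, and multiplicativity says that \<open>h'\<close> is \<open>h\<close> minus its
  coboundary.\<close>

lemma model_iso_iff:
  assumes h: "h \<in> H" and h': "h' \<in> H"
  shows "butterfly_iso K X X' (model h) (model h') \<longleftrightarrow>
    (\<exists>f\<in>hoch_cochains K C P 1. h' = (\<lambda>cs\<in>tuples C 2. h cs \<oplus>\<^bsub>B'\<^esub> hoch_d C P 1 f cs))"
proof -
  interpret M: butterfly_data K X s r X' s' r' S "m h" k by (rule butterfly_data_H[OF h])
  interpret M': butterfly_data K X s r X' s' r' S "m h'" k by (rule butterfly_data_H[OF h'])
  interpret MM: butterfly_pair K X s r X' s' r' "model h" "model h'"
    by (rule butterfly_pairI[OF model_butterfly[OF h] model_butterfly[OF h']])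
  interpret h: bilin_map K C C B' "\<lambda>x y. h [x, y]" by (rule cochain2_bilin[OF H_cochain[OF h]])
  interpret h': bilin_map K C C B' "\<lambda>x y. h' [x, y]" by (rule cochain2_bilin[OF H_cochain[OF h']])
  note [simp] = h.closed h'.closed
  have m_m': "m h' a b = m h a b \<oplus>\<^bsub>A2'\<^esub> (j' (h' [p a, p b]) \<ominus>\<^bsub>A2'\<^esub> j' (h [p a, p b]))"
    if "a \<in> carrier A1" "b \<in> carrier A1" for a b
    using that by (simp add: m_def Y.A2.M.diff_simps)
  show ?thesis
  proof
    assume "\<exists>f\<in>hoch_cochains K C P 1. h' = (\<lambda>cs\<in>tuples C 2. h cs \<oplus>\<^bsub>B'\<^esub> hoch_d C P 1 f cs)"
    then obtain f where f: "f \<in> hoch_cochains K C P 1"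
      and h'f: "h' = (\<lambda>cs\<in>tuples C 2. h cs \<oplus>\<^bsub>B'\<^esub> hoch_d C P 1 f cs)" by blast
    interpret f: lin_map K C P "\<lambda>x. f [x]" by (rule P.cochain1_lin[OF f])
    have f_closed [simp]: "f [x] \<in> carrier B'" if "x \<in> carrier C" for x using f.closed[OF that] by simp
    have eq: "j' (h' [p a, p b]) = j' (h [p a, p b]) \<oplus>\<^bsub>A2'\<^esub> (lact A2' (S a) (j' (f [p b]))
        \<ominus>\<^bsub>A2'\<^esub> j' (f [p (a \<otimes>\<^bsub>A1\<^esub> b)]) \<oplus>\<^bsub>A2'\<^esub> ract A2' (j' (f [p a])) (S b))"
      if "a \<in> carrier A1" "b \<in> carrier A1" for a b
      unfolding h'f using that P.hoch_d1[OF f, of "p a" "p b"]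
      by (simp add: S_def Y.j_lact_bx Y.j_ract_bx del: One_nat_def)
    show "butterfly_iso K X X' (model h) (model h')"
    proof (rule MM.butterfly_isoI[where \<alpha> = "\<lambda>e. (fst e, snd e \<ominus>\<^bsub>A2'\<^esub> j' (f [p (fst e)]))"])
      show "lin_map K MM.F.E MM.F'.E (\<lambda>e. (fst e, snd e \<ominus>\<^bsub>A2'\<^esub> j' (f [p (fst e)])))"
        by unfold_locales (auto intro!: linear_mapsI simp: Y.A2.smult_diff Y.A2.M.diff_simps f.add[simplified] f.smult[simplified])
    next
      fix e e' assume "e \<in> carrier MM.F.E" "e' \<in> carrier MM.F.E"
      then obtain a x b y where e: "e = (a, x)" "e' = (b, y)" and [simp]: "a \<in> carrier A1" "b \<in> carrier A1"
          "x \<in> carrier A2'" "y \<in> carrier A2'" by auto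
      \<comment> \<open>\<open>Gamma\<close> is unchanged since \<open>d' j' = 0\<close>, and
        products of \<open>j' (f [c])\<close> with \<open>d' y\<close> vanish by the Peiffer
        identity. What is left over is the formula for the coboundary of \<open>f\<close>.\<close>
      show "(fst (e \<otimes>\<^bsub>MM.F.E\<^esub> e'), snd (e \<otimes>\<^bsub>MM.F.E\<^esub> e') \<ominus>\<^bsub>A2'\<^esub> j' (f [p (fst (e \<otimes>\<^bsub>MM.F.E\<^esub> e'))]))
        = (fst e, snd e \<ominus>\<^bsub>A2'\<^esub> j' (f [p (fst e)])) \<otimes>\<^bsub>MM.F'.E\<^esub> (fst e', snd e' \<ominus>\<^bsub>A2'\<^esub> j' (f [p (fst e')]))"
        by (simp add: e M.model_mult_def M'.model_mult_def M.Gamma_def M'.Gamma_def m_m' eq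
            Y.peiffer[of "j' _", symmetric] Y.A2.act_expand Y.A2.M.diff_simps)
    qed (auto simp: M.Gamma_def M'.Gamma_def Y.A1.M.diff_simps)
  next
    assume "butterfly_iso K X X' (model h) (model h')"
    then obtain \<alpha> where "butterfly_iso_map K X s r X' s' r' (model h) (model h') \<alpha>" by (rule MM.butterfly_isoE)
    then interpret A: butterfly_iso_map K X s r X' s' r' "model h" "model h'" \<alpha> .
    interpret \<alpha>: lin_map K MM.F.E MM.F'.E \<alpha> by (rule A.lin)
    define y where "y a = snd (\<alpha> (a, \<zero>\<^bsub>A2'\<^esub>))" for a
    have \<alpha>_closed: "\<alpha> (a, x) \<in> carrier A1 \<times> carrier A2'" if "a \<in> carrier A1" "x \<in> carrier A2'" for a x
      using that \<alpha>.closed[of "(a, x)"] by simp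
    have y_closed [simp]: "y a \<in> carrier A2'" if "a \<in> carrier A1" for a
      using \<alpha>_closed[of a "\<zero>\<^bsub>A2'\<^esub>"] that by (auto simp: y_def mem_Times_iff)
    have \<alpha>0: "\<alpha> (a, \<zero>\<^bsub>A2'\<^esub>) = (a, y a)" if "a \<in> carrier A1" for a
      using A.\<delta>[of "(a, \<zero>\<^bsub>A2'\<^esub>)"] that by (simp add: y_def prod_eq_iff)
    have \<alpha>: "\<alpha> (a, x) = (a, x \<oplus>\<^bsub>A2'\<^esub> y a)" if "a \<in> carrier A1" "x \<in> carrier A2'" for a x
      using \<alpha>.add[of "(a, \<zero>\<^bsub>A2'\<^esub>)" "(\<zero>\<^bsub>A1\<^esub>, x)"] A.\<iota>[of x] that by (simp add: \<alpha>0 Y.A2.M.a_comm)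
    have y_add: "y (a \<oplus>\<^bsub>A1\<^esub> b) = y a \<oplus>\<^bsub>A2'\<^esub> y b" if "a \<in> carrier A1" "b \<in> carrier A1" for a b
      using \<alpha>.add[of "(a, \<zero>\<^bsub>A2'\<^esub>)" "(b, \<zero>\<^bsub>A2'\<^esub>)"] that by (simp add: \<alpha>0)
    have y_smult: "y (t \<odot>\<^bsub>A1\<^esub> a) = t \<odot>\<^bsub>A2'\<^esub> y a" if "t \<in> carrier K" "a \<in> carrier A1" for t a
      using \<alpha>.smult[of t "(a, \<zero>\<^bsub>A2'\<^esub>)"] that by (simp add: \<alpha>0)
    have d_y [simp]: "d' (y a) = \<zero>\<^bsub>A1'\<^esub>" if "a \<in> carrier A1" for a
      using A.\<gamma>[of "(a, \<zero>\<^bsub>A2'\<^esub>)"] that by (simp add: \<alpha>0 M.Gamma_def M'.Gamma_def)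
    have y_d: "y (d x) = \<zero>\<^bsub>A2'\<^esub>" if "x \<in> carrier A2" for x
      using A.\<kappa>[of x] that by (simp add: \<alpha>)
    \<comment> \<open>\<open>a\<close> differs from \<open>s (p a)\<close> by
      \<open>d (r a)\<close>, on which \<open>y\<close> vanishes.\<close>
    have y_sp: "y a = y (s (p a))" if "a \<in> carrier A1" for a
    proof -
      have "y (s (p a) \<oplus>\<^bsub>A1\<^esub> d (r a)) = y (s (p a))" 
        using y_add[of "s (p a)" "d (r a)"] y_d[of "r a"] that by simp
      then show ?thesis using that by (simp only: X.s_p_eq)
    qed
    \<comment> \<open>The sign mirrors the converse direction, where the isomorphism subtracts
      \<open>j' (f [p a])\<close>.\<close>
    define f where "f = (\<lambda>cs\<in>tuples C 1. \<ominus>\<^bsub>B'\<^esub> Y.jinv (y (s (hd cs))))"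
    have jinv_add: "Y.jinv (y a \<oplus>\<^bsub>A2'\<^esub> y b) = Y.jinv (y a) \<oplus>\<^bsub>B'\<^esub> Y.jinv (y b)" if "a \<in> carrier A1" "b \<in> carrier A1" for a b
      by (rule Y.j_eqD) (use that in simp_all)
    have jinv_smult: "Y.jinv (t \<odot>\<^bsub>A2'\<^esub> y a) = t \<odot>\<^bsub>B'\<^esub> Y.jinv (y a)" if "t \<in> carrier K" "a \<in> carrier A1" for t a
      by (rule Y.j_eqD) (use that in simp_all)
    have f: "f \<in> hoch_cochains K C P 1"
      unfolding f_def
      by (rule P.cochain1I, rule linear_mapsI)
        (simp_all add: y_add y_smult jinv_add jinv_smult Y.B.M.minus_add Y.B.M.a_ac Y.B.smult_r_minus)
    have f_eq: "f [c] = \<ominus>\<^bsub>B'\<^esub> Y.jinv (y (s c))" if "c \<in> carrier C" for c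
      using that by (simp add: f_def)
    have "h' = (\<lambda>cs\<in>tuples C 2. h cs \<oplus>\<^bsub>P\<^esub> hoch_d C P 1 f cs)"
    proof (rule P.cochain2_eqI[OF H_cochain[OF h'] P.cochain2_add[OF H_cochain[OF h] P.hoch_d1_cochain[OF f]]])
      fix c c' assume [simp]: "c \<in> carrier C" "c' \<in> carrier C"
      have S: "S (s c) = s' (\<phi>\<^sub>0 c)" "S (s c') = s' (\<phi>\<^sub>0 c')" by (simp_all add: S_def)
      have ycc: "y (s c \<otimes>\<^bsub>A1\<^esub> s c') = y (s (c \<otimes>\<^bsub>C\<^esub> c'))"
        using y_sp[of "s c \<otimes>\<^bsub>A1\<^esub> s c'"] by simp
      have "snd (\<alpha> ((s c, \<zero>\<^bsub>A2'\<^esub>) \<otimes>\<^bsub>MM.F.E\<^esub> (s c', \<zero>\<^bsub>A2'\<^esub>))) = snd (\<alpha> (s c, \<zero>\<^bsub>A2'\<^esub>) \<otimes>\<^bsub>MM.F'.E\<^esub> \<alpha> (s c', \<zero>\<^bsub>A2'\<^esub>))"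
        by (subst A.mult) simp_all
      then have "m h (s c) (s c') \<oplus>\<^bsub>A2'\<^esub> y (s (c \<otimes>\<^bsub>C\<^esub> c')) = m h' (s c) (s c') \<oplus>\<^bsub>A2'\<^esub> ract A2' (y (s c)) (s' (\<phi>\<^sub>0 c'))
          \<oplus>\<^bsub>A2'\<^esub> lact A2' (s' (\<phi>\<^sub>0 c)) (y (s c'))"
        by (simp add: M.model_mult_def M'.model_mult_def M.Gamma_def M'.Gamma_def \<alpha> \<alpha>0 S ycc)
      then have "(j' (h [c, c']) \<oplus>\<^bsub>A2'\<^esub> y (s (c \<otimes>\<^bsub>C\<^esub> c'))) \<oplus>\<^bsub>A2'\<^esub> m h (s c) (s c') =
          (j' (h' [c, c']) \<oplus>\<^bsub>A2'\<^esub> ract A2' (y (s c)) (s' (\<phi>\<^sub>0 c'))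
          \<oplus>\<^bsub>A2'\<^esub> lact A2' (s' (\<phi>\<^sub>0 c)) (y (s c'))) \<oplus>\<^bsub>A2'\<^esub> m h (s c) (s c')"
        by (simp add: m_m' Y.A2.M.diff_simps del: Y.A2.M.add.right_cancel)
      then have main: "j' (h [c, c']) \<oplus>\<^bsub>A2'\<^esub> y (s (c \<otimes>\<^bsub>C\<^esub> c')) = j' (h' [c, c']) \<oplus>\<^bsub>A2'\<^esub> ract A2' (y (s c)) (s' (\<phi>\<^sub>0 c'))
          \<oplus>\<^bsub>A2'\<^esub> lact A2' (s' (\<phi>\<^sub>0 c)) (y (s c'))"
        by (subst (asm) Y.A2.M.add.right_cancel) simp_all
      have "j' (h' [c, c']) = j' (h [c, c'] \<oplus>\<^bsub>B'\<^esub> hoch_d C P 1 f [c, c'])"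
        using main P.hoch_d1[OF f, of c c']
        by (simp add: f_eq Y.j_lact_bx Y.j_ract_bx Y.A2.act_expand Y.A2.M.diff_simps del: One_nat_def)
      moreover have "hoch_d C P 1 f [c, c'] \<in> carrier B'"
        using P.cochain2_closed[OF P.hoch_d1_cochain[OF f], of "[c, c']"] by (simp del: One_nat_def)
      ultimately have "h' [c, c'] = h [c, c'] \<oplus>\<^bsub>B'\<^esub> hoch_d C P 1 f [c, c']"
        by (intro Y.j_eqD) simp_all
      then show "h' [c, c'] = (\<lambda>cs\<in>tuples C 2. h cs \<oplus>\<^bsub>P\<^esub> hoch_d C P 1 f cs) [c, c']" by (simp del: One_nat_def)
    qed
    with f show "\<exists>f\<in>hoch_cochains K C P 1. h' = (\<lambda>cs\<in>tuples C 2. h cs \<oplus>\<^bsub>B'\<^esub> hoch_d C P 1 f cs)"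
      unfolding P_simps by blast
  qed
qed

text \<open>Together with \<open>H_diff\<close> this shows that \<open>H\<close>, when inhabited, is
  a coset of the 2-cocycles. The torsor structure on isomorphism classes is the image of this
  one.\<close>

lemma H_add:
  assumes h: "h \<in> H" and g: "g \<in> hoch_cocycles K C P 2"
  shows "(\<lambda>cs\<in>tuples C 2. h cs \<oplus>\<^bsub>B'\<^esub> g cs) \<in> H"
proof -
  have gc: "g \<in> hoch_cochains K C P 2" by (rule P.cocycle2_cochain[OF g])
  have "(\<lambda>cs\<in>tuples C 2. h cs \<oplus>\<^bsub>B'\<^esub> g cs) \<in> hoch_cochains K C P 2"
    using P.cochain2_add[OF H_cochain[OF h] gc] by simp
  moreover have "\<phi> (\<epsilon> [a, b, c]) = hoch_d C P 2 (\<lambda>cs\<in>tuples C 2. h cs \<oplus>\<^bsub>B'\<^esub> g cs) [a, b, c] \<oplus>\<^bsub>B'\<^esub> \<epsilon>' [\<phi>\<^sub>0 a, \<phi>\<^sub>0 b, \<phi>\<^sub>0 c]"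
    if "a \<in> carrier C" "b \<in> carrier C" "c \<in> carrier C" for a b c
  proof -
    have "hoch_d C P 2 g [a, b, c] = \<zero>\<^bsub>B'\<^esub>" using g that by (simp add: P.cocycle2_iff)
    then have "hoch_d C P 2 (\<lambda>cs\<in>tuples C 2. h cs \<oplus>\<^bsub>B'\<^esub> g cs) [a, b, c] = hoch_d C P 2 h [a, b, c]"
      using P.hoch_d2_add[OF H_cochain[OF h] gc that] P.hoch_d2_closed[OF H_cochain[OF h] that] by simp
    then show ?thesis using h that by (simp add: H_def)
  qed
  ultimately show ?thesis by (simp add: H_def)
qed

lemma H_diff:
  assumes h: "h \<in> H" and h': "h' \<in> H"
  shows "\<exists>g\<in>hoch_cocycles K C P 2. h' = (\<lambda>cs\<in>tuples C 2. h cs \<oplus>\<^bsub>B'\<^esub> g cs)"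
proof -
  let ?n = "\<lambda>cs\<in>tuples C 2. \<ominus>\<^bsub>P\<^esub> h cs"
  let ?g = "\<lambda>cs\<in>tuples C 2. ?n cs \<oplus>\<^bsub>P\<^esub> h' cs"
  note hc = H_cochain[OF h] H_cochain[OF h']
  have n: "?n \<in> hoch_cochains K C P 2" by (rule P.cochain2_neg[OF hc(1)])
  have g: "?g \<in> hoch_cochains K C P 2" by (rule P.cochain2_add[OF n hc(2)])
  have "hoch_d C P 2 ?g [a, b, c] = \<zero>\<^bsub>P\<^esub>" if abc: "a \<in> carrier C" "b \<in> carrier C" "c \<in> carrier C" for a b c
  proof -
    have e: "\<epsilon>' [\<phi>\<^sub>0 a, \<phi>\<^sub>0 b, \<phi>\<^sub>0 c] \<in> carrier B'" using \<epsilon>' abc by (auto simp: PiE_def)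
    have cl: "hoch_d C P 2 h [a, b, c] \<in> carrier B'" "hoch_d C P 2 h' [a, b, c] \<in> carrier B'"
      using P.hoch_d2_closed[OF hc(1) abc] P.hoch_d2_closed[OF hc(2) abc] by simp_all
    have "hoch_d C P 2 h [a, b, c] \<oplus>\<^bsub>B'\<^esub> \<epsilon>' [\<phi>\<^sub>0 a, \<phi>\<^sub>0 b, \<phi>\<^sub>0 c] = hoch_d C P 2 h' [a, b, c] \<oplus>\<^bsub>B'\<^esub> \<epsilon>' [\<phi>\<^sub>0 a, \<phi>\<^sub>0 b, \<phi>\<^sub>0 c]"
      using h h' abc by (simp add: H_def)
    then have "hoch_d C P 2 h [a, b, c] = hoch_d C P 2 h' [a, b, c]" using cl e by simp
    then show ?thesis
      using P.hoch_d2_add[OF n hc(2) abc] P.hoch_d2_neg[OF hc(1) abc] cl by (simp add: Y.B.M.l_neg)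
  qed
  then have "?g \<in> hoch_cocycles K C P 2" using g by (simp add: P.cocycle2_iff)
  moreover have "h' = (\<lambda>cs\<in>tuples C 2. h cs \<oplus>\<^bsub>P\<^esub> ?g cs)"
    by (rule P.cochain2_eqI[OF hc(2) P.cochain2_add[OF hc(1) g]])
      (use P.cochain2_closed[OF hc(1)] P.cochain2_closed[OF hc(2)] in \<open>simp add: Y.B.M.r_neg2\<close>)
  ultimately show ?thesis unfolding P_simps by blast
qed

text \<open>The isomorphism is the identity on pairs: both twisting by \<open>g\<close> and
  replacing \<open>h\<close> by \<open>h + g\<close> add \<open>j' (g [p a, p b])\<close> to the
  second component of a product.\<close>

lemma twist_model:
  assumes h: "h \<in> H" and g: "g \<in> hoch_cocycles K C P 2"
  defines "hg \<equiv> \<lambda>cs\<in>tuples C 2. h cs \<oplus>\<^bsub>B'\<^esub> g cs"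
  shows "butterfly K X X' (twist_butterfly X X' g (model h))"
    and "butterfly_iso K X X' (twist_butterfly X X' g (model h)) (model hg)"
proof -
  have hg: "hg \<in> H" unfolding hg_def by (rule H_add[OF h g])
  interpret M: butterfly_data K X s r X' s' r' S "m h" k by (rule butterfly_data_H[OF h])
  interpret M': butterfly_data K X s r X' s' r' S "m hg" k by (rule butterfly_data_H[OF hg])
  interpret E: assoc_algebra K M.model_algebra by (rule M.model_algebra)
  have [simp]: "h [x, y] \<in> carrier B'" "g [x, y] \<in> carrier B'" if "x \<in> carrier C" "y \<in> carrier C" for x y
    using that P.cochain2_closed[OF H_cochain[OF h], of "[x, y]"]
      P.cochain2_closed[OF P.cocycle2_cochain[OF g], of "[x, y]"] by simp_all
  have m: "m hg a b = m h a b \<oplus>\<^bsub>A2'\<^esub> j' (g [p a, p b])" if "a \<in> carrier A1" "b \<in> carrier A1" for a b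
    using that by (simp add: m_def hg_def Y.A2.M.diff_simps)
  \<comment> \<open>\<open>unit2\<close> contains \<open>- m 1 1\<close>, so adding \<open>g\<close>
    to \<open>h\<close> lowers it by \<open>j' (g [1, 1])\<close>. This is the origin of the
    corrected unit in \<open>twist_butterfly\<close>.\<close>
  have one: "(\<one>\<^bsub>A1\<^esub>, M.unit2) \<ominus>\<^bsub>M.model_algebra\<^esub> (\<zero>\<^bsub>A1\<^esub>, j' (g [\<one>\<^bsub>C\<^esub>, \<one>\<^bsub>C\<^esub>])) = (\<one>\<^bsub>A1\<^esub>, M'.unit2)"
    by (subst E.M.diff_eq_eq) (simp_all add: M.unit2_def M'.unit2_def m Y.A2.M.diff_simps)
  have "algebra_transport_axioms K (bf_E (twist_butterfly X X' g (model h))) M'.model_algebra (\<lambda>e. e)"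
    by (rule algebra_transport_axioms.intro)
      (auto simp: one bij_betw_def M.model_mult_def M'.model_mult_def M.Gamma_def M'.Gamma_def m Y.A2.M.a_ac)
  then have tr: "algebra_transport K (bf_E (twist_butterfly X X' g (model h))) (bf_E (model hg)) (\<lambda>e. e)"
    unfolding M'.model_sel by (intro algebra_transport.intro M'.model_algebra)
  show "butterfly K X X' (twist_butterfly X X' g (model h))"
    "butterfly_iso K X X' (twist_butterfly X X' g (model h)) (model hg)"
    by (rule butterfly_transport[OF model_butterfly[OF hg] tr]; simp add: M.Gamma_def M'.Gamma_def)+
qed

lemma twist_iso_model:
  assumes F: "butterfly K X X' F" and iso: "butterfly_iso K X X' F (model h)"
    and h: "h \<in> H" and g: "g \<in> hoch_cocycles K C P 2"
  shows "butterfly K X X' (twist_butterfly X X' g F)"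
    and "butterfly_iso K X X' (twist_butterfly X X' g F) (model (\<lambda>cs\<in>tuples C 2. h cs \<oplus>\<^bsub>B'\<^esub> g cs))"
proof -
  have "g [x, y] \<in> carrier B'" if "x \<in> carrier C" "y \<in> carrier C" for x y
    using that P.cochain2_closed[OF P.cocycle2_cochain[OF g], of "[x, y]"] by simp
  then interpret T: twist_pair K X s r X' s' r' F "model h" g
    by (intro twist_pair.intro twist_pair_axioms.intro butterfly_pairI F iso model_butterfly h twist_model(1) g)
  show "butterfly K X X' (twist_butterfly X X' g F)" by (rule T.twist_transport(1))
  show "butterfly_iso K X X' (twist_butterfly X X' g F) (model (\<lambda>cs\<in>tuples C 2. h cs \<oplus>\<^bsub>B'\<^esub> g cs))"
    by (rule butterfly_iso_trans[OF T.twist_transport(2) twist_model(2)[OF h g]])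
qed

end

section \<open>Linear sections of a butterfly and their defect\<close>

locale butterfly_over_on = biext_morphism K X s r X' s' r' \<phi>\<^sub>0 \<phi> \<epsilon> \<epsilon>' + butterfly_on K X s r X' s' r' F
  for K (structure) and X s r X' s' r' \<phi>\<^sub>0 \<phi> \<epsilon> \<epsilon>' F +
  assumes over: "butterfly_over X X' F \<phi>\<^sub>0 \<phi>"
begin

lemma p_\<gamma>: "e \<in> carrier E \<Longrightarrow> p' (\<gamma> e) = \<phi>\<^sub>0 (p (\<delta> e))"
  using over by (simp add: butterfly_over_def)

lemma \<kappa>_kernel:
  assumes "x \<in> carrier A2" "d x = \<zero>\<^bsub>A1\<^esub>"
  shows "\<kappa> x = \<ominus>\<^bsub>E\<^esub> \<iota> (\<psi> x)"
proof -
  obtain b where b: "b \<in> carrier B" "x = j b" using assms by (rule kernel_cases)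
  then have "\<kappa> (j b) \<oplus>\<^bsub>E\<^esub> \<iota> (j' (\<phi> b)) = \<zero>\<^bsub>E\<^esub>" using over by (simp add: butterfly_over_def)
  then show ?thesis using b by (simp add: \<psi>_j E.M.eq_neg_iff)
qed

text \<open>Start from any linear section of \<open>p \<delta>\<close>. Its errors under \<delta>
  and \<gamma> lie in the kernels of \<open>p\<close> and \<open>p'\<close>, so \<open>r\<close> and
  \<open>r'\<close> lift them. The two corrections do not interfere: values of \<kappa> are
  invisible to \<gamma>, values of \<iota> to \<delta>.\<close>

lemma ex_compatible_section:
  "\<exists>\<sigma>. lin_map K C E \<sigma> \<and> (\<forall>c\<in>carrier C. \<delta> (\<sigma> c) = s c \<and> \<gamma> (\<sigma> c) = s' (\<phi>\<^sub>0 c))"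
proof -
  have lin: "lin_map K E C (\<lambda>e. p (\<delta> e))"
    by unfold_locales (auto intro!: linear_mapsI)
  have "c \<in> (\<lambda>e. p (\<delta> e)) ` carrier E" if c: "c \<in> carrier C" for c
  proof -
    have "s c \<in> \<delta> ` carrier E" unfolding \<delta>_surj using c by simp
    then obtain e where "e \<in> carrier E" "s c = \<delta> e" by (rule imageE)
    then show ?thesis using c X.p_s[OF c] by (intro image_eqI[of _ _ e]) simp_all
  qed
  then have "(\<lambda>e. p (\<delta> e)) ` carrier E = carrier C" by auto
  then obtain \<sigma>0 where \<sigma>0: "\<sigma>0 \<in> linear_maps K C E" "\<forall>c\<in>carrier C. p (\<delta> (\<sigma>0 c)) = c"
    using surjective_linear_map_has_section[OF X.K_field lin] by blast
  interpret \<sigma>0: lin_map K C E \<sigma>0 by unfold_locales (rule \<sigma>0(1))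
  note [simp] = \<sigma>0(2)[rule_format]
  define \<sigma> where "\<sigma> c = \<sigma>0 c \<ominus>\<^bsub>E\<^esub> \<kappa> (r (\<delta> (\<sigma>0 c) \<ominus>\<^bsub>A1\<^esub> s c)) \<ominus>\<^bsub>E\<^esub> \<iota> (r' (\<gamma> (\<sigma>0 c) \<ominus>\<^bsub>A1'\<^esub> s' (\<phi>\<^sub>0 c)))" for c
  have "\<sigma> \<in> linear_maps K C E"
    by (rule linear_mapsI) (simp_all add: \<sigma>_def E.smult_diff E.smult_r_distr E.M.diff_simps)
  then have "lin_map K C E \<sigma>" by unfold_locales
  moreover have "\<delta> (\<sigma> c) = s c" "\<gamma> (\<sigma> c) = s' (\<phi>\<^sub>0 c)" if "c \<in> carrier C" for c
    using that by (simp_all add: \<sigma>_def X.d_r Y.d_r p_\<gamma> X.A1.M.diff_simps Y.A1.M.diff_simps)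
  ultimately show ?thesis by blast
qed

end

locale butterfly_section = butterfly_over_on K X s r X' s' r' \<phi>\<^sub>0 \<phi> \<epsilon> \<epsilon>' F
  for K (structure) and X s r X' s' r' \<phi>\<^sub>0 \<phi> \<epsilon> \<epsilon>' F +
  fixes \<sigma>
  assumes \<sigma>_lin: "lin_map K (bx_C X) (bf_E F) \<sigma>"
    and \<delta>_\<sigma> [simp]: "c \<in> carrier (bx_C X) \<Longrightarrow> bf_delta F (\<sigma> c) = s c"
    and \<gamma>_\<sigma> [simp]: "c \<in> carrier (bx_C X) \<Longrightarrow> bf_gamma F (\<sigma> c) = s' (\<phi>\<^sub>0 c)"
begin

sublocale \<sigma>: lin_map K C E \<sigma> by (rule \<sigma>_lin)

definition "defect a b = \<sigma> a \<otimes>\<^bsub>E\<^esub> \<sigma> b \<ominus>\<^bsub>E\<^esub> \<sigma> (a \<otimes>\<^bsub>C\<^esub> b) \<ominus>\<^bsub>E\<^esub> \<kappa> (X.f a b) \<ominus>\<^bsub>E\<^esub> \<iota> (Y.f (\<phi>\<^sub>0 a) (\<phi>\<^sub>0 b))"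

definition "defect_cochain = (\<lambda>cs\<in>tuples C 2.
     SOME x. x \<in> carrier B' \<and> \<iota> (j' x) = defect (hd cs) (hd (tl cs)))"

lemma defect_cochain:
  assumes "a \<in> carrier C" "b \<in> carrier C"
  shows defect_cochain_closed: "defect_cochain [a, b] \<in> carrier B'"
    and \<iota>_defect_cochain: "\<iota> (j' (defect_cochain [a, b])) = defect a b"
proof -
  have "defect a b \<in> carrier E" "\<delta> (defect a b) = \<zero>\<^bsub>A1\<^esub>"
    using assms by (simp_all add: defect_def X.d_f)
  then obtain y where y: "y \<in> carrier A2'" "\<iota> y = defect a b" using \<iota>_exact by blast
  have "d' y = \<gamma> (defect a b)" using y by (simp flip: y(2))
  also have "\<dots> = \<zero>\<^bsub>A1'\<^esub>" using assms by (simp add: defect_def Y.d_f)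
  finally have "y \<in> j' ` carrier B'" using y(1) by (intro Y.j_exact)
  then obtain x where "x \<in> carrier B'" "y = j' x" by blast
  with y have "\<exists>x. x \<in> carrier B' \<and> \<iota> (j' x) = defect a b" by blast
  then have "defect_cochain [a, b] \<in> carrier B' \<and> \<iota> (j' (defect_cochain [a, b])) = defect a b"
    using someI_ex[of "\<lambda>x. x \<in> carrier B' \<and> \<iota> (j' x) = defect a b"] assms
    by (simp add: defect_cochain_def)
  then show "defect_cochain [a, b] \<in> carrier B'" "\<iota> (j' (defect_cochain [a, b])) = defect a b" by simp_all
qed

lemma \<iota>_j_eqD: "\<lbrakk>\<iota> (j' x) = \<iota> (j' y); x \<in> carrier B'; y \<in> carrier B'\<rbrakk> \<Longrightarrow> x = y"
  by (meson \<iota>_eqD Y.j_eqD Y.j.closed)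

text \<open>The chosen values are unique because \<open>\<iota> j'\<close> is injective; bilinearity
  of \<open>defect\<close> therefore passes to them.\<close>

lemma defect_cochain_in: "defect_cochain \<in> hoch_cochains K C P 2"
  unfolding P.cochain2_iff
proof
  show "defect_cochain \<in> extensional (tuples C 2)" by (simp add: defect_cochain_def)
  have "(\<lambda>x y. defect_cochain [x, y]) \<in> bilinear_maps K C C B'"
    by (rule bilinear_mapsI; (rule \<iota>_j_eqD)?)
      (simp_all add: defect_cochain_closed \<iota>_defect_cochain defect_def E.mult_expand X.C.mult_expand
        X.f.expand Y.f.expand E.smult_diff E.smult_r_distr E.M.diff_simps)
  then show "(\<lambda>x y. defect_cochain [x, y]) \<in> bilinear_maps K C C P" by (simp only: bilinear_maps_P)
qed

definition "t a = \<sigma> (p a) \<oplus>\<^bsub>E\<^esub> \<kappa> (r a)"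

lemma t_lin: "lin_map K A1 E t"
  by unfold_locales (auto intro!: linear_mapsI simp: t_def E.smult_r_distr E.M.a_ac)

sublocale t: lin_map K A1 E t by (rule t_lin)

lemma \<delta>_t [simp]: "a \<in> carrier A1 \<Longrightarrow> \<delta> (t a) = a"
  by (simp add: t_def X.s_p_eq)

lemma \<gamma>_t [simp]: "a \<in> carrier A1 \<Longrightarrow> \<gamma> (t a) = S a"
  by (simp add: t_def S_def)

lemma \<kappa>_t: "x \<in> carrier A2 \<Longrightarrow> \<kappa> x = t (d x) \<oplus>\<^bsub>E\<^esub> \<iota> (k x)"
proof -
  assume x: "x \<in> carrier A2"
  have "\<kappa> (x \<ominus>\<^bsub>A2\<^esub> r (d x)) = \<iota> (k x)"
    using x \<kappa>_kernel[of "x \<ominus>\<^bsub>A2\<^esub> r (d x)"] by (simp add: k_def X.r_s_d)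
  then show ?thesis using x by (simp add: t_def E.M.diff_simps)
qed

lemma m_closed [simp]: "\<lbrakk>a \<in> carrier A1; b \<in> carrier A1\<rbrakk> \<Longrightarrow> m defect_cochain a b \<in> carrier A2'"
  by (simp add: m_def defect_cochain_closed)

lemma t_mult:
  assumes [simp]: "a \<in> carrier A1" "b \<in> carrier A1"
  shows "t a \<otimes>\<^bsub>E\<^esub> t b = t (a \<otimes>\<^bsub>A1\<^esub> b) \<oplus>\<^bsub>E\<^esub> \<iota> (m defect_cochain a b)"
proof -
  have 1: "\<sigma> (p a) \<otimes>\<^bsub>E\<^esub> \<sigma> (p b) = \<sigma> (p a \<otimes>\<^bsub>C\<^esub> p b) \<oplus>\<^bsub>E\<^esub> \<kappa> (X.f (p a) (p b)) \<oplus>\<^bsub>E\<^esub> \<iota> (Y.f (\<phi>\<^sub>0 (p a)) (\<phi>\<^sub>0 (p b)))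
      \<oplus>\<^bsub>E\<^esub> \<iota> (j' (defect_cochain [p a, p b]))"
    by (simp add: \<iota>_defect_cochain defect_def E.M.diff_simps)
  have 2: "\<sigma> (p a) \<otimes>\<^bsub>E\<^esub> \<kappa> (r b) = \<kappa> (lact A2 (s (p a)) (r b))"
    by (simp add: \<kappa>_mult_right)
  have 3: "\<kappa> (r a) \<otimes>\<^bsub>E\<^esub> t b = \<kappa> (ract A2 (r a) b)"
    by (simp add: \<kappa>_mult_left)
  \<comment> \<open>Up to \<open>r (a b)\<close> these are the terms collected in
    \<open>w a b\<close>, to which \<open>\<kappa>_kernel\<close> applies.\<close>
  have 4: "\<kappa> (X.f (p a) (p b)) \<oplus>\<^bsub>E\<^esub> \<kappa> (ract A2 (r a) b) \<oplus>\<^bsub>E\<^esub> \<kappa> (lact A2 (s (p a)) (r b)) =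
      \<kappa> (r (a \<otimes>\<^bsub>A1\<^esub> b)) \<ominus>\<^bsub>E\<^esub> \<iota> (\<psi> (X.w a b))"
  proof -
    have "\<kappa> (X.f (p a) (p b)) \<oplus>\<^bsub>E\<^esub> \<kappa> (ract A2 (r a) b) \<oplus>\<^bsub>E\<^esub> \<kappa> (lact A2 (s (p a)) (r b)) =
      \<kappa> (r (a \<otimes>\<^bsub>A1\<^esub> b)) \<oplus>\<^bsub>E\<^esub> \<kappa> (X.w a b)"
      by (simp add: X.w_def E.M.diff_simps)
    then show ?thesis by (simp add: \<kappa>_kernel E.M.add_neg_eq)
  qed
  have "t a \<otimes>\<^bsub>E\<^esub> t b = \<sigma> (p a) \<otimes>\<^bsub>E\<^esub> \<sigma> (p b) \<oplus>\<^bsub>E\<^esub> \<sigma> (p a) \<otimes>\<^bsub>E\<^esub> \<kappa> (r b) \<oplus>\<^bsub>E\<^esub> \<kappa> (r a) \<otimes>\<^bsub>E\<^esub> t b"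
    unfolding t_def[of a] by (simp add: E.l_distr) (simp add: t_def[of b] E.r_distr)
  also have "\<dots> = \<sigma> (p a \<otimes>\<^bsub>C\<^esub> p b) \<oplus>\<^bsub>E\<^esub> (\<kappa> (X.f (p a) (p b)) \<oplus>\<^bsub>E\<^esub> \<kappa> (ract A2 (r a) b) \<oplus>\<^bsub>E\<^esub> \<kappa> (lact A2 (s (p a)) (r b)))
      \<oplus>\<^bsub>E\<^esub> \<iota> (Y.f (\<phi>\<^sub>0 (p a)) (\<phi>\<^sub>0 (p b))) \<oplus>\<^bsub>E\<^esub> \<iota> (j' (defect_cochain [p a, p b]))"
    unfolding 1 2 3 by (simp add: defect_cochain_closed E.M.a_ac)
  also have "\<dots> = t (a \<otimes>\<^bsub>A1\<^esub> b) \<oplus>\<^bsub>E\<^esub> \<iota> (m defect_cochain a b)"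
    unfolding 4 by (simp add: t_def m_def defect_cochain_closed E.M.diff_simps)
  finally show ?thesis .
qed

text \<open>Associativity of \<open>E\<close> on \<open>t a\<close>, \<open>t b\<close>,
  \<open>t c\<close>, compared inside the image of \<iota>, is the cocycle identity for
  \<open>m\<close>. Taking \<open>a\<close>, \<open>b\<close>, \<open>c\<close> to be values of
  \<open>s\<close> reaches all triples in \<open>C\<close>, and \<open>m_coboundary\<close>
  translates.\<close>

lemma defect_cochain_H: "defect_cochain \<in> H"
  unfolding H_def
proof (intro CollectI conjI ballI defect_cochain_in)
  fix x y z assume xyz: "x \<in> carrier C" "y \<in> carrier C" "z \<in> carrier C"
  define a b c where "a = s x" "b = s y" "c = s z"
  note abc_def = this
  have [simp]: "a \<in> carrier A1" "b \<in> carrier A1" "c \<in> carrier A1" using xyz by (simp_all add: abc_def)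
  have p: "p a = x" "p b = y" "p c = z" using xyz by (simp_all add: abc_def)
  let ?m = "m defect_cochain"
  have 1: "(t a \<otimes>\<^bsub>E\<^esub> t b) \<otimes>\<^bsub>E\<^esub> t c = t (a \<otimes>\<^bsub>A1\<^esub> b \<otimes>\<^bsub>A1\<^esub> c) \<oplus>\<^bsub>E\<^esub> \<iota> (?m (a \<otimes>\<^bsub>A1\<^esub> b) c \<oplus>\<^bsub>A2'\<^esub> ract A2' (?m a b) (S c))"
    by (simp add: t_mult E.l_distr \<iota>_mult_left E.M.a_ac)
  have 2: "t a \<otimes>\<^bsub>E\<^esub> (t b \<otimes>\<^bsub>E\<^esub> t c) = t (a \<otimes>\<^bsub>A1\<^esub> b \<otimes>\<^bsub>A1\<^esub> c) \<oplus>\<^bsub>E\<^esub> \<iota> (?m a (b \<otimes>\<^bsub>A1\<^esub> c) \<oplus>\<^bsub>A2'\<^esub> lact A2' (S a) (?m b c))"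
    by (simp add: t_mult E.r_distr \<iota>_mult_right X.A1.m_assoc E.M.a_ac)
  have "t (a \<otimes>\<^bsub>A1\<^esub> b \<otimes>\<^bsub>A1\<^esub> c) \<oplus>\<^bsub>E\<^esub> \<iota> (?m (a \<otimes>\<^bsub>A1\<^esub> b) c \<oplus>\<^bsub>A2'\<^esub> ract A2' (?m a b) (S c)) =
      t (a \<otimes>\<^bsub>A1\<^esub> b \<otimes>\<^bsub>A1\<^esub> c) \<oplus>\<^bsub>E\<^esub> \<iota> (?m a (b \<otimes>\<^bsub>A1\<^esub> c) \<oplus>\<^bsub>A2'\<^esub> lact A2' (S a) (?m b c))"
    unfolding 1[symmetric] 2[symmetric] by (simp add: E.m_assoc)
  then have "\<iota> (?m (a \<otimes>\<^bsub>A1\<^esub> b) c \<oplus>\<^bsub>A2'\<^esub> ract A2' (?m a b) (S c)) = \<iota> (?m a (b \<otimes>\<^bsub>A1\<^esub> c) \<oplus>\<^bsub>A2'\<^esub> lact A2' (S a) (?m b c))"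
    by (subst (asm) E.M.add_left_cancel) simp_all
  then have "?m (a \<otimes>\<^bsub>A1\<^esub> b) c \<oplus>\<^bsub>A2'\<^esub> ract A2' (?m a b) (S c) = ?m a (b \<otimes>\<^bsub>A1\<^esub> c) \<oplus>\<^bsub>A2'\<^esub> lact A2' (S a) (?m b c)"
    by (rule \<iota>_eqD) simp_all
  then have "lact A2' (S a) (?m b c) \<ominus>\<^bsub>A2'\<^esub> ?m (a \<otimes>\<^bsub>A1\<^esub> b) c \<oplus>\<^bsub>A2'\<^esub> ?m a (b \<otimes>\<^bsub>A1\<^esub> c) \<ominus>\<^bsub>A2'\<^esub> ract A2' (?m a b) (S c) = \<zero>\<^bsub>A2'\<^esub>"
    by (simp add: Y.A2.M.diff_simps)
  then have 3: "j' (hoch_d C P 2 defect_cochain [x, y, z] \<oplus>\<^bsub>B'\<^esub> \<epsilon>' [\<phi>\<^sub>0 x, \<phi>\<^sub>0 y, \<phi>\<^sub>0 z] \<ominus>\<^bsub>B'\<^esub> \<phi> (\<epsilon> [x, y, z])) = j' \<zero>\<^bsub>B'\<^esub>"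
    using m_coboundary[OF defect_cochain_in, of a b c] p by simp
  have e: "\<epsilon> [x, y, z] \<in> carrier B" "\<epsilon>' [\<phi>\<^sub>0 x, \<phi>\<^sub>0 y, \<phi>\<^sub>0 z] \<in> carrier B'"
      "hoch_d C P 2 defect_cochain [x, y, z] \<in> carrier B'"
    using \<epsilon> \<epsilon>' P.hoch_d2_closed[OF defect_cochain_in xyz] xyz by (auto simp: PiE_def)
  have "hoch_d C P 2 defect_cochain [x, y, z] \<oplus>\<^bsub>B'\<^esub> \<epsilon>' [\<phi>\<^sub>0 x, \<phi>\<^sub>0 y, \<phi>\<^sub>0 z] \<ominus>\<^bsub>B'\<^esub> \<phi> (\<epsilon> [x, y, z]) = \<zero>\<^bsub>B'\<^esub>"
    by (rule Y.j_eqD[OF 3]) (use e in simp_all)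
  then show "\<phi> (\<epsilon> [x, y, z]) = hoch_d C P 2 defect_cochain [x, y, z] \<oplus>\<^bsub>B'\<^esub> \<epsilon>' [\<phi>\<^sub>0 x, \<phi>\<^sub>0 y, \<phi>\<^sub>0 z]"
    using e by (simp add: Y.B.M.diff_eq_eq)
qed

text \<open>As a vector space \<open>E\<close> is the direct sum of \<open>t A1\<close> and
  \<open>\<iota> A2'\<close>; by \<open>t_mult\<close> its product in these coordinates is
  \<open>model_mult\<close>.\<close>

lemma model_iso: "butterfly_iso K X X' (model defect_cochain) F"
proof -
  interpret M: butterfly_data K X s r X' s' r' S "m defect_cochain" k
    by (rule butterfly_data_H[OF defect_cochain_H])
  interpret MF: butterfly_pair K X s r X' s' r' "model defect_cochain" F
    by (rule butterfly_pairI[OF model_butterfly[OF defect_cochain_H] butterfly])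
  show ?thesis
  proof (rule MF.butterfly_isoI[where \<alpha> = "\<lambda>e. t (fst e) \<oplus>\<^bsub>E\<^esub> \<iota> (snd e)"])
    show "lin_map K MF.F.E E (\<lambda>e. t (fst e) \<oplus>\<^bsub>E\<^esub> \<iota> (snd e))"
      by unfold_locales (auto intro!: linear_mapsI simp: E.smult_r_distr E.M.a_ac)
  next
    fix e e' assume "e \<in> carrier MF.F.E" "e' \<in> carrier MF.F.E"
    then obtain a x b y where e: "e = (a, x)" "e' = (b, y)" and [simp]: "a \<in> carrier A1" "b \<in> carrier A1"
        "x \<in> carrier A2'" "y \<in> carrier A2'" by auto
    show "t (fst (e \<otimes>\<^bsub>MF.F.E\<^esub> e')) \<oplus>\<^bsub>E\<^esub> \<iota> (snd (e \<otimes>\<^bsub>MF.F.E\<^esub> e')) =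
        (t (fst e) \<oplus>\<^bsub>E\<^esub> \<iota> (snd e)) \<otimes>\<^bsub>E\<^esub> (t (fst e') \<oplus>\<^bsub>E\<^esub> \<iota> (snd e'))"
      by (simp add: e M.model_mult_def M.Gamma_def E.l_distr E.r_distr t_mult \<iota>_mult_left \<iota>_mult_right
          Y.peiffer[symmetric] Y.A2.act_expand E.M.a_ac)
  qed (auto simp: \<kappa>_t M.Gamma_def)
qed

end

lemma (in butterfly_over_on) ex_model: "\<exists>h\<in>H. butterfly_iso K X X' F (model h)"
proof -
  obtain \<sigma> where \<sigma>: "lin_map K C E \<sigma>" "\<forall>c\<in>carrier C. \<delta> (\<sigma> c) = s c \<and> \<gamma> (\<sigma> c) = s' (\<phi>\<^sub>0 c)"
    using ex_compatible_section by blast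
  interpret \<sigma>: butterfly_section K X s r X' s' r' \<phi>\<^sub>0 \<phi> \<epsilon> \<epsilon>' F \<sigma>
    by (rule butterfly_section.intro[OF butterfly_over_on_axioms butterfly_section_axioms.intro])
      (use \<sigma> in simp_all)
  have "butterfly_iso K X X' F (model \<sigma>.defect_cochain)"
    by (rule butterfly_iso_sym[OF model_butterfly[OF \<sigma>.defect_cochain_H] butterfly \<sigma>.model_iso])
  then show ?thesis using \<sigma>.defect_cochain_H by blast
qed

section \<open>Classification of butterflies\<close>

context biext_morphism
begin

lemma \<phi>_closed: "\<phi> \<in> carrier B \<rightarrow> carrier B'" by auto

lemma butterfly_over_model:
  assumes "F \<in> butterflies_over K X X' \<phi>\<^sub>0 \<phi>"
  obtains h where "h \<in> H" "butterfly K X X' F" "butterfly_iso K X X' F (model h)"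
proof -
  have F: "butterfly K X X' F" "butterfly_over X X' F \<phi>\<^sub>0 \<phi>"
    using assms by (simp_all add: butterflies_over_def)
  interpret F: butterfly_over_on K X s r X' s' r' \<phi>\<^sub>0 \<phi> \<epsilon> \<epsilon>' F
    by (intro butterfly_over_on.intro biext_morphism_axioms butterfly_onI F butterfly_over_on_axioms.intro)
  show thesis using that F(1) F.ex_model by blast
qed

lemma iso_model_over:
  assumes F: "butterfly K X X' F" "butterfly_iso K X X' F (model h)" and h: "h \<in> H"
  shows "F \<in> butterflies_over K X X' \<phi>\<^sub>0 \<phi>"
  using butterfly_over_iso[OF model_butterfly[OF h] F(1)
      butterfly_iso_sym[OF F(1) model_butterfly[OF h] F(2)] model_over[OF h] \<phi>_closed] F(1)
  by (simp add: butterflies_over_def)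

text \<open>A butterfly on any carrier provides its defect cochain; in the other direction
  \<open>u\<close> makes room in the prescribed type for a copy of a model.\<close>

lemma ex_butterfly_iff:
  fixes u :: "'a1 \<times> 'x2 \<Rightarrow> 'e"
  assumes u: "inj_on u (carrier A1 \<times> carrier A2')"
  shows "(\<exists>F :: ('k, 'a2, 'a1, 'x2, 'x1, 'e) bfly. F \<in> butterflies_over K X X' \<phi>\<^sub>0 \<phi>) \<longleftrightarrow> H \<noteq> {}"
proof
  assume "\<exists>F :: ('k, 'a2, 'a1, 'x2, 'x1, 'e) bfly. F \<in> butterflies_over K X X' \<phi>\<^sub>0 \<phi>"
  then show "H \<noteq> {}" using butterfly_over_model by blast
next
  assume "H \<noteq> {}"
  then obtain h where h: "h \<in> H" by blast
  interpret M: butterfly_data K X s r X' s' r' S "m h" k by (rule butterfly_data_H[OF h])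
  have "inj_on u (carrier (bf_E (model h)))" using u by simp
  then obtain F :: "('k, 'a2, 'a1, 'x2, 'x1, 'e) bfly" where
    "butterfly K X X' F" "butterfly_iso K X X' F (model h)"
    using butterfly_copy[OF model_butterfly[OF h]] by blast
  then show "\<exists>F :: ('k, 'a2, 'a1, 'x2, 'x1, 'e) bfly. F \<in> butterflies_over K X X' \<phi>\<^sub>0 \<phi>"
    using iso_model_over h by blast
qed

lemma hoch_class_eq_iff:
  "hoch_class K C P 3 (push_cochain C 3 \<phi> \<epsilon>) = hoch_class K C P 3 (pull_cochain C 3 \<phi>\<^sub>0 \<epsilon>') \<longleftrightarrow> H \<noteq> {}"
proof -
  have u: "push_cochain C 3 \<phi> \<epsilon> \<in> tuples C 3 \<rightarrow>\<^sub>E carrier P"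
    using \<epsilon> by (auto simp: push_cochain_def PiE_def)
  have "map \<phi>\<^sub>0 cs \<in> tuples C' 3" if "cs \<in> tuples C 3" for cs
    using that by (auto simp: tuples_def)
  then have v: "pull_cochain C 3 \<phi>\<^sub>0 \<epsilon>' \<in> tuples C 3 \<rightarrow>\<^sub>E carrier P"
    using \<epsilon>' by (auto simp: pull_cochain_def PiE_def)
  have "hoch_class K C P 3 (push_cochain C 3 \<phi> \<epsilon>) = hoch_class K C P 3 (pull_cochain C 3 \<phi>\<^sub>0 \<epsilon>') \<longleftrightarrow>
      (\<exists>g\<in>hoch_cochains K C P 2. \<forall>a\<in>carrier C. \<forall>b\<in>carrier C. \<forall>c\<in>carrier C.
        push_cochain C 3 \<phi> \<epsilon> [a, b, c] = hoch_d C P 2 g [a, b, c] \<oplus>\<^bsub>P\<^esub> pull_cochain C 3 \<phi>\<^sub>0 \<epsilon>' [a, b, c])"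
    by (rule P.hoch_class3_eq_iff[OF u v])
  moreover have "H = {g \<in> hoch_cochains K C P 2. \<forall>a\<in>carrier C. \<forall>b\<in>carrier C. \<forall>c\<in>carrier C.
        push_cochain C 3 \<phi> \<epsilon> [a, b, c] = hoch_d C P 2 g [a, b, c] \<oplus>\<^bsub>P\<^esub> pull_cochain C 3 \<phi>\<^sub>0 \<epsilon>' [a, b, c]}"
    by (simp add: H_def push_cochain_def pull_cochain_def)
  ultimately show ?thesis by blast
qed

lemma equiv_butterfly_iso_rel: "equiv {F. butterfly K X X' F} (butterfly_iso_rel K X X')"
proof (rule equivI)
  show "butterfly_iso_rel K X X' \<subseteq> {F. butterfly K X X' F} \<times> {F. butterfly K X X' F}"
    by (auto simp: butterfly_iso_rel_def)
  show "refl_on {F. butterfly K X X' F} (butterfly_iso_rel K X X')"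
    by (auto simp: butterfly_iso_rel_def butterfly_iso_refl intro!: refl_onI)
  show "sym (butterfly_iso_rel K X X')"
    by (rule symI) (auto simp: butterfly_iso_rel_def intro: butterfly_iso_sym)
  show "trans (butterfly_iso_rel K X X')"
    by (rule transI) (auto simp: butterfly_iso_rel_def intro: butterfly_iso_trans)
qed

text \<open>Reduces questions about isomorphism of twisted butterflies to arithmetic of cochains:
  \<open>F\<close> and \<open>F'\<close> are replaced by models, and twisting by addition of
  \<open>g\<close>.\<close>

lemma twist_butterfly_rel:
  assumes h: "h \<in> H" and F: "butterfly K X X' F" "butterfly_iso K X X' F (model h)"
    and g: "g \<in> hoch_cocycles K C P 2"
    and h': "h' \<in> H" and F': "butterfly K X X' F'" "butterfly_iso K X X' F' (model h')"
  shows "(twist_butterfly X X' g F, F') \<in> butterfly_iso_rel K X X' \<longleftrightarrow>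
    (\<exists>f\<in>hoch_cochains K C P 1.
      h' = (\<lambda>cs\<in>tuples C 2. (\<lambda>cs\<in>tuples C 2. h cs \<oplus>\<^bsub>B'\<^esub> g cs) cs \<oplus>\<^bsub>B'\<^esub> hoch_d C P 1 f cs))"
proof -
  let ?hg = "\<lambda>cs\<in>tuples C 2. h cs \<oplus>\<^bsub>B'\<^esub> g cs"
  have hg: "?hg \<in> H" by (rule H_add[OF h g])
  note T = twist_iso_model[OF F h g]
  have "(twist_butterfly X X' g F, F') \<in> butterfly_iso_rel K X X' \<longleftrightarrow>
      butterfly_iso K X X' (twist_butterfly X X' g F) F'"
    using T F' by (simp add: butterfly_iso_rel_def)
  also have "\<dots> \<longleftrightarrow> butterfly_iso K X X' (model ?hg) (model h')"
    by (rule iffI)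
      (rule butterfly_iso_trans[OF butterfly_iso_sym[OF T(1) model_butterfly[OF hg] T(2)]
          butterfly_iso_trans[OF _ F'(2)]], assumption,
       rule butterfly_iso_trans[OF T(2) butterfly_iso_trans[OF _
          butterfly_iso_sym[OF F'(1) model_butterfly[OF h'] F'(2)]]])
  finally show ?thesis unfolding model_iso_iff[OF hg h'] .
qed

text \<open>Every butterfly involved is compared with some \<open>model h\<close>; twisting it by
  \<open>g\<close> leads to \<open>model (h + g)\<close>. Each hypothesis of the abstract quotient
  lemma thus becomes a property of addition in \<open>H\<close>, the stabilizer being the group of
  coboundaries.\<close>

lemma simply_transitive_action_butterfly_classes:
  "\<exists>\<psi>. simply_transitive_action (hochschild_cohomology K C P 2)
      (butterfly_classes K X X' \<phi>\<^sub>0 \<phi> :: ('k, 'a2, 'a1, 'x2, 'x1, 'e) bfly set set) \<psi> \<and>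
    (\<forall>g\<in>hoch_cocycles K C P 2. \<forall>F\<in>(butterflies_over K X X' \<phi>\<^sub>0 \<phi> :: ('k, 'a2, 'a1, 'x2, 'x1, 'e) bfly set).
      \<psi> (hoch_class K C P 2 g) (butterfly_iso_rel K X X' `` {F}) =
      butterfly_iso_rel K X X' `` {twist_butterfly X X' g F})"
proof -
  let ?G = "hoch_cocycle_group K C P 2"
  let ?R = "butterfly_iso_rel K X X' :: ('k, 'a2, 'a1, 'x2, 'x1, 'e) bfly rel"
  have carrier: "carrier ?G = hoch_cocycles K C P 2" by (simp add: hoch_cocycle_group_def)
  have "\<exists>\<psi>. simply_transitive_action (?G Mod hoch_coboundaries K C P 2) (butterflies_over K X X' \<phi>\<^sub>0 \<phi> // ?R) \<psi> \<and>
    (\<forall>g\<in>carrier ?G. \<forall>F\<in>butterflies_over K X X' \<phi>\<^sub>0 \<phi>.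
      \<psi> (hoch_coboundaries K C P 2 #>\<^bsub>?G\<^esub> g) (?R `` {F}) = ?R `` {twist_butterfly X X' g F})"
  proof (rule simply_transitive_quotient_action[OF P.normal_coboundaries equiv_butterfly_iso_rel], unfold carrier)
    show "butterflies_over K X X' \<phi>\<^sub>0 \<phi> \<subseteq> {F. butterfly K X X' F}"
      by (auto simp: butterflies_over_def)
  next
    fix g and F :: "('k, 'a2, 'a1, 'x2, 'x1, 'e) bfly"
    assume g: "g \<in> hoch_cocycles K C P 2" and "F \<in> butterflies_over K X X' \<phi>\<^sub>0 \<phi>"
    then obtain h where h: "h \<in> H" "butterfly K X X' F" "butterfly_iso K X X' F (model h)"
      using butterfly_over_model by blast
    note T = twist_iso_model[OF h(2,3,1) g]
    show "twist_butterfly X X' g F \<in> butterflies_over K X X' \<phi>\<^sub>0 \<phi>"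
      by (rule iso_model_over[OF T H_add[OF h(1) g]])
    have gc: "g \<in> hoch_cochains K C P 2" by (rule P.cocycle2_cochain[OF g])
    \<comment> \<open>The stabilizer condition: adding \<open>g\<close> and then the coboundary of
      \<open>f\<close> restores \<open>h\<close> exactly when \<open>g\<close> is minus that
      coboundary.\<close>
    have eq: "h = (\<lambda>cs\<in>tuples C 2. (\<lambda>cs\<in>tuples C 2. h cs \<oplus>\<^bsub>B'\<^esub> g cs) cs \<oplus>\<^bsub>B'\<^esub> hoch_d C P 1 f cs) \<longleftrightarrow>
        g = (\<lambda>cs\<in>tuples C 2. \<ominus>\<^bsub>B'\<^esub> hoch_d C P 1 f cs)" if f: "f \<in> hoch_cochains K C P 1" for f
    proof -
      have df: "hoch_d C P 1 f \<in> hoch_cochains K C P 2" by (rule P.hoch_d1_cochain[OF f])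
      have cl: "h cs \<in> carrier B'" "g cs \<in> carrier B'" "hoch_d C P 1 f cs \<in> carrier B'" if "cs \<in> tuples C 2" for cs
        using P.cochain2_closed[OF H_cochain[OF h(1)] that] P.cochain2_closed[OF gc that] P.cochain2_closed[OF df that]
        by simp_all
      have ext: "h = (\<lambda>cs\<in>tuples C 2. h' cs) \<longleftrightarrow> (\<forall>cs\<in>tuples C 2. h cs = h' cs)"
        if "h \<in> extensional (tuples C 2)" for h h' :: "'c list \<Rightarrow> 'y"
        using that by (auto intro: extensionalityI)
      have "h cs = h cs \<oplus>\<^bsub>B'\<^esub> g cs \<oplus>\<^bsub>B'\<^esub> hoch_d C P 1 f cs \<longleftrightarrow> g cs = \<ominus>\<^bsub>B'\<^esub> hoch_d C P 1 f cs"
        if "cs \<in> tuples C 2" for cs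
        using cl[OF that] by (simp add: Y.B.M.a_assoc Y.B.M.eq_neg_iff del: One_nat_def)
      then show ?thesis
        using H_cochain[OF h(1)] gc by (simp add: ext P.cochain2_iff del: One_nat_def)
    qed
    have "(twist_butterfly X X' g F, F) \<in> ?R \<longleftrightarrow>
        (\<exists>f\<in>hoch_cochains K C P 1. g = (\<lambda>cs\<in>tuples C 2. \<ominus>\<^bsub>P\<^esub> hoch_d C P 1 f cs))"
      using twist_butterfly_rel[OF h g h] eq by (simp cong: bex_cong del: One_nat_def)
    also have "\<dots> \<longleftrightarrow> g \<in> hoch_coboundaries K C P 2"
    proof
      assume "\<exists>f\<in>hoch_cochains K C P 1. g = (\<lambda>cs\<in>tuples C 2. \<ominus>\<^bsub>P\<^esub> hoch_d C P 1 f cs)"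
      then show "g \<in> hoch_coboundaries K C P 2" using P.hoch_d1_neg by blast
    next
      assume "g \<in> hoch_coboundaries K C P 2"
      then obtain f where f: "f \<in> hoch_cochains K C P 1" "g = hoch_d C P 1 f" unfolding P.coboundary2_iff by blast
      \<comment> \<open>Coboundaries are closed under negation; passing to \<open>f'\<close> absorbs
        the sign in the stabilizer condition.\<close>
      then obtain f' where f': "f' \<in> hoch_cochains K C P 1" "(\<lambda>cs\<in>tuples C 2. \<ominus>\<^bsub>P\<^esub> hoch_d C P 1 f cs) = hoch_d C P 1 f'"
        using P.hoch_d1_neg[OF f(1)] unfolding P.coboundary2_iff by blast
      have "g = (\<lambda>cs\<in>tuples C 2. \<ominus>\<^bsub>P\<^esub> hoch_d C P 1 f' cs)"
        unfolding f'(2)[symmetric] f(2)[symmetric]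
        by (rule P.cochain2_eqI[OF gc P.cochain2_neg[OF P.cochain2_neg[OF gc]]])
          (use P.cochain2_closed[OF gc] in simp)
      with f'(1) show "\<exists>f\<in>hoch_cochains K C P 1. g = (\<lambda>cs\<in>tuples C 2. \<ominus>\<^bsub>P\<^esub> hoch_d C P 1 f cs)" by blast
    qed
    finally show "(twist_butterfly X X' g F, F) \<in> ?R \<longleftrightarrow> g \<in> hoch_coboundaries K C P 2" .
  next
    fix g and F F' :: "('k, 'a2, 'a1, 'x2, 'x1, 'e) bfly"
    assume g: "g \<in> hoch_cocycles K C P 2" and F: "F \<in> butterflies_over K X X' \<phi>\<^sub>0 \<phi>"
      and F': "F' \<in> butterflies_over K X X' \<phi>\<^sub>0 \<phi>" and R: "(F, F') \<in> ?R"
    obtain h where h: "h \<in> H" "butterfly K X X' F'" "butterfly_iso K X X' F' (model h)"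
      using F' by (rule butterfly_over_model)
    have F: "butterfly K X X' F" "butterfly_iso K X X' F (model h)"
      using R h(3) butterfly_iso_trans by (auto simp: butterfly_iso_rel_def)
    note T = twist_iso_model[OF F h(1) g] and T' = twist_iso_model[OF h(2,3,1) g]
    show "(twist_butterfly X X' g F, twist_butterfly X X' g F') \<in> ?R"
      unfolding butterfly_iso_rel_def
      using T T' butterfly_iso_trans[OF T(2) butterfly_iso_sym[OF T'(1) model_butterfly[OF H_add[OF h(1) g]] T'(2)]]
      by simp
  next
    fix g g' and F :: "('k, 'a2, 'a1, 'x2, 'x1, 'e) bfly"
    assume g: "g \<in> hoch_cocycles K C P 2" "g' \<in> hoch_cocycles K C P 2" and "F \<in> butterflies_over K X X' \<phi>\<^sub>0 \<phi>"
    then obtain h where h: "h \<in> H" "butterfly K X X' F" "butterfly_iso K X X' F (model h)"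
      using butterfly_over_model by blast
    let ?gg = "g \<otimes>\<^bsub>?G\<^esub> g'"
    interpret G: comm_group ?G by (rule P.comm_group_cocycles)
    have gg: "?gg \<in> hoch_cocycles K C P 2" using G.m_closed g by (simp add: carrier)
    have cl: "x cs \<in> carrier B'" if "x \<in> hoch_cochains K C P 2" "cs \<in> tuples C 2" for x cs
      using P.cochain2_closed[OF that] by simp
    \<comment> \<open>Twisting by \<open>g'\<close> and then by \<open>g\<close> adds the same
      cochain as twisting by their product, because addition in \<open>B'\<close> is commutative and
      associative.\<close>
    have eq: "(\<lambda>cs\<in>tuples C 2. h cs \<oplus>\<^bsub>B'\<^esub> ?gg cs) =
        (\<lambda>cs\<in>tuples C 2. (\<lambda>cs\<in>tuples C 2. h cs \<oplus>\<^bsub>B'\<^esub> g' cs) cs \<oplus>\<^bsub>B'\<^esub> g cs)"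
      using cl H_cochain[OF h(1)] P.cocycle2_cochain[OF g(1)] P.cocycle2_cochain[OF g(2)]
      by (intro restrict_ext) (simp add: hoch_cocycle_group_def Y.B.M.a_ac)
    note T1 = twist_iso_model[OF h(2,3,1) g(2)]
    note T2 = twist_iso_model[OF T1 H_add[OF h(1) g(2)] g(1)]
    note T = twist_iso_model[OF h(2,3,1) gg, unfolded eq]
    show "(twist_butterfly X X' ?gg F, twist_butterfly X X' g (twist_butterfly X X' g' F)) \<in> ?R"
      unfolding butterfly_iso_rel_def
      using T T2 butterfly_iso_trans[OF T(2) butterfly_iso_sym[OF T2(1) model_butterfly[OF H_add[OF H_add[OF h(1) g(2)] g(1)]] T2(2)]]
      by simp
  next
    fix F F' :: "('k, 'a2, 'a1, 'x2, 'x1, 'e) bfly"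
    assume F: "F \<in> butterflies_over K X X' \<phi>\<^sub>0 \<phi>" and F': "F' \<in> butterflies_over K X X' \<phi>\<^sub>0 \<phi>"
    obtain h where h: "h \<in> H" "butterfly K X X' F" "butterfly_iso K X X' F (model h)"
      using F by (rule butterfly_over_model)
    obtain h' where h': "h' \<in> H" "butterfly K X X' F'" "butterfly_iso K X X' F' (model h')"
      using F' by (rule butterfly_over_model)
    obtain g where g: "g \<in> hoch_cocycles K C P 2" "h' = (\<lambda>cs\<in>tuples C 2. h cs \<oplus>\<^bsub>B'\<^esub> g cs)"
      using H_diff[OF h(1) h'(1)] by blast
    note T = twist_iso_model[OF h(2,3,1) g(1), folded g(2)]
    have "(twist_butterfly X X' g F, F') \<in> ?R"
      unfolding butterfly_iso_rel_def
      using T h' butterfly_iso_trans[OF T(2) butterfly_iso_sym[OF h'(2) model_butterfly[OF h'(1)] h'(3)]]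
      by simp
    with g(1) show "\<exists>g\<in>hoch_cocycles K C P 2. (twist_butterfly X X' g F, F') \<in> ?R" by blast
  qed
  then show ?thesis
    unfolding hochschild_cohomology_def butterfly_classes_def hoch_class_def carrier .
qed

end

text \<open>Extracts the splittings hidden in \<open>associated_cocycle\<close> in the form required
  by \<open>biext\<close>, with the given \<epsilon> as their obstruction.\<close>

lemma associated_cocycle_biext:
  assumes K: "field K" and X: "crossed_biextension K X" and \<epsilon>: "associated_cocycle K X \<epsilon>"
  shows "\<exists>s r. biext K X s r \<and> (\<forall>a\<in>carrier (bx_C X). \<forall>b\<in>carrier (bx_C X). \<forall>c\<in>carrier (bx_C X).
      bx_j X (\<epsilon> [a, b, c]) = biext.obstruction X s r a b c)"
proof -
  let ?A1 = "bx_A1 X" and ?A2 = "bx_A2 X" and ?C = "bx_C X" and ?p = "bx_p X" and ?d = "bx_d X"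
  interpret A1: assoc_algebra K ?A1
    using X by (simp add: crossed_biextension_def crossed_bimodule_def)
  interpret C: assoc_algebra K ?C
    using X by (simp add: crossed_biextension_def)
  from X have p_hom: "?p \<in> algebra_homs K ?A1 ?C"
    and im: "?d ` carrier ?A2 = {a \<in> carrier ?A1. ?p a = \<zero>\<^bsub>?C\<^esub>}"
    by (simp_all add: crossed_biextension_def)
  interpret p: lin_map K ?A1 ?C ?p
  proof unfold_locales
    show "?p \<in> linear_maps K ?A1 ?C" using p_hom unfolding algebra_homs_def by (rule IntD2)
  qed
  from \<epsilon> obtain s q where s: "s \<in> linear_maps K ?C ?A1" "\<forall>c\<in>carrier ?C. ?p (s c) = c"
    and q: "q \<in> linear_maps K (?A1\<lparr>carrier := ?d ` carrier ?A2\<rparr>) ?A2"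
      "\<forall>y\<in>?d ` carrier ?A2. ?d (q y) = y"
    and e: "\<forall>c\<in>carrier ?C. \<forall>c'\<in>carrier ?C. \<forall>c''\<in>carrier ?C.
           bx_j X (\<epsilon> [c, c', c'']) =
             lact ?A2 (s c) (q (s c' \<otimes>\<^bsub>?A1\<^esub> s c'' \<ominus>\<^bsub>?A1\<^esub> s (c' \<otimes>\<^bsub>?C\<^esub> c'')))
             \<ominus>\<^bsub>?A2\<^esub> q (s (c \<otimes>\<^bsub>?C\<^esub> c') \<otimes>\<^bsub>?A1\<^esub> s c'' \<ominus>\<^bsub>?A1\<^esub> s (c \<otimes>\<^bsub>?C\<^esub> c' \<otimes>\<^bsub>?C\<^esub> c''))
             \<oplus>\<^bsub>?A2\<^esub> q (s c \<otimes>\<^bsub>?A1\<^esub> s (c' \<otimes>\<^bsub>?C\<^esub> c'') \<ominus>\<^bsub>?A1\<^esub> s (c \<otimes>\<^bsub>?C\<^esub> (c' \<otimes>\<^bsub>?C\<^esub> c'')))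
             \<ominus>\<^bsub>?A2\<^esub> ract ?A2 (q (s c \<otimes>\<^bsub>?A1\<^esub> s c' \<ominus>\<^bsub>?A1\<^esub> s (c \<otimes>\<^bsub>?C\<^esub> c'))) (s c'')"
    using \<epsilon>[unfolded associated_cocycle_def Let_def, THEN conjunct2] by (elim exE conjE) (rule that)
  interpret s: lin_map K ?C ?A1 s by unfold_locales (rule s(1))
  note [simp] = s(2)[rule_format]
  \<comment> \<open>\<open>q\<close> is defined on the image of \<open>d\<close>, which is the
    kernel of \<open>p\<close>; the argument is the component of \<open>a\<close> in this
    kernel.\<close>
  define r where "r a = q (a \<ominus>\<^bsub>?A1\<^esub> s (?p a))" for a
  have mem: "a \<ominus>\<^bsub>?A1\<^esub> s (?p a) \<in> ?d ` carrier ?A2" if "a \<in> carrier ?A1" for a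
    unfolding im using that by simp
  have q_closed: "q y \<in> carrier ?A2" if "y \<in> ?d ` carrier ?A2" for y
    using q(1) that by (auto simp: linear_maps_def)
  have q_add: "q (y \<oplus>\<^bsub>?A1\<^esub> z) = q y \<oplus>\<^bsub>?A2\<^esub> q z"
    if "y \<in> ?d ` carrier ?A2" "z \<in> ?d ` carrier ?A2" for y z
    using q(1) that by (auto simp: linear_maps_def)
  have q_smult: "q (t \<odot>\<^bsub>?A1\<^esub> y) = t \<odot>\<^bsub>?A2\<^esub> q y" if "t \<in> carrier K" "y \<in> ?d ` carrier ?A2" for t y
    using q(1) that by (auto simp: linear_maps_def)
  have r_lin: "r \<in> linear_maps K ?A1 ?A2"
  proof (rule linear_mapsI)
    fix a assume "a \<in> carrier ?A1"
    then show "r a \<in> carrier ?A2" unfolding r_def by (intro q_closed mem)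
  next
    fix a b assume ab: "a \<in> carrier ?A1" "b \<in> carrier ?A1"
    then have "a \<oplus>\<^bsub>?A1\<^esub> b \<ominus>\<^bsub>?A1\<^esub> s (?p (a \<oplus>\<^bsub>?A1\<^esub> b)) = (a \<ominus>\<^bsub>?A1\<^esub> s (?p a)) \<oplus>\<^bsub>?A1\<^esub> (b \<ominus>\<^bsub>?A1\<^esub> s (?p b))"
      by (simp add: A1.M.diff_simps)
    then show "r (a \<oplus>\<^bsub>?A1\<^esub> b) = r a \<oplus>\<^bsub>?A2\<^esub> r b"
      unfolding r_def using q_add[OF mem[OF ab(1)] mem[OF ab(2)]] by simp
  next
    fix t a assume ta: "t \<in> carrier K" "a \<in> carrier ?A1"
    then have "t \<odot>\<^bsub>?A1\<^esub> a \<ominus>\<^bsub>?A1\<^esub> s (?p (t \<odot>\<^bsub>?A1\<^esub> a)) = t \<odot>\<^bsub>?A1\<^esub> (a \<ominus>\<^bsub>?A1\<^esub> s (?p a))"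
      by (simp add: A1.smult_diff)
    then show "r (t \<odot>\<^bsub>?A1\<^esub> a) = t \<odot>\<^bsub>?A2\<^esub> r a"
      unfolding r_def using q_smult[OF ta(1) mem[OF ta(2)]] by simp
  qed
  have biext: "biext K X s r"
    by (rule biext.intro[OF K X s(1) _ r_lin]) (simp_all add: r_def q(2)[rule_format, OF mem])
  then interpret biext K X s r .
  have f_eq: "q (s c \<otimes>\<^bsub>?A1\<^esub> s c' \<ominus>\<^bsub>?A1\<^esub> s (c \<otimes>\<^bsub>?C\<^esub> c')) = f c c'"
    if "c \<in> carrier ?C" "c' \<in> carrier ?C" for c c'
    using that by (simp add: f_def r_def)
  show ?thesis
    by (intro exI conjI, rule biext) (simp add: obstruction_def e f_eq)
qed

theorem theorem7p3:
  fixes K :: "('k, 'r) ring_scheme"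
    and X :: "('k, 'b, 'a2, 'a1, 'c) biext"
    and X' :: "('k, 'y, 'x2, 'x1, 'd) biext"
    and \<phi>\<^sub>0 :: "'c \<Rightarrow> 'd" and \<phi> :: "'b \<Rightarrow> 'y"
    and \<epsilon> :: "'c list \<Rightarrow> 'b" and \<epsilon>' :: "'d list \<Rightarrow> 'y"
    and u :: "'a1 \<times> 'x2 \<Rightarrow> 'e"
  assumes "field K"
    and "crossed_biextension K X" and "crossed_biextension K X'"
    and "associated_cocycle K X \<epsilon>" and "associated_cocycle K X' \<epsilon>'"
    and "bimodule_morphism K (bx_C X) (bx_bimodule X) (bx_C X') (bx_bimodule X') \<phi>\<^sub>0 \<phi>"
    \<comment> \<open>The type \<open>'e\<close> carrying the algebras \<open>E\<close> is arbitrary, but large enough: the vector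
       space underlying \<open>E\<close> is always isomorphic to the direct sum of \<open>A1\<close> and \<open>A2'\<close>.\<close>
    and "inj_on u (carrier (bx_A1 X) \<times> carrier (bx_A2 X'))"
  shows
    "((\<exists>F :: ('k, 'a2, 'a1, 'x2, 'x1, 'e) bfly.
         butterfly K X X' F \<and> butterfly_over X X' F \<phi>\<^sub>0 \<phi>) \<longleftrightarrow>
      hoch_class K (bx_C X) (pullback_bimodule \<phi>\<^sub>0 (bx_bimodule X')) 3
        (push_cochain (bx_C X) 3 \<phi> \<epsilon>) =
      hoch_class K (bx_C X) (pullback_bimodule \<phi>\<^sub>0 (bx_bimodule X')) 3
        (pull_cochain (bx_C X) 3 \<phi>\<^sub>0 \<epsilon>'))
     \<and>
     ((butterfly_classes K X X' \<phi>\<^sub>0 \<phi> :: ('k, 'a2, 'a1, 'x2, 'x1, 'e) bfly set set) \<noteq> {} \<longrightarrow>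
      (\<exists>\<psi>. simply_transitive_action
             (hochschild_cohomology K (bx_C X) (pullback_bimodule \<phi>\<^sub>0 (bx_bimodule X')) 2)
             (butterfly_classes K X X' \<phi>\<^sub>0 \<phi> :: ('k, 'a2, 'a1, 'x2, 'x1, 'e) bfly set set) \<psi> \<and>
           \<comment> \<open>the action is the natural one, not merely some action\<close>
           (\<forall>g\<in>hoch_cocycles K (bx_C X) (pullback_bimodule \<phi>\<^sub>0 (bx_bimodule X')) 2.
            \<forall>F\<in>(butterflies_over K X X' \<phi>\<^sub>0 \<phi> :: ('k, 'a2, 'a1, 'x2, 'x1, 'e) bfly set).
              \<psi> (hoch_class K (bx_C X) (pullback_bimodule \<phi>\<^sub>0 (bx_bimodule X')) 2 g)
                (butterfly_iso_rel K X X' `` {F}) =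
              butterfly_iso_rel K X X' `` {twist_butterfly X X' g F})))"
proof -
  \<comment> \<open>These are splittings from which \<epsilon> itself was built, so \<epsilon>
    equals their obstruction on the nose and not merely up to a coboundary.\<close>
  obtain s r where s: "biext K X s r"
    "\<forall>a\<in>carrier (bx_C X). \<forall>b\<in>carrier (bx_C X). \<forall>c\<in>carrier (bx_C X).
      bx_j X (\<epsilon> [a, b, c]) = biext.obstruction X s r a b c"
    using associated_cocycle_biext[OF assms(1,2,4)] by (elim exE conjE)
  obtain s' r' where s': "biext K X' s' r'"
    "\<forall>a\<in>carrier (bx_C X'). \<forall>b\<in>carrier (bx_C X'). \<forall>c\<in>carrier (bx_C X').
      bx_j X' (\<epsilon>' [a, b, c]) = biext.obstruction X' s' r' a b c"
    using associated_cocycle_biext[OF assms(1,3,5)] by (elim exE conjE)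
  have "\<epsilon> \<in> tuples (bx_C X) 3 \<rightarrow>\<^sub>E carrier (bx_B X)" "\<epsilon>' \<in> tuples (bx_C X') 3 \<rightarrow>\<^sub>E carrier (bx_B X')"
    by (rule assms(4)[unfolded associated_cocycle_def, THEN conjunct1],
        rule assms(5)[unfolded associated_cocycle_def, THEN conjunct1])
  then interpret biext_morphism K X s r X' s' r' \<phi>\<^sub>0 \<phi> \<epsilon> \<epsilon>'
    by (intro biext_morphism.intro biext_pair.intro s(1) s'(1) biext_morphism_axioms.intro assms(6) s(2)[rule_format] s'(2)[rule_format])
  show ?thesis
    unfolding hoch_class_eq_iff
    by (intro conjI impI simply_transitive_action_butterfly_classes)
      (rule ex_butterfly_iff[OF assms(7), unfolded butterflies_over_def mem_Collect_eq])
qed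

end
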